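(* There exists a function $a: \mathbb{R}^2 \rightarrow \mathbb{R}$ which is a H\"ormander-Marcinkiewicz symbol of $(\phi,\psi)$ type, and which in particular satisfies $|\partial^{\vec{\alpha}} a(\vec\xi)| \leq C_{\vec{\alpha}}\, \mathrm{dist}(\vec{\xi}, \vec{0})^{-|\vec{\alpha}|}$ for all $\vec\xi\neq \vec 0$ and all multi-indices $\vec\alpha$, such that the trilinear operator $$T_m(f_1,f_2,f_3)(x)=\int_{\mathbb{R}^3} m(\xi_1,\xi_2,\xi_3)\,\hat f_1(\xi_1)\hat f_2(\xi_2)\hat f_3(\xi_3)\,e^{2\pi i x(\xi_1+\xi_2+\xi_3)}\,d\xi_1d\xi_2d\xi_3$$ (defined a priori on $\mathcal{S}(\mathbb{R})^3$) with symbol $m(\xi_1, \xi_2, \xi_3) = \mathrm{sgn}(\xi_1 + \xi_2)\, a(\xi_2, \xi_3)$ satisfies no $L^p$ estimates.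
   Context: $\mathcal{S}(\mathbb{R})$ is the Schwartz class and $\hat f(\xi)=\int_{\mathbb{R}} f(x)e^{-2\pi i x\xi}\,dx$. A symbol $a$ on $\mathbb{R}^2$ is of $(\phi,\psi)$ type if it is a sum of tensor products that are of $\phi$ type in the first variable and of $\psi$ type in the second variable: $a(\xi_1,\xi_2)=\sum_{k\in\mathbb{Z}}\hat\phi_k(\xi_1)\hat\psi_k(\xi_2)$ with $\phi_k,\psi_k\in\mathcal{S}(\mathbb{R})$ (some terms possibly zero), $\mathrm{supp}\,\hat\phi_k\subset[-2^k,2^k]$, $\mathrm{supp}\,\hat\psi_k\subset[-2^{k+1},-2^{k-1}]\cup[2^{k-1},2^{k+1}]$, and for every integer $l\ge0$ a constant $C_l$ independent of $k$ with $|\frac{d^l}{d\xi^l}\hat\phi_k(\xi)|,\ |\frac{d^l}{d\xi^l}\hat\psi_k(\xi)|\le C_l2^{-kl}$ for all $\xi$. A trilinear operator $T$ defined a priori on $\mathcal{S}(\mathbb{R})^3$ "satisfies no $L^p$ estimates" if there is no triple $(p_1,p_2,p_3)\in[1,\infty]^3$ for which there is a constant $C$ such that $\|T(f_1,f_2,f_3)\|_p\le C\prod_{j=1}^3\|f_j\|_{p_j}$ for all $f_1,f_2,f_3\in\mathcal{S}(\mathbb{R})$, where $\frac1p=\frac1{p_1}+\frac1{p_2}+\frac1{p_3}$ (with $1/\infty=0$). *)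

theory Defs
  imports "HOL-Analysis.Analysis" "HOL-Probability.Essential_Supremum"
begin

definition ddx :: "(real \<Rightarrow> complex) \<Rightarrow> real \<Rightarrow> complex" where
  "ddx f x = vector_derivative f (at x)"

definition schwartz :: "(real \<Rightarrow> complex) \<Rightarrow> bool" where
  "schwartz f \<longleftrightarrow>
     (\<forall>n x. (ddx ^^ n) f differentiable (at x)) \<and>
     (\<forall>m n. \<exists>C. \<forall>x. \<bar>x\<bar> ^ m * norm ((ddx ^^ n) f x) \<le> C)"

definition fourier :: "(real \<Rightarrow> complex) \<Rightarrow> real \<Rightarrow> complex" where
  "fourier f \<xi> = (LINT x|lborel. f x * exp (- (2 * pi * \<i> * x * \<xi>)))"

definition supp :: "('a::topological_space \<Rightarrow> 'b::zero) \<Rightarrow> 'a set" where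
  "supp f = closure {x. f x \<noteq> 0}"

text \<open>Below, a symbol on the plane is identified with a function of the pair of
  frequencies; the metric on the product type \<^typ>\<open>real \<times> real\<close> is the Euclidean one.\<close>

definition phi_psi_type :: "(real \<times> real \<Rightarrow> real) \<Rightarrow> bool" where
  "phi_psi_type a \<longleftrightarrow> (\<exists>\<phi> \<psi> :: int \<Rightarrow> real \<Rightarrow> complex.
     (\<forall>k. schwartz (\<phi> k) \<and> schwartz (\<psi> k)) \<and>
     (\<forall>k. supp (fourier (\<phi> k)) \<subseteq> {- (2 powi k) .. 2 powi k}) \<and>
     (\<forall>k. supp (fourier (\<psi> k)) \<subseteq>
        {- (2 powi (k + 1)) .. - (2 powi (k - 1))} \<union> {2 powi (k - 1) .. 2 powi (k + 1)}) \<and>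
     (\<forall>l. \<exists>C. \<forall>k \<xi>.
        norm ((ddx ^^ l) (fourier (\<phi> k)) \<xi>) \<le> C * 2 powi (- (k * int l)) \<and>
        norm ((ddx ^^ l) (fourier (\<psi> k)) \<xi>) \<le> C * 2 powi (- (k * int l))) \<and>
     (\<forall>\<xi>\<^sub>1 \<xi>\<^sub>2. ((\<lambda>k. fourier (\<phi> k) \<xi>\<^sub>1 * fourier (\<psi> k) \<xi>\<^sub>2)
        has_sum complex_of_real (a (\<xi>\<^sub>1, \<xi>\<^sub>2))) UNIV))"

definition dirderiv ::
  "'a::real_normed_vector \<Rightarrow> ('a \<Rightarrow> 'b::real_normed_vector) \<Rightarrow> 'a \<Rightarrow> 'b" where
  "dirderiv v f x = frechet_derivative f (at x) v"

text \<open>\<open>Ck_on n S f\<close>: on the open set \<open>S\<close>, \<open>f\<close> is \<open>n\<close> times differentiable and its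
  iterated directional derivatives of order up to \<open>n\<close> are continuous.\<close>

primrec Ck_on ::
  "nat \<Rightarrow> 'a::real_normed_vector set \<Rightarrow> ('a \<Rightarrow> 'b::real_normed_vector) \<Rightarrow> bool" where
  "Ck_on 0 S f \<longleftrightarrow> continuous_on S f"
| "Ck_on (Suc n) S f \<longleftrightarrow>
     (\<forall>x\<in>S. f differentiable (at x)) \<and> (\<forall>v. Ck_on n S (dirderiv v f))"

definition partial :: "nat \<times> nat \<Rightarrow> (real \<times> real \<Rightarrow> real) \<Rightarrow> real \<times> real \<Rightarrow> real" where
  "partial \<alpha> a = (dirderiv (1, 0) ^^ fst \<alpha>) ((dirderiv (0, 1) ^^ snd \<alpha>) a)"

definition hoermander_marcinkiewicz :: "(real \<times> real \<Rightarrow> real) \<Rightarrow> bool" where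
  "hoermander_marcinkiewicz a \<longleftrightarrow>
     (\<forall>n. Ck_on n (- {0}) a) \<and>
     (\<forall>\<alpha>. \<exists>C. \<forall>\<xi>. \<xi> \<noteq> 0 \<longrightarrow>
        \<bar>partial \<alpha> a \<xi>\<bar> \<le> C * dist \<xi> 0 powi (- int (fst \<alpha> + snd \<alpha>)))"

definition T_op :: "(real \<times> real \<times> real \<Rightarrow> complex) \<Rightarrow>
    (real \<Rightarrow> complex) \<Rightarrow> (real \<Rightarrow> complex) \<Rightarrow> (real \<Rightarrow> complex) \<Rightarrow> real \<Rightarrow> complex" where
  "T_op m f\<^sub>1 f\<^sub>2 f\<^sub>3 x = (LINT (\<xi>\<^sub>1, \<xi>\<^sub>2, \<xi>\<^sub>3)|lborel.
     m (\<xi>\<^sub>1, \<xi>\<^sub>2, \<xi>\<^sub>3) * fourier f\<^sub>1 \<xi>\<^sub>1 * fourier f\<^sub>2 \<xi>\<^sub>2 * fourier f\<^sub>3 \<xi>\<^sub>3 *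
     exp (2 * pi * \<i> * x * (\<xi>\<^sub>1 + \<xi>\<^sub>2 + \<xi>\<^sub>3)))"

text \<open>Lebesgue (quasi-)norms with values in \<open>[0, \<infinity>]\<close>, for exponents in \<open>(0, \<infinity>]\<close>.\<close>

definition Lp_norm :: "ennreal \<Rightarrow> (real \<Rightarrow> complex) \<Rightarrow> ennreal" where
  "Lp_norm p f =
     (if p = \<infinity> then esssup lborel (\<lambda>x. ennreal (norm (f x)))
      else (let I = (\<integral>\<^sup>+ x. ennreal (norm (f x) powr enn2real p) \<partial>lborel)
            in if I = \<infinity> then \<infinity> else ennreal (enn2real I powr (1 / enn2real p))))"

text \<open>In \<^typ>\<open>ennreal\<close> we have \<open>1 / \<infinity> = 0\<close> and \<open>1 / 0 = \<infinity>\<close>, so \<open>p\<close> below is uniquely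
  determined by \<open>p\<^sub>1, p\<^sub>2, p\<^sub>3\<close> and lies in \<open>[1/3, \<infinity>]\<close>.\<close>

definition satisfies_no_Lp_estimates ::
  "((real \<Rightarrow> complex) \<Rightarrow> (real \<Rightarrow> complex) \<Rightarrow> (real \<Rightarrow> complex) \<Rightarrow> real \<Rightarrow> complex) \<Rightarrow> bool" where
  "satisfies_no_Lp_estimates T \<longleftrightarrow>
     \<not> (\<exists>p\<^sub>1 p\<^sub>2 p\<^sub>3 p :: ennreal. 1 \<le> p\<^sub>1 \<and> 1 \<le> p\<^sub>2 \<and> 1 \<le> p\<^sub>3 \<and>
          1 / p = 1 / p\<^sub>1 + 1 / p\<^sub>2 + 1 / p\<^sub>3 \<and>
          (\<exists>C::real. \<forall>f\<^sub>1 f\<^sub>2 f\<^sub>3. schwartz f\<^sub>1 \<and> schwartz f\<^sub>2 \<and> schwartz f\<^sub>3 \<longrightarrow>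
             Lp_norm p (T f\<^sub>1 f\<^sub>2 f\<^sub>3)
               \<le> ennreal C * (Lp_norm p\<^sub>1 f\<^sub>1 * Lp_norm p\<^sub>2 f\<^sub>2 * Lp_norm p\<^sub>3 f\<^sub>3)))"

end

theory Submission
  imports Defs "HOL-Probability.Probability"
begin

text \<open>
  Write \<open>g\<close> for the inverse Fourier transform of a bump and let \<open>f\<^sub>1\<close>, \<open>f\<^sub>2\<close>, \<open>f\<^sub>3\<close> be sums
  over \<open>j < N\<close> of copies of \<open>g\<close> translated to \<open>L j\<close>, modulated to the frequencies
  \<open>- \<lambda>\<^sub>j\<close>, \<open>\<lambda>\<^sub>j\<close>, \<open>2\<^sup>j\<close> with \<open>\<lambda>\<^sub>j \<sim> 2\<^sup>j\<close>. For the symbol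
  \<open>\<Sum>\<^sub>k \<Phi>(\<xi>\<^sub>2 / 2\<^sup>k) \<Psi>(\<xi>\<^sub>3 / 2\<^sup>k)\<close> the \<open>k\<close>-th packet of \<open>f\<^sub>3\<close> gets
  multiplied by the sum over \<open>j < k\<close> of the Hilbert transforms of \<open>f\<^sub>1\<close> times the \<open>j\<close>-th packet
  of \<open>f\<^sub>2\<close>. The off-diagonal products have frequencies far from zero and contribute \<open>O(1)\<close>, whereas
  the diagonal ones are unmodulated bumps at \<open>L j\<close> whose Hilbert transforms decay only like
  \<open>1 / (x - L j)\<close> and add up to \<open>log k\<close> near \<open>L k\<close>. So the output is at least of size
  \<open>log N\<close> on a set of measure \<open>\<sim> N\<close>, while each input is bounded with \<open>L\<^sup>1\<close> norm \<open>O(N)\<close>: this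
  contradicts every estimate with Hoelder exponents, because the Hilbert transform is unbounded on
  \<open>l\<^sup>1\<close>-valued functions.
\<close>

subsection \<open>Smooth functions and a plateau bump\<close>

text \<open>The symbol has to break a symmetry. The symbol lets only j < k pass, and since positions
  increase together with frequencies, every surviving centre L j lies to the left of L k, so all
  tails have the same sign. The size of the gain is irrelevant: a bounded function with integral
  O(N) has L^q norm O(N^(1/q)) for every q >= 1, an output that is large on a set of measure
  comparable to N has norm at least a multiple of N^(1/p), and the relation between the exponents
  makes the powers of N cancel. Any unbounded factor then refutes the estimate, and one family of
  inputs serves all exponents. The lower bound on the output uses only the measure of the set where
  it is large, never a triangle inequality, so it covers the range 1/3 <= p < 1 as well. Frequency
  supports are compact and the scales are chosen so that the symbol is exactly 0 or exactly 1 on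
  each pair of packets. The operator is therefore computed by an identity, and errors arise only
  from the spatial tails of the packets.\<close>

coinductive smooth :: "(real \<Rightarrow> 'a::real_normed_vector) \<Rightarrow> bool" where
  smooth_step: "\<lbrakk>\<And>x. (f has_vector_derivative f' x) (at x); smooth f'\<rbrakk> \<Longrightarrow> smooth f"

text \<open>Infinite differentiability is a greatest fixed point, so every family closed under
  differentiation consists of smooth functions. Most closure properties below exhibit such a family
  and never compute an n-th derivative.\<close>

lemma smooth_coinduct_derivative:
  assumes "P f"
    and "\<And>f. P f \<Longrightarrow> \<exists>f'. (\<forall>x. (f has_vector_derivative f' x) (at x)) \<and> P f'"
  shows "smooth f"
  using assms(1)
proof (coinduction arbitrary: f)
  case smooth
  obtain f' where "\<forall>x. (f has_vector_derivative f' x) (at x)" "P f'"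
    using assms(2)[OF smooth] by (elim exE conjE)
  then show ?case
    by (intro exI[of _ f] exI[of _ f']) simp
qed

lemma smooth_vector_derivative:
  assumes "smooth f"
  shows "(f has_vector_derivative vector_derivative f (at x)) (at x)"
    and "smooth (\<lambda>x. vector_derivative f (at x))"
proof -
  obtain f' where f': "\<And>x. (f has_vector_derivative f' x) (at x)" "smooth f'"
    using assms by (cases rule: smooth.cases) (rule that)
  have eq: "(\<lambda>x. vector_derivative f (at x)) = f'"
    by (rule ext) (rule vector_derivative_at[OF f'(1)])
  show "smooth (\<lambda>x. vector_derivative f (at x))"
    unfolding eq by (rule f')
  show "(f has_vector_derivative vector_derivative f (at x)) (at x)"
    unfolding fun_cong[OF eq] by (rule f')
qed

lemma smooth_imp_continuous:
  assumes "smooth f" shows "continuous_on A f"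
  by (intro continuous_at_imp_continuous_on ballI
      has_vector_derivative_continuous[OF smooth_vector_derivative(1)[OF assms]])

lemma smooth_borel_measurable: "smooth f \<Longrightarrow> f \<in> borel_measurable borel"
  by (simp add: borel_measurable_continuous_onI smooth_imp_continuous)

lemma smooth_const: "smooth (\<lambda>_. c)"
proof (rule smooth_coinduct_derivative[where P = "\<lambda>f. \<exists>c. f = (\<lambda>_. c)"])
  fix f :: "real \<Rightarrow> 'a" assume "\<exists>c. f = (\<lambda>_. c)"
  then obtain c where "f = (\<lambda>_. c)" by (elim exE)
  then show "\<exists>f'. (\<forall>x. (f has_vector_derivative f' x) (at x)) \<and> (\<exists>c. f' = (\<lambda>_. c))"
    by (intro exI[of _ "\<lambda>_. 0"]) auto
qed auto

lemma smooth_affine: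
  assumes "smooth f" shows "smooth (\<lambda>x. f (a * x + b))"
proof (rule smooth_coinduct_derivative
    [where P = "\<lambda>g. \<exists>c f. smooth f \<and> g = (\<lambda>x. c *\<^sub>R f (a * x + b))"])
  show "\<exists>c g. smooth g \<and> (\<lambda>x. f (a * x + b)) = (\<lambda>x. c *\<^sub>R g (a * x + b))"
    using assms by (intro exI[of _ 1] exI[of _ f]) simp
next
  fix g :: "real \<Rightarrow> 'a" assume "\<exists>c f. smooth f \<and> g = (\<lambda>x. c *\<^sub>R f (a * x + b))"
  then obtain c f where f: "smooth f" and g: "g = (\<lambda>x. c *\<^sub>R f (a * x + b))"
    by (elim exE conjE)
  let ?f' = "\<lambda>x. vector_derivative f (at x)"
  have "(g has_vector_derivative (c * a) *\<^sub>R ?f' (a * x + b)) (at x)" for x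
  proof -
    have "((\<lambda>x. f (a * x + b)) has_vector_derivative a *\<^sub>R ?f' (a * x + b)) (at x)"
      by (rule vector_diff_chain_at[unfolded o_def, OF _ smooth_vector_derivative(1)[OF f]])
        (auto intro!: derivative_eq_intros)
    then show ?thesis
      unfolding g scaleR_scaleR[symmetric]
      by (rule bounded_linear.has_vector_derivative[OF bounded_linear_scaleR_right])
  qed
  then show "\<exists>g'. (\<forall>x. (g has_vector_derivative g' x) (at x)) \<and>
      (\<exists>c f. smooth f \<and> g' = (\<lambda>x. c *\<^sub>R f (a * x + b)))"
    using smooth_vector_derivative(2)[OF f]
    by (intro exI[of _ "\<lambda>x. (c * a) *\<^sub>R ?f' (a * x + b)"] conjI allI exI[of _ "c * a"] exI[of _ ?f'])
      simp_all
qed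

lemma smooth_bounded_linear:
  assumes "bounded_linear h" and "smooth f"
  shows "smooth (\<lambda>x. h (f x))"
proof (rule smooth_coinduct_derivative[where P = "\<lambda>g. \<exists>f. smooth f \<and> g = (\<lambda>x. h (f x))"])
  show "\<exists>g. smooth g \<and> (\<lambda>x. h (f x)) = (\<lambda>x. h (g x))"
    using assms by (intro exI[of _ f]) simp
next
  fix g assume "\<exists>f. smooth f \<and> g = (\<lambda>x. h (f x))"
  then obtain f where f: "smooth f" and g: "g = (\<lambda>x. h (f x))"
    by (elim exE conjE)
  let ?f' = "\<lambda>x. vector_derivative f (at x)"
  show "\<exists>g'. (\<forall>x. (g has_vector_derivative g' x) (at x)) \<and> (\<exists>f. smooth f \<and> g' = (\<lambda>x. h (f x)))"
    using bounded_linear.has_vector_derivative[OF assms(1) smooth_vector_derivative(1)[OF f]]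
      smooth_vector_derivative(2)[OF f]
    by (intro exI[of _ "\<lambda>x. h (?f' x)"] conjI allI exI[of _ ?f']) (simp_all add: g)
qed

lemma smooth_of_real: "smooth f \<Longrightarrow> smooth (\<lambda>x. complex_of_real (f x))"
  by (rule smooth_bounded_linear[OF bounded_linear_of_real])

lemma smooth_add:
  assumes "smooth f" "smooth g"
  shows "smooth (\<lambda>x. f x + g x)"
proof (rule smooth_coinduct_derivative
    [where P = "\<lambda>h. \<exists>f g. smooth f \<and> smooth g \<and> h = (\<lambda>x. f x + g x)"])
  show "\<exists>f1 g1. smooth f1 \<and> smooth g1 \<and> (\<lambda>x. f x + g x) = (\<lambda>x. f1 x + g1 x)"
    using assms by (intro exI[of _ f] exI[of _ g]) simp
next
  fix h :: "real \<Rightarrow> 'a" assume "\<exists>f g. smooth f \<and> smooth g \<and> h = (\<lambda>x. f x + g x)"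
  then obtain f g where fg: "smooth f" "smooth g" and h: "h = (\<lambda>x. f x + g x)"
    by (elim exE conjE)
  note d = smooth_vector_derivative[OF fg(1)] smooth_vector_derivative[OF fg(2)]
  show "\<exists>h'. (\<forall>x. (h has_vector_derivative h' x) (at x)) \<and>
      (\<exists>f g. smooth f \<and> smooth g \<and> h' = (\<lambda>x. f x + g x))"
    unfolding h
    by (intro exI conjI allI, rule has_vector_derivative_add[OF d(1) d(3)], rule d(2), rule d(4), rule refl)
qed

text \<open>The product rule turns a product into a sum of two products; finite sums of products are
  therefore the invariant family to use for coinduction.\<close>

inductive sum_of_products :: "(real \<Rightarrow> 'a::real_normed_algebra) \<Rightarrow> bool" where
  "smooth f \<Longrightarrow> smooth g \<Longrightarrow> sum_of_products (\<lambda>x. f x * g x)"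
| "sum_of_products f \<Longrightarrow> sum_of_products g \<Longrightarrow> sum_of_products (\<lambda>x. f x + g x)"

lemma sum_of_products_derivative:
  "sum_of_products f \<Longrightarrow>
    \<exists>f'. (\<forall>x. (f has_vector_derivative f' x) (at x)) \<and> sum_of_products f'"
proof (induction rule: sum_of_products.induct)
  case (1 f g)
  note d = smooth_vector_derivative[OF 1(1)] smooth_vector_derivative[OF 1(2)]
  show ?case
    by (intro exI conjI allI, rule has_vector_derivative_mult[OF d(1) d(3)],
        rule sum_of_products.intros(2)[OF sum_of_products.intros(1)[OF 1(1) d(4)]
          sum_of_products.intros(1)[OF d(2) 1(2)]])
next
  case (2 f g)
  then obtain f' g' where "\<forall>x. (f has_vector_derivative f' x) (at x)" "sum_of_products f'"
    "\<forall>x. (g has_vector_derivative g' x) (at x)" "sum_of_products g'"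
    by (elim exE conjE)
  then show ?case
    by (intro exI[of _ "\<lambda>x. f' x + g' x"] conjI allI has_vector_derivative_add
        sum_of_products.intros(2)) simp_all
qed

lemma smooth_mult:
  fixes f g :: "real \<Rightarrow> 'a::real_normed_algebra"
  assumes "smooth f" "smooth g"
  shows "smooth (\<lambda>x. f x * g x)"
  by (rule smooth_coinduct_derivative[where P = sum_of_products,
        OF sum_of_products.intros(1)[OF assms] sum_of_products_derivative])

text \<open>The quotient rule sends u / g^n to (u' g - n u g') / g^(n+1), so fractions whose
  denominator is a power of the fixed \<open>g\<close> form an invariant family.\<close>

lemma smooth_divide:
  fixes f g :: "real \<Rightarrow> real"
  assumes "smooth f" "smooth g" "\<And>x. g x \<noteq> 0"
  shows "smooth (\<lambda>x. f x / g x)"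
proof (rule smooth_coinduct_derivative
    [where P = "\<lambda>h. \<exists>n u. smooth u \<and> h = (\<lambda>x. u x / g x ^ n)"])
  show "\<exists>n u. smooth u \<and> (\<lambda>x. f x / g x) = (\<lambda>x. u x / g x ^ n)"
    using assms(1) by (intro exI[of _ 1] exI[of _ f]) simp
next
  fix h assume "\<exists>n u. smooth u \<and> h = (\<lambda>x. u x / g x ^ n)"
  then obtain n u where u: "smooth u" and h: "h = (\<lambda>x. u x / g x ^ n)"
    by (elim exE conjE)
  let ?u' = "\<lambda>x. vector_derivative u (at x)" and ?g' = "\<lambda>x. vector_derivative g (at x)"
  let ?v = "\<lambda>x. ?u' x * g x + (- real n) * (u x * ?g' x)"
  have "(h has_vector_derivative ?v x / g x ^ Suc n) (at x)" for x
  proof (cases n)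
    case 0
    then show ?thesis using smooth_vector_derivative(1)[OF u] assms(3) by (simp add: h)
  next
    case (Suc k)
    have du: "(u has_real_derivative ?u' x) (at x)" and dg: "(g has_real_derivative ?g' x) (at x)"
      using smooth_vector_derivative(1)[OF u] smooth_vector_derivative(1)[OF assms(2)]
      by (simp_all add: has_real_derivative_iff_has_vector_derivative)
    have "(h has_real_derivative
        (?u' x * g x ^ n - u x * (real n * (?g' x * g x ^ k))) / (g x ^ n * g x ^ n)) (at x)"
      using DERIV_divide[OF du DERIV_power[OF dg, of n]] assms(3)[of x] by (simp add: h Suc)
    also have "(?u' x * g x ^ n - u x * (real n * (?g' x * g x ^ k))) / (g x ^ n * g x ^ n) =
        (g x ^ k * ?v x) / (g x ^ k * (g x * (g x * g x ^ k)))"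
      by (intro arg_cong2[where f = "(/)"]) (simp_all add: Suc algebra_simps del: of_nat_Suc)
    also have "\<dots> = ?v x / g x ^ Suc n"
      using assms(3)[of x] by (subst mult_divide_mult_cancel_left) (auto simp: Suc)
    finally have "(h has_real_derivative ?v x / g x ^ Suc n) (at x)" .
    then show ?thesis by (simp add: has_real_derivative_iff_has_vector_derivative)
  qed
  moreover have "smooth ?v"
    by (intro smooth_add smooth_mult smooth_const smooth_vector_derivative u assms)
  ultimately show "\<exists>h'. (\<forall>x. (h has_vector_derivative h' x) (at x)) \<and>
      (\<exists>n u. smooth u \<and> h' = (\<lambda>x. u x / g x ^ n))"
    by (intro exI[of _ "\<lambda>x. ?v x / g x ^ Suc n"] conjI allI exI[of _ "Suc n"] exI[of _ ?v]) simp_all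
qed

lemma smooth_exp: "smooth (\<lambda>x. exp (c * complex_of_real x))"
proof (rule smooth_coinduct_derivative
    [where P = "\<lambda>f. \<exists>k. f = (\<lambda>x. k * exp (c * complex_of_real x))"])
  show "\<exists>k. (\<lambda>x. exp (c * complex_of_real x)) = (\<lambda>x. k * exp (c * complex_of_real x))"
    by (intro exI[of _ 1]) simp
next
  fix f assume "\<exists>k. f = (\<lambda>x. k * exp (c * complex_of_real x))"
  then obtain k where f: "f = (\<lambda>x. k * exp (c * complex_of_real x))" by (elim exE)
  have "(f has_vector_derivative (k * c) * exp (c * complex_of_real x)) (at x)" for x
    unfolding f by (rule has_vector_derivative_real_field) (auto intro!: derivative_eq_intros)
  then show "\<exists>f'. (\<forall>x. (f has_vector_derivative f' x) (at x)) \<and>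
      (\<exists>k. f' = (\<lambda>x. k * exp (c * complex_of_real x)))"
    by (intro exI[of _ "\<lambda>x. (k * c) * exp (c * complex_of_real x)"] conjI allI exI[of _ "k * c"])
      simp_all
qed

lemma smooth_ident: "smooth complex_of_real"
  by (rule smooth_step[of _ "\<lambda>_. 1"])
    (auto intro!: smooth_const derivative_eq_intros has_vector_derivative_of_real)

section \<open>The plateau bump built from exp(-1/x)\<close>

definition flat :: "real poly \<Rightarrow> real \<Rightarrow> real" where
  "flat p x = (if x > 0 then poly p (1 / x) * exp (- (1 / x)) else 0)"

lemma poly_mult_exp_minus_at_top: "((\<lambda>y. poly p y * exp (- y)) \<longlongrightarrow> (0::real)) at_top"
proof -
  have "((\<lambda>y. \<Sum>i\<le>degree p. coeff p i * (y ^ i / exp y)) \<longlongrightarrow> (\<Sum>i\<le>degree p. coeff p i * (0::real))) at_top"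
    by (intro tendsto_sum tendsto_mult tendsto_const tendsto_power_div_exp_0)
  then show ?thesis
    by (simp add: poly_altdef sum_distrib_right exp_minus divide_inverse mult.assoc)
qed

text \<open>With y = 1/x, differentiating p(y) exp(-y) in x gives y^2 (p - p')(y) exp(-y), and
  \<open>[:0, 0, 1:]\<close> is the polynomial y^2. Admitting all polynomials makes the family
  invariant under differentiation.\<close>

lemma flat_derivative:
  "(flat p has_vector_derivative flat ([:0, 0, 1:] * (p - pderiv p)) x) (at x)"
proof -
  consider "x > 0" | "x < 0" | "x = 0" by linarith
  then have "(flat p has_real_derivative flat ([:0, 0, 1:] * (p - pderiv p)) x) (at x)"
  proof cases
    case 1
    have "((\<lambda>x. poly p (1 / x) * exp (- (1 / x))) has_real_derivative
        flat ([:0, 0, 1:] * (p - pderiv p)) x) (at x)"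
    proof -
      have "((\<lambda>x. poly p (1 / x) * exp (- (1 / x))) has_real_derivative
          poly (pderiv p) (1 / x) * (- 1 / x^2) * exp (- (1 / x)) +
          poly p (1 / x) * (exp (- (1 / x)) * (1 / x^2))) (at x)"
        using 1 by (auto intro!: derivative_eq_intros DERIV_chain2[OF poly_DERIV] simp: power2_eq_square)
      moreover have "flat ([:0, 0, 1:] * (p - pderiv p)) x =
          poly (pderiv p) (1 / x) * (- 1 / x^2) * exp (- (1 / x)) +
          poly p (1 / x) * (exp (- (1 / x)) * (1 / x^2))"
        using 1 by (simp add: flat_def power2_eq_square algebra_simps)
      ultimately show ?thesis by simp
    qed
    then show ?thesis
      by (rule has_field_derivative_transform_within_open[where S = "{0<..}"])
        (use 1 in \<open>auto simp: flat_def\<close>)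
  next
    case 2
    have "((\<lambda>x. 0) has_real_derivative flat ([:0, 0, 1:] * (p - pderiv p)) x) (at x)"
      using 2 by (simp add: flat_def)
    then show ?thesis
      by (rule has_field_derivative_transform_within_open[where S = "{..<0}"])
        (use 2 in \<open>auto simp: flat_def\<close>)
  next
    case 3
    have "((\<lambda>h. flat p h / h) \<longlongrightarrow> 0) (at_right 0)"
    proof -
      \<comment> \<open>For y = 1/h the right-hand difference quotient at 0 is y p(y) exp(-y), and
        \<open>pCons 0 p\<close> is the polynomial y p(y).\<close>
      have "((\<lambda>h. poly (pCons 0 p) (inverse h) * exp (- inverse h)) \<longlongrightarrow> (0::real)) (at_right 0)"
        by (rule filterlim_compose[OF poly_mult_exp_minus_at_top filterlim_inverse_at_top_right])
      then show ?thesis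
        by (rule Lim_transform_eventually)
          (auto simp: eventually_at_filter flat_def divide_inverse)
    qed
    moreover have "((\<lambda>h. flat p h / h) \<longlongrightarrow> 0) (at_left 0)"
      by (rule Lim_transform_eventually[OF tendsto_const])
        (auto simp: eventually_at_filter flat_def)
    ultimately have "((\<lambda>h. flat p h / h) \<longlongrightarrow> 0) (at 0)"
      by (simp add: filterlim_split_at)
    then show ?thesis
      using 3 by (simp add: has_field_derivative_iff flat_def)
  qed
  then show ?thesis by (simp add: has_real_derivative_iff_has_vector_derivative)
qed

lemma smooth_flat: "smooth (flat p)"
proof (rule smooth_coinduct_derivative[where P = "\<lambda>f. \<exists>p. f = flat p"])
  fix f assume "\<exists>p. f = flat p"
  then obtain p where f: "f = flat p" by (elim exE)
  show "\<exists>f'. (\<forall>x. (f has_vector_derivative f' x) (at x)) \<and> (\<exists>p. f' = flat p)"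
    using flat_derivative[of p] unfolding f
    by (intro exI[of _ "flat ([:0, 0, 1:] * (p - pderiv p))"] conjI allI exI) simp_all
qed auto

text \<open>A smooth transition from 0 on the half-line x <= 0 to 1 on the half-line x >= 1.\<close>

definition smooth_ramp :: "real \<Rightarrow> real" where
  "smooth_ramp x = flat 1 x / (flat 1 x + flat 1 (1 - x))"

lemma flat_1_sum_pos: "flat 1 x + flat 1 (1 - x) > 0"
  by (auto simp: flat_def add_pos_pos)

lemma smooth_smooth_ramp: "smooth smooth_ramp"
proof -
  have "smooth (\<lambda>x. flat 1 (1 - x))"
    using smooth_affine[OF smooth_flat, of 1 "-1" 1] by simp
  then have "smooth (\<lambda>x. flat 1 x / (flat 1 x + flat 1 (1 - x)))"
    by (intro smooth_divide smooth_add smooth_flat) (use flat_1_sum_pos in \<open>auto simp: less_le\<close>)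
  then show ?thesis by (simp add: smooth_ramp_def[abs_def])
qed

text \<open>The rescaled ramps produce the value 1 for |x| <= 3/4 and 0 for |x| >= 1. Both regions
  matter: they are what makes the symbol exactly 1 or exactly 0 on a pair of packets.\<close>

definition bump :: "real \<Rightarrow> real" where
  "bump x = smooth_ramp (4 * x + 4) * smooth_ramp (- 4 * x + 4)"

lemma smooth_bump: "smooth bump"
  unfolding bump_def[abs_def]
  by (intro smooth_mult smooth_affine smooth_smooth_ramp)

lemma bump_eq_0: "\<bar>x\<bar> \<ge> 1 \<Longrightarrow> bump x = 0"
  by (auto simp: bump_def smooth_ramp_def flat_def abs_if split: if_splits)

lemma bump_eq_1:
  assumes "\<bar>x\<bar> \<le> 3 / 4" shows "bump x = 1"
proof -
  have "smooth_ramp y = 1" if "y \<ge> 1" for y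
    using that by (simp add: smooth_ramp_def flat_def)
  then show ?thesis using assms by (simp add: bump_def)
qed

lemma bump_nonneg: "bump x \<ge> 0"
proof -
  have "smooth_ramp y \<ge> 0" for y
    using flat_1_sum_pos[of y] by (simp add: smooth_ramp_def flat_def)
  then show ?thesis by (simp add: bump_def)
qed

subsection \<open>Fourier inversion for test functions\<close>

definition test_function :: "(real \<Rightarrow> complex) \<Rightarrow> bool" where
  "test_function b \<longleftrightarrow> smooth b \<and> (\<exists>R. \<forall>x. \<bar>x\<bar> \<ge> R \<longrightarrow> b x = 0)"

lemma test_functionI: "smooth b \<Longrightarrow> (\<And>x. \<bar>x\<bar> \<ge> R \<Longrightarrow> b x = 0) \<Longrightarrow> test_function b"
  unfolding test_function_def by blast

lemma test_functionE:
  assumes "test_function b"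
  obtains R where "R > 0" "smooth b" "\<And>x. \<bar>x\<bar> \<ge> R \<Longrightarrow> b x = 0"
proof -
  from assms obtain R where R: "smooth b" "\<And>x. \<bar>x\<bar> \<ge> R \<Longrightarrow> b x = 0"
    unfolding test_function_def by blast
  show thesis
    by (rule that[of "max 1 R"]) (use R in auto)
qed

lemma test_function_mult_smooth:
  assumes "test_function b" "smooth u"
  shows "test_function (\<lambda>x. u x * b x)"
proof -
  obtain R where "smooth b" "\<And>x. \<bar>x\<bar> \<ge> R \<Longrightarrow> b x = 0"
    using assms(1) by (rule test_functionE) (use that in blast)
  then show ?thesis
    using assms(2) by (intro test_functionI[of _ R] smooth_mult) auto
qed

lemma test_function_add:
  assumes "test_function b" "test_function c"
  shows "test_function (\<lambda>x. b x + c x)"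
proof -
  obtain R S where "\<And>x. \<bar>x\<bar> \<ge> R \<Longrightarrow> b x = 0" "\<And>x. \<bar>x\<bar> \<ge> S \<Longrightarrow> c x = 0" "smooth b" "smooth c"
    using assms by (metis test_functionE)
  then show ?thesis
    by (intro test_functionI[of _ "max R S"] smooth_add) auto
qed

lemma test_function_0: "test_function (\<lambda>_. 0)"
  by (rule test_functionI) (auto intro: smooth_const)

lemma test_function_sum:
  "(\<And>i. i \<in> I \<Longrightarrow> test_function (b i)) \<Longrightarrow> test_function (\<lambda>x. \<Sum>i\<in>I. b i x)"
  by (induction I rule: infinite_finite_induct) (auto intro: test_function_0 test_function_add)

lemma test_function_affine:
  assumes "test_function b" "c \<noteq> 0"
  shows "test_function (\<lambda>x. b (c * x + d))"
proof -
  obtain R where R: "smooth b" "\<And>x. \<bar>x\<bar> \<ge> R \<Longrightarrow> b x = 0"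
    using assms(1) by (rule test_functionE) (use that in blast)
  show ?thesis
  proof (rule test_functionI[of _ "(R + \<bar>d\<bar>) / \<bar>c\<bar>"])
    show "smooth (\<lambda>x. b (c * x + d))" by (intro smooth_affine R)
    fix x assume "(R + \<bar>d\<bar>) / \<bar>c\<bar> \<le> \<bar>x\<bar>"
    then have "R + \<bar>d\<bar> \<le> \<bar>c * x\<bar>"
      using assms(2) by (simp add: divide_le_eq abs_mult mult.commute)
    then show "b (c * x + d) = 0" by (intro R) arith
  qed
qed

lemma has_vector_derivative_eq_0_outside:
  assumes "(f has_vector_derivative f') (at x)" "\<And>x. \<bar>x\<bar> \<ge> R \<Longrightarrow> f x = 0" "\<bar>x\<bar> > R"
  shows "f' = 0"
proof -
  have "((\<lambda>_. 0) has_vector_derivative f') (at x)"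
  proof (rule has_vector_derivative_transform_within_open[OF assms(1)])
    show "open {x. R < \<bar>x\<bar>}"
      by (intro open_Collect_less continuous_intros)
  qed (use assms in auto)
  then show ?thesis
    using vector_derivative_unique_at has_vector_derivative_const by metis
qed

lemma test_function_derivative:
  assumes "test_function b"
  shows "test_function (\<lambda>x. vector_derivative b (at x))"
proof -
  obtain R where R: "smooth b" "\<And>x. \<bar>x\<bar> \<ge> R \<Longrightarrow> b x = 0"
    using assms by (rule test_functionE) (use that in blast)
  \<comment> \<open>The derivative is shown to vanish only on the open set |x| > R, hence the radius
    \<open>R + 1\<close>.\<close>
  then show ?thesis
    by (intro test_functionI[of _ "R + 1"] smooth_vector_derivative)
      (auto intro!: has_vector_derivative_eq_0_outside[OF smooth_vector_derivative(1)[OF R(1)] R(2)])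
qed

lemma compact_support_integral:
  fixes f :: "real \<Rightarrow> complex"
  assumes "continuous_on UNIV f" "\<And>x. \<bar>x\<bar> \<ge> R \<Longrightarrow> f x = 0"
  shows "integrable lborel f" "(LINT x|lborel. f x) = integral {-R..R} f"
proof -
  have eq: "(\<lambda>x. indicator {-R..R} x *\<^sub>R f x) = f"
  proof
    fix x
    show "indicator {-R..R} x *\<^sub>R f x = f x"
      using assms(2)[of x] by (cases "R \<le> \<bar>x\<bar>") (auto simp: indicator_def)
  qed
  have int: "set_integrable lborel {-R..R} f"
    by (intro borel_integrable_atLeastAtMost' continuous_on_subset[OF assms(1)]) simp
  show "integrable lborel f"
    by (rule int[unfolded set_integrable_def eq])
  show "(LINT x|lborel. f x) = integral {-R..R} f"
    by (rule set_borel_integral_eq_integral(2)[OF int, unfolded set_lebesgue_integral_def eq])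
qed

lemma test_function_integrable:
  assumes "test_function b" shows "integrable lborel b"
  using assms by (rule test_functionE) (rule compact_support_integral(1)[OF smooth_imp_continuous])

lemma test_function_bounded:
  assumes "test_function b"
  shows "\<exists>B>0. \<forall>x. norm (b x) \<le> B"
proof -
  obtain R where R: "smooth b" "\<And>x. \<bar>x\<bar> \<ge> R \<Longrightarrow> b x = 0"
    using assms by (rule test_functionE) (use that in blast)
  have "bounded (b ` {-R..R})"
    by (intro compact_imp_bounded compact_continuous_image smooth_imp_continuous R) auto
  then obtain B where "B > 0" "\<forall>x\<in>{-R..R}. norm (b x) \<le> B"
    by (auto simp: bounded_pos)
  moreover have "norm (b x) \<le> B" for x
  proof (cases "R \<le> \<bar>x\<bar>")
    case False
    then have "x \<in> {-R..R}" by auto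
    with calculation show ?thesis by blast
  qed (use R(2) calculation in auto)
  ultimately show ?thesis by blast
qed

section \<open>Inverse Fourier transforms of test functions\<close>

definition inv_fourier :: "(real \<Rightarrow> complex) \<Rightarrow> real \<Rightarrow> complex" where
  "inv_fourier b x = (LINT \<xi>|lborel. b \<xi> * exp (2 * pi * \<i> * x * \<xi>))"

lemma norm_exp_fourier [simp]:
  "norm (exp (2 * complex_of_real pi * \<i> * complex_of_real x * complex_of_real y)) = 1"
  by (simp add: norm_exp_eq_Re)

lemma smooth_exp_fourier: "smooth (\<lambda>\<xi>. exp (2 * pi * \<i> * (x::real) * \<xi>))"
  by (rule smooth_exp)

lemma inv_fourier_integrable:
  "test_function b \<Longrightarrow> integrable lborel (\<lambda>\<xi>. b \<xi> * exp (2 * pi * \<i> * (x::real) * \<xi>))"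
  using test_function_integrable[OF test_function_mult_smooth[OF _ smooth_exp_fourier[of x]]]
  by (simp add: mult.commute)

lemma norm_inv_fourier_le: "norm (inv_fourier b x) \<le> (LINT \<xi>|lborel. norm (b \<xi>))"
  unfolding inv_fourier_def
  by (rule order_trans[OF integral_norm_bound]) (simp add: norm_mult)

text \<open>Compact support turns the integral over the line into one over a fixed interval, where a
  jointly continuous partial derivative permits differentiation under the integral sign.\<close>

lemma inv_fourier_derivative:
  assumes "test_function b"
  shows "(inv_fourier b has_vector_derivative inv_fourier (\<lambda>\<xi>. 2 * pi * \<i> * \<xi> * b \<xi>) x) (at x)"
proof -
  obtain R where R: "R > 0" "smooth b" "\<And>x. \<bar>x\<bar> \<ge> R \<Longrightarrow> b x = 0"
    using assms by (rule test_functionE) (use that in blast)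
  note cont = smooth_imp_continuous[OF R(2)]
    continuous_on_compose2[OF smooth_imp_continuous[OF R(2)], where f = snd]
  have "((\<lambda>x. integral (cbox (-R) R) (\<lambda>\<xi>. b \<xi> * exp (2 * pi * \<i> * x * \<xi>)))
      has_vector_derivative integral (cbox (-R) R)
        (\<lambda>\<xi>. 2 * pi * \<i> * \<xi> * b \<xi> * exp (2 * pi * \<i> * x * \<xi>))) (at x within UNIV)"
  proof (rule leibniz_rule_vector_derivative
      [where fx = "\<lambda>x \<xi>. 2 * pi * \<i> * \<xi> * b \<xi> * exp (2 * pi * \<i> * x * \<xi>)"])
    fix x t :: real
    show "((\<lambda>x::real. b t * exp (2 * pi * \<i> * x * t)) has_vector_derivative
        2 * pi * \<i> * t * b t * exp (2 * pi * \<i> * x * t)) (at x within UNIV)"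
      by (rule has_vector_derivative_real_field) (auto intro!: derivative_eq_intros)
    show "(\<lambda>\<xi>. b \<xi> * exp (2 * pi * \<i> * x * \<xi>)) integrable_on cbox (- R) R"
      by (intro integrable_continuous continuous_intros cont)
    show "continuous_on (UNIV \<times> cbox (- R) R)
       (\<lambda>(x, t). 2 * pi * \<i> * complex_of_real t * b t * exp (2 * pi * \<i> * complex_of_real x * t))"
      unfolding split_beta by (intro continuous_intros cont) auto
  qed auto
  moreover have "inv_fourier b = (\<lambda>x. integral (cbox (-R) R) (\<lambda>\<xi>. b \<xi> * exp (2 * pi * \<i> * x * \<xi>)))"
    unfolding inv_fourier_def
    by (intro ext, subst compact_support_integral(2)[of _ R])
      (intro continuous_intros cont, simp_all add: R(3))
  moreover have "inv_fourier (\<lambda>\<xi>. 2 * pi * \<i> * \<xi> * b \<xi>) x =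
      integral (cbox (-R) R) (\<lambda>\<xi>. 2 * pi * \<i> * \<xi> * b \<xi> * exp (2 * pi * \<i> * x * \<xi>))"
    unfolding inv_fourier_def
    by (subst compact_support_integral(2)[of _ R])
      (intro continuous_intros cont, simp_all add: R(3))
  ultimately show ?thesis by simp
qed

lemma inv_fourier_continuous: "test_function b \<Longrightarrow> continuous_on A (inv_fourier b)"
  by (intro continuous_at_imp_continuous_on ballI
      has_vector_derivative_continuous[OF inv_fourier_derivative])

text \<open>Integration by parts: the derivative of b(\<xi>) exp(2 \<pi> i x \<xi>) integrates to
  zero, because \<open>b\<close> vanishes at both ends of a long interval.\<close>

lemma inv_fourier_of_derivative:
  assumes "test_function b"
  shows "inv_fourier (\<lambda>\<xi>. vector_derivative b (at \<xi>)) x = - (2 * pi * \<i> * x) * inv_fourier b x"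
proof -
  let ?b' = "\<lambda>\<xi>. vector_derivative b (at \<xi>)" and ?e = "\<lambda>\<xi>. exp (2 * pi * \<i> * x * \<xi>)"
  obtain R where R: "R > 0" "smooth b" "\<And>x. \<bar>x\<bar> \<ge> R \<Longrightarrow> b x = 0"
    using assms by (rule test_functionE) (use that in blast)
  obtain S where S: "S > 0" "smooth ?b'" "\<And>x. \<bar>x\<bar> \<ge> S \<Longrightarrow> ?b' x = 0"
    using test_function_derivative[OF assms] by (rule test_functionE) (use that in blast)
  let ?f = "\<lambda>\<xi>. ?b' \<xi> * ?e \<xi> + 2 * pi * \<i> * x * (b \<xi> * ?e \<xi>)"
  define Q where "Q = max R S"
  have "((\<lambda>\<xi>. b \<xi> * ?e \<xi>) has_vector_derivative ?f \<xi>) (at \<xi> within {-Q..Q})" for \<xi>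
  proof -
    have "(?e has_vector_derivative 2 * pi * \<i> * x * ?e \<xi>) (at \<xi>)"
      by (rule has_vector_derivative_real_field) (auto intro!: derivative_eq_intros)
    from has_vector_derivative_mult[OF smooth_vector_derivative(1)[OF R(2)] this]
    show ?thesis
      by (rule has_vector_derivative_at_within[OF has_vector_derivative_eq_rhs])
        (simp add: algebra_simps)
  qed
  then have "(?f has_integral b Q * ?e Q - b (-Q) * ?e (-Q)) {-Q..Q}"
    using R(1) by (intro fundamental_theorem_of_calculus) (auto simp: Q_def)
  moreover have "b Q = 0" "b (-Q) = 0" using R by (auto simp: Q_def)
  ultimately have "integral {-Q..Q} ?f = 0" by (simp add: integral_unique)
  moreover have "(LINT \<xi>|lborel. ?f \<xi>) = integral {-Q..Q} ?f"
    by (intro compact_support_integral(2) continuous_intros smooth_imp_continuous R S)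
      (auto simp: Q_def R S)
  moreover have "(LINT \<xi>|lborel. ?f \<xi>) = inv_fourier ?b' x + 2 * pi * \<i> * x * inv_fourier b x"
    by (simp only: inv_fourier_def Bochner_Integration.integral_add[OF
          inv_fourier_integrable[OF test_function_derivative[OF assms]]
          integrable_mult_right[OF inv_fourier_integrable[OF assms]]]
        integral_mult_right_zero)
  ultimately show ?thesis unfolding mult_minus_left eq_neg_iff_add_eq_0 by argo
qed

text \<open>Each factor x is traded for a derivative of \<open>b\<close>, so the induction has to
  run over all test functions at once.\<close>

lemma inv_fourier_decay:
  "test_function b \<Longrightarrow> \<exists>C. \<forall>x. \<bar>x\<bar> ^ m * norm (inv_fourier b x) \<le> C"
proof (induction m arbitrary: b)
  case 0
  then show ?case using norm_inv_fourier_le by auto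
next
  case (Suc m)
  let ?b' = "\<lambda>\<xi>. vector_derivative b (at \<xi>)"
  obtain C where C: "\<bar>x\<bar> ^ m * norm (inv_fourier ?b' x) \<le> C" for x
    using Suc.IH[OF test_function_derivative[OF Suc.prems]] by blast
  have "\<bar>x\<bar> ^ Suc m * norm (inv_fourier b x) \<le> C / (2 * pi)" for x
    using C[of x] inv_fourier_of_derivative[OF Suc.prems, of x]
    by (simp add: norm_mult field_simps)
  then show ?case by blast
qed

lemma inv_fourier_iterated_ddx:
  "test_function b \<Longrightarrow> (ddx ^^ n) (inv_fourier b) = inv_fourier (\<lambda>\<xi>. (2 * pi * \<i> * \<xi>) ^ n * b \<xi>)
     \<and> test_function (\<lambda>\<xi>. (2 * pi * \<i> * \<xi>) ^ n * b \<xi>)"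
proof (induction n)
  case (Suc n)
  have "smooth (\<lambda>\<xi>. 2 * pi * \<i> * \<xi>)"
    by (intro smooth_mult smooth_const smooth_ident)
  then have "test_function (\<lambda>\<xi>. 2 * pi * \<i> * \<xi> * ((2 * pi * \<i> * \<xi>) ^ n * b \<xi>))"
    by (intro test_function_mult_smooth conjunct2[OF Suc.IH] Suc.prems)
  moreover have "ddx (inv_fourier (\<lambda>\<xi>. (2 * pi * \<i> * \<xi>) ^ n * b \<xi>)) =
    inv_fourier (\<lambda>\<xi>. 2 * pi * \<i> * \<xi> * ((2 * pi * \<i> * \<xi>) ^ n * b \<xi>))"
    using Suc unfolding ddx_def
    by (intro ext vector_derivative_at inv_fourier_derivative) simp
  ultimately show ?case
    using Suc by (simp only: funpow.simps o_apply power_Suc mult.assoc)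
qed (simp add: id_def)

lemma schwartz_inv_fourier:
  assumes "test_function b"
  shows "schwartz (inv_fourier b)"
  unfolding schwartz_def
proof (intro conjI allI)
  fix m n and x :: real
  let ?b = "\<lambda>\<xi>. (2 * pi * \<i> * \<xi>) ^ n * b \<xi>"
  have eq: "(ddx ^^ n) (inv_fourier b) = inv_fourier ?b" and test: "test_function ?b"
    using inv_fourier_iterated_ddx[OF assms, of n] by auto
  show "(ddx ^^ n) (inv_fourier b) differentiable at x"
    unfolding eq by (rule differentiableI_vector[OF inv_fourier_derivative[OF test]])
  show "\<exists>C. \<forall>x. \<bar>x\<bar> ^ m * norm ((ddx ^^ n) (inv_fourier b) x) \<le> C"
    unfolding eq by (rule inv_fourier_decay[OF test])
qed

text \<open>The decay estimates of order 0 and 2 add up to domination by a multiple of 1 / (1 +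
  x^2).\<close>

lemma inv_fourier_integrable_self:
  assumes "test_function b"
  shows "integrable lborel (inv_fourier b)"
proof -
  obtain C where C: "\<bar>x\<bar> ^ 0 * norm (inv_fourier b x) \<le> C" for x
    using inv_fourier_decay[OF assms] by blast
  obtain D where D: "\<bar>x\<bar> ^ 2 * norm (inv_fourier b x) \<le> D" for x
    using inv_fourier_decay[OF assms] by blast
  have "integrable lborel (\<lambda>x::real. inverse (1 + x\<^sup>2))"
    using integrable_inverse_1_plus_square by (simp add: set_integrable_def)
  then have "integrable lborel (\<lambda>x. (C + D) * inverse (1 + x\<^sup>2))"
    by (rule integrable_mult_right)
  then show ?thesis
  proof (rule Bochner_Integration.integrable_bound)
    show "inv_fourier b \<in> borel_measurable lborel"
      using borel_measurable_continuous_onI[OF inv_fourier_continuous[OF assms]] by simp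
    have "norm (inv_fourier b x) \<le> norm ((C + D) * inverse (1 + x\<^sup>2))" for x
    proof -
      have "(1 + x\<^sup>2) * norm (inv_fourier b x) \<le> C + D"
        using C[of x] D[of x] by (simp add: algebra_simps)
      then have "norm (inv_fourier b x) \<le> (C + D) * inverse (1 + x\<^sup>2)"
        by (simp add: field_simps add_pos_nonneg)
      then show ?thesis by simp
    qed
    then show "AE x in lborel. norm (inv_fourier b x) \<le> norm ((C + D) * inverse (1 + x\<^sup>2))"
      by simp
  qed
qed

lemma (in pair_sigma_finite) integrable_tensor:
  fixes f g :: "_ \<Rightarrow> complex"
  assumes "integrable M1 f" "integrable M2 g"
  shows "integrable (M1 \<Otimes>\<^sub>M M2) (\<lambda>p. f (fst p) * g (snd p))"
proof (rule Fubini_integrable)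
  have [measurable]: "f \<in> borel_measurable M1" "g \<in> borel_measurable M2" using assms by auto
  show "(\<lambda>p. f (fst p) * g (snd p)) \<in> borel_measurable (M1 \<Otimes>\<^sub>M M2)" by measurable
  show "integrable M1 (\<lambda>x. LINT y|M2. norm (f (fst (x, y)) * g (snd (x, y))))"
    using assms by (auto simp: norm_mult)
  show "AE x in M1. integrable M2 (\<lambda>y. f (fst (x, y)) * g (snd (x, y)))"
    using assms by auto
qed

section \<open>Fourier inversion by Gaussian regularisation\<close>

lemma gauss_kernel_integral:
  "(LINT y|lborel. exp (2 * pi * \<i> * y * \<eta>) * complex_of_real (std_normal_density y)) =
    complex_of_real (exp (- (2 * pi * \<eta>)\<^sup>2 / 2))"
proof -
  have "char std_normal_distribution (2 * pi * \<eta>) =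
      (LINT y|lborel. std_normal_density y *\<^sub>R exp (\<i> * complex_of_real (2 * pi * \<eta> * y)))"
    unfolding char_def by (subst integral_density) auto
  also have "\<dots> = (LINT y|lborel. exp (2 * pi * \<i> * y * \<eta>) * complex_of_real (std_normal_density y))"
    by (intro Bochner_Integration.integral_cong) (auto simp: scaleR_conv_of_real mult_ac)
  finally show ?thesis by (simp add: char_std_normal_distribution)
qed

text \<open>The Gaussian factor makes the double integral in x and frequency absolutely convergent,
  so that Fubini applies. Its transform is again Gaussian, and the rescaling concentrates it: the
  result is an average of \<open>b\<close> at scale \<open>e\<close> against a probability
  density.\<close>

lemma integral_inv_fourier_gauss:
  assumes b: "test_function b" and "e > 0"
  shows "(LINT x|lborel. inv_fourier b x * exp (- (e * x)\<^sup>2 / 2)) =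
    (LINT \<eta>|lborel. b (e * \<eta>) * normal_density 0 (1 / (2 * pi)) \<eta>)"
proof -
  let ?c = "complex_of_real (sqrt (2 * pi))"
  let ?w = "\<lambda>y. complex_of_real (std_normal_density y)"
  let ?F = "\<lambda>(y::real) \<eta>. b (e * \<eta>) * exp (2 * pi * \<i> * y * \<eta>) * ?w y"
  have be: "test_function (\<lambda>\<eta>. b (e * \<eta>))"
    using test_function_affine[OF b, of e 0] assms by simp
  have [measurable]: "(\<lambda>\<eta>. b (e * \<eta>)) \<in> borel_measurable borel"
    using be by (auto simp: test_function_def smooth_borel_measurable)
  have int_w: "integrable lborel ?w"
    by (intro integrable_of_real integrable_normal_density) simp
  have w: "complex_of_real (exp (- y\<^sup>2 / 2)) = ?c * ?w y" for y
  proof -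
    have "exp (- y\<^sup>2 / 2) = sqrt (2 * pi) * std_normal_density y"
      by (simp add: std_normal_density_def)
    then show ?thesis by (simp only: of_real_mult)
  qed
  have ift: "inv_fourier b (y / e) = e * (LINT \<eta>|lborel. b (e * \<eta>) * exp (2 * pi * \<i> * y * \<eta>))" for y
    unfolding inv_fourier_def using \<open>e > 0\<close>
    by (subst lborel_integral_real_affine[of e _ 0]) (simp_all add: scaleR_conv_of_real mult.assoc)
  have "(LINT x|lborel. inv_fourier b x * exp (- (e * x)\<^sup>2 / 2)) =
      (1 / e) *\<^sub>R (LINT y|lborel. inv_fourier b (y / e) * exp (- y\<^sup>2 / 2))"
    using \<open>e > 0\<close> by (subst lborel_integral_real_affine[of "1 / e" _ 0]) auto
  also have "\<dots> = ?c * (LINT y|lborel. LINT \<eta>|lborel. ?F y \<eta>)"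
    using \<open>e > 0\<close> unfolding ift w
    by (simp add: scaleR_conv_of_real mult_ac flip: integral_mult_right_zero integral_mult_left_zero)
  also have "(LINT y|lborel. LINT \<eta>|lborel. ?F y \<eta>) = (LINT \<eta>|lborel. LINT y|lborel. ?F y \<eta>)"
  proof (rule lborel_pair.Fubini_integral[symmetric])
    have "integrable (lborel \<Otimes>\<^sub>M lborel) (\<lambda>p. ?w (fst p) * b (e * snd p))"
      by (intro lborel_pair.integrable_tensor[of ?w "\<lambda>\<eta>. b (e * \<eta>)"] int_w test_function_integrable be)
    then show "integrable (lborel \<Otimes>\<^sub>M lborel) (\<lambda>(y, \<eta>). ?F y \<eta>)"
      by (rule Bochner_Integration.integrable_bound) (auto simp: norm_mult split_beta)
  qed
  also have "(LINT \<eta>|lborel. LINT y|lborel. ?F y \<eta>) =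
      (LINT \<eta>|lborel. b (e * \<eta>) * exp (- (2 * pi * \<eta>)\<^sup>2 / 2))"
    using gauss_kernel_integral by (simp add: mult.assoc)
  also have "?c * \<dots> = (LINT \<eta>|lborel. b (e * \<eta>) * normal_density 0 (1 / (2 * pi)) \<eta>)"
  proof (subst integral_mult_right_zero[symmetric], rule Bochner_Integration.integral_cong[OF refl])
    fix \<eta> :: real
    have "sqrt (2 * pi) * exp (- (2 * pi * \<eta>)\<^sup>2 / 2) = normal_density 0 (1 / (2 * pi)) \<eta>"
      by (simp add: normal_density_def power_divide power_mult_distrib real_sqrt_mult real_sqrt_divide
          power2_eq_square field_simps)
    then show "?c * (b (e * \<eta>) * exp (- (2 * pi * \<eta>)\<^sup>2 / 2)) =
        b (e * \<eta>) * normal_density 0 (1 / (2 * pi)) \<eta>"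
      by (simp flip: of_real_mult)
  qed
  finally show ?thesis .
qed

text \<open>Let the width parameter of the regularisation tend to 0. Both sides converge by
  dominated convergence: one is dominated by the modulus of the inverse transform, the other by a
  bound for \<open>b\<close> times the normal density, whose total mass is 1.\<close>

lemma integral_inv_fourier:
  assumes b: "test_function b"
  shows "(LINT x|lborel. inv_fourier b x) = b 0"
proof (rule LIMSEQ_unique)
  define e where "e n = inverse (real (Suc n))" for n
  have e: "e n > 0" "e \<longlonglongrightarrow> 0" for n
    unfolding e_def using LIMSEQ_inverse_real_of_nat by auto
  have [measurable]: "b \<in> borel_measurable borel"
    using b by (auto simp: test_function_def smooth_borel_measurable)
  have [measurable]: "inv_fourier b \<in> borel_measurable borel"
    using borel_measurable_continuous_onI[OF inv_fourier_continuous[OF b]] .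
  have cont: "isCont b 0"
    using b smooth_imp_continuous[of b UNIV]
    by (simp add: test_function_def continuous_on_eq_continuous_at)
  show "(\<lambda>n. LINT x|lborel. inv_fourier b x * exp (- (e n * x)\<^sup>2 / 2)) \<longlonglongrightarrow>
      (LINT x|lborel. inv_fourier b x)"
  proof (rule integral_dominated_convergence[where w = "\<lambda>x. norm (inv_fourier b x)"])
    show "AE x in lborel. (\<lambda>n. inv_fourier b x * exp (- (e n * x)\<^sup>2 / 2)) \<longlonglongrightarrow> inv_fourier b x"
    proof (rule AE_I2)
      fix x :: real
      have "(\<lambda>n. inv_fourier b x * exp (- (e n * x)\<^sup>2 / 2)) \<longlonglongrightarrow>
          inv_fourier b x * complex_of_real (exp (- (0 * x)\<^sup>2 / 2))"
        by (intro tendsto_intros e) auto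
      then show "(\<lambda>n. inv_fourier b x * exp (- (e n * x)\<^sup>2 / 2)) \<longlonglongrightarrow> inv_fourier b x" by simp
    qed
  qed (use inv_fourier_integrable_self[OF b] in \<open>auto simp: norm_mult mult_left_le\<close>)
  obtain B where B: "\<And>x. norm (b x) \<le> B" using test_function_bounded[OF b] by blast
  have "(\<lambda>n. LINT \<eta>|lborel. b (e n * \<eta>) * normal_density 0 (1 / (2 * pi)) \<eta>) \<longlonglongrightarrow>
      (LINT \<eta>|lborel. b 0 * normal_density 0 (1 / (2 * pi)) \<eta>)"
  proof (rule integral_dominated_convergence[where w = "\<lambda>\<eta>. B * normal_density 0 (1 / (2 * pi)) \<eta>"])
    show "integrable lborel (\<lambda>\<eta>. B * normal_density 0 (1 / (2 * pi)) \<eta>)"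
      by (intro integrable_mult_right integrable_normal_density) simp
    show "AE \<eta> in lborel. (\<lambda>n. b (e n * \<eta>) * normal_density 0 (1 / (2 * pi)) \<eta>)
        \<longlonglongrightarrow> b 0 * normal_density 0 (1 / (2 * pi)) \<eta>"
    proof (rule AE_I2)
      fix \<eta> :: real
      have "(\<lambda>n. e n * \<eta>) \<longlonglongrightarrow> 0" using tendsto_mult_right[OF e(2), of \<eta>] by simp
      then show "(\<lambda>n. b (e n * \<eta>) * normal_density 0 (1 / (2 * pi)) \<eta>)
          \<longlonglongrightarrow> b 0 * normal_density 0 (1 / (2 * pi)) \<eta>"
        using isCont_tendsto_compose[OF cont] by (intro tendsto_intros)
    qed
  qed (auto simp: norm_mult intro!: mult_right_mono B)
  also have "(LINT \<eta>|lborel. b 0 * normal_density 0 (1 / (2 * pi)) \<eta>) = b 0"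
    by (simp add: integral_complex_of_real)
  finally show "(\<lambda>n. LINT x|lborel. inv_fourier b x * exp (- (e n * x)\<^sup>2 / 2)) \<longlonglongrightarrow> b 0"
    unfolding integral_inv_fourier_gauss[OF b e(1)] .
qed

text \<open>Multiplication by a character in x translates \<open>b\<close> in frequency, so
  inversion at \<xi> reduces to the case of frequency 0.\<close>

lemma fourier_inv_fourier:
  assumes b: "test_function b"
  shows "fourier (inv_fourier b) = b"
proof
  fix \<xi>
  have "inv_fourier b x * exp (- (2 * pi * \<i> * x * \<xi>)) = inv_fourier (\<lambda>\<eta>. b (\<eta> + \<xi>)) x" for x
  proof -
    have "inv_fourier b x = (LINT \<eta>|lborel. b (\<eta> + \<xi>) * exp (2 * pi * \<i> * x * \<eta>) * exp (2 * pi * \<i> * x * \<xi>))"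
      unfolding inv_fourier_def
      by (subst lborel_integral_real_affine[of 1 _ \<xi>])
        (auto simp: exp_add[symmetric] algebra_simps intro!: Bochner_Integration.integral_cong)
    also have "\<dots> = inv_fourier (\<lambda>\<eta>. b (\<eta> + \<xi>)) x * exp (2 * pi * \<i> * x * \<xi>)"
      by (simp add: inv_fourier_def)
    finally show ?thesis by (simp add: exp_minus)
  qed
  then have "fourier (inv_fourier b) \<xi> = (LINT x|lborel. inv_fourier (\<lambda>\<eta>. b (\<eta> + \<xi>)) x)"
    by (simp add: fourier_def)
  also have "\<dots> = b (0 + \<xi>)"
    using test_function_affine[OF b, of 1 \<xi>] by (intro integral_inv_fourier) simp
  finally show "fourier (inv_fourier b) \<xi> = b \<xi>" by simp
qed

subsection \<open>Dyadic symbols\<close>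

definition nderiv :: "nat \<Rightarrow> (real \<Rightarrow> real) \<Rightarrow> real \<Rightarrow> real" where
  "nderiv n f = ((\<lambda>g x. vector_derivative g (at x)) ^^ n) f"

lemma nderiv_0 [simp]: "nderiv 0 f = f"
  by (simp add: nderiv_def)

lemma nderiv_Suc: "nderiv (Suc n) f = (\<lambda>x. vector_derivative (nderiv n f) (at x))"
  by (simp add: nderiv_def)

lemma smooth_nderiv: "smooth f \<Longrightarrow> smooth (nderiv n f)"
  by (induction n) (simp_all add: nderiv_Suc smooth_vector_derivative(2))

lemma vector_derivative_eq_0_open:
  assumes "smooth f" "open U" "\<And>x. x \<in> U \<Longrightarrow> f x = 0" "x \<in> U"
  shows "vector_derivative f (at x) = 0"
proof (rule vector_derivative_at)
  show "(f has_vector_derivative 0) (at x)"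
    by (rule has_vector_derivative_transform_within_open[OF has_vector_derivative_const assms(2,4)])
      (simp add: assms(3))
qed

text \<open>The supporting set is kept explicit because differentiation preserves it when it is
  closed, and the disjointness of dyadic scales depends on its exact end points.\<close>

definition smooth_supported :: "real set \<Rightarrow> (real \<Rightarrow> real) \<Rightarrow> bool" where
  "smooth_supported K f \<longleftrightarrow> smooth f \<and> (\<forall>x. x \<notin> K \<longrightarrow> f x = 0)"

lemma smooth_supported_nderiv:
  assumes "smooth_supported K f" "closed K"
  shows "smooth_supported K (nderiv n f)"
proof (induction n)
  case 0
  then show ?case using assms(1) by simp
next
  case (Suc n)
  then have "smooth (nderiv n f)" "\<And>x. x \<in> - K \<Longrightarrow> nderiv n f x = 0"
    by (auto simp: smooth_supported_def)
  then show ?case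
    using vector_derivative_eq_0_open[of "nderiv n f" "- K"] assms(2)
    by (simp add: smooth_supported_def nderiv_Suc smooth_vector_derivative(2) open_Compl)
qed

lemma smooth_supported_test_function:
  assumes "smooth_supported K f" "bounded K"
  shows "test_function (\<lambda>x. complex_of_real (f x))"
proof -
  obtain R where R: "\<And>x. x \<in> K \<Longrightarrow> \<bar>x\<bar> \<le> R"
    using assms(2) by (auto simp: bounded_iff)
  show ?thesis
  proof (rule test_functionI)
    show "smooth (\<lambda>x. complex_of_real (f x))"
      using assms(1) by (auto simp: smooth_supported_def intro: smooth_of_real)
    fix x assume "\<bar>x\<bar> \<ge> R + 1"
    then have "x \<notin> K" using R[of x] by auto
    then show "complex_of_real (f x) = 0"
      using assms(1) by (simp add: smooth_supported_def)
  qed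
qed

lemma smooth_supported_bounded:
  assumes "smooth_supported K f" "bounded K"
  shows "\<exists>B\<ge>0. \<forall>x. \<bar>f x\<bar> \<le> B"
  using test_function_bounded[OF smooth_supported_test_function[OF assms]]
  by (auto intro: less_imp_le)

text \<open>With the parameters \<open>F\<close>, \<open>G\<close>, \<open>s\<close> left free, the span of this family is closed under
  partial derivatives.\<close>

definition dyadic_symbol :: "(real \<Rightarrow> real) \<Rightarrow> (real \<Rightarrow> real) \<Rightarrow> nat \<Rightarrow> real \<times> real \<Rightarrow> real" where
  "dyadic_symbol F G s \<xi> = (\<Sum>k. (1 / 2 ^ k) ^ s * (F (fst \<xi> / 2 ^ k) * G (snd \<xi> / 2 ^ k)))"

abbreviation low_window :: "(real \<Rightarrow> real) \<Rightarrow> bool" where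
  "low_window \<equiv> smooth_supported {-1..1}"

text \<open>The interval lies in the annulus 1/2 <= |x| <= 2 allowed for \<psi> type, and the ratio
  5/3 of its end points is less than 2. Its dyadic dilates are therefore disjoint, and each point of
  the plane sees at most one scale.\<close>

abbreviation high_window :: "(real \<Rightarrow> real) \<Rightarrow> bool" where
  "high_window \<equiv> smooth_supported {3/4..5/4}"

lemma high_window_dyadic:
  assumes "high_window G" "G (x / 2 ^ k) \<noteq> 0"
  shows "3 / 4 * 2 ^ k \<le> x" "x \<le> 5 / 4 * 2 ^ k"
proof -
  have "x / 2 ^ k \<in> {3/4..5/4}"
    using assms unfolding smooth_supported_def by blast
  then show "3 / 4 * 2 ^ k \<le> x" "x \<le> 5 / 4 * 2 ^ k"
    by (auto simp: field_simps)
qed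

lemma high_window_unique:
  assumes G: "high_window G" and "G (x / 2 ^ k) \<noteq> 0" "G (x / 2 ^ j) \<noteq> 0"
  shows "j = k"
proof -
  have "\<not> i < l" if "G (x / 2 ^ l) \<noteq> 0" "G (x / 2 ^ i) \<noteq> 0" for i l :: nat
  proof
    assume "i < l"
    then have "(2::real) ^ Suc i \<le> 2 ^ l" by (intro power_increasing) auto
    moreover have "(0::real) < 2 ^ l" by simp
    ultimately show False
      using high_window_dyadic(1)[OF G that(1)] high_window_dyadic(2)[OF G that(2)]
      unfolding power_Suc by linarith
  qed
  from this[OF assms(2,3)] this[OF assms(3,2)] show ?thesis by simp
qed

lemma dyadic_symbol_single:
  assumes "high_window G" "G (snd \<xi> / 2 ^ k) \<noteq> 0"
  shows "dyadic_symbol F G s \<xi> = (1 / 2 ^ k) ^ s * (F (fst \<xi> / 2 ^ k) * G (snd \<xi> / 2 ^ k))"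
  unfolding dyadic_symbol_def
  using high_window_unique[OF assms]
  by (subst suminf_finite[of "{k}"]) auto

lemma dyadic_symbol_eq_0:
  assumes "\<And>k. G (snd \<xi> / 2 ^ k) = 0"
  shows "dyadic_symbol F G s \<xi> = 0"
  by (simp add: dyadic_symbol_def assms)

text \<open>For k >= n the k-th high window starts at 3/4 times 2^k, beyond the strip. The sum is
  thus locally finite and may be differentiated term by term; since only scales k >= 0 occur, this
  holds near the origin too.\<close>

lemma dyadic_symbol_eq_sum:
  assumes "high_window G" "\<bar>snd \<xi>\<bar> < 2 ^ n / 2"
  shows "dyadic_symbol F G s \<xi> =
    (\<Sum>k<n. (1 / 2 ^ k) ^ s * (F (fst \<xi> / 2 ^ k) * G (snd \<xi> / 2 ^ k)))"
  unfolding dyadic_symbol_def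
proof (rule suminf_finite)
  fix k assume "k \<notin> {..<n}"
  then have "(2::real) ^ n \<le> 2 ^ k" by (intro power_increasing) auto
  moreover have "(0::real) < 2 ^ k" by simp
  ultimately have "snd \<xi> < 3 / 4 * 2 ^ k"
    using assms(2) by linarith
  then have "G (snd \<xi> / 2 ^ k) = 0"
    using high_window_dyadic(1)[OF assms(1), of "snd \<xi>" k] by linarith
  then show "(1 / 2 ^ k) ^ s * (F (fst \<xi> / 2 ^ k) * G (snd \<xi> / 2 ^ k)) = 0" by simp
qed simp

lemma smooth_real_derivative:
  "smooth f \<Longrightarrow> (f has_real_derivative nderiv 1 f x) (at x)"
  using smooth_vector_derivative(1)[of f x]
  by (simp add: has_real_derivative_iff_has_vector_derivative nderiv_Suc)

text \<open>Each differentiation replaces one window by its derivative and releases a factor 2^(-k),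
  which the exponent \<open>s\<close> records.\<close>

lemma dyadic_symbol_has_derivative:
  assumes F: "low_window F" and G: "high_window G"
  shows "(dyadic_symbol F G s has_derivative
    (\<lambda>h. fst h * dyadic_symbol (nderiv 1 F) G (Suc s) \<xi> +
         snd h * dyadic_symbol F (nderiv 1 G) (Suc s) \<xi>)) (at \<xi>)"
proof -
  \<comment> \<open>This many scales suffice on the whole strip |snd \<eta>| < |snd \<xi>| + 1, an
    open neighbourhood of \<xi>.\<close>
  obtain n where n: "(\<bar>snd \<xi>\<bar> + 1) * 2 < 2 ^ n"
    using real_arch_pow[of 2 "(\<bar>snd \<xi>\<bar> + 1) * 2"] by auto
  have sF: "smooth F" and sG: "smooth G" using F G by (auto simp: smooth_supported_def)
  have G': "high_window (nderiv 1 G)" by (intro smooth_supported_nderiv G) auto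
  have summand: "((\<lambda>\<xi>. (1 / 2 ^ k) ^ s * (F (fst \<xi> / 2 ^ k) * G (snd \<xi> / 2 ^ k))) has_derivative
      (\<lambda>h. fst h * ((1 / 2 ^ k) ^ Suc s * (nderiv 1 F (fst \<xi> / 2 ^ k) * G (snd \<xi> / 2 ^ k))) +
         snd h * ((1 / 2 ^ k) ^ Suc s * (F (fst \<xi> / 2 ^ k) * nderiv 1 G (snd \<xi> / 2 ^ k))))) (at \<xi>)" for k
  proof -
    have dF: "((\<lambda>\<xi>. F (fst \<xi> / 2 ^ k)) has_derivative
        (\<lambda>h. nderiv 1 F (fst \<xi> / 2 ^ k) * (fst h / 2 ^ k))) (at \<xi>)"
      by (rule DERIV_compose_FDERIV[OF smooth_real_derivative[OF sF], THEN has_derivative_eq_rhs])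
        (auto intro!: derivative_eq_intros)
    have dG: "((\<lambda>\<xi>. G (snd \<xi> / 2 ^ k)) has_derivative
        (\<lambda>h. nderiv 1 G (snd \<xi> / 2 ^ k) * (snd h / 2 ^ k))) (at \<xi>)"
      by (rule DERIV_compose_FDERIV[OF smooth_real_derivative[OF sG], THEN has_derivative_eq_rhs])
        (auto intro!: derivative_eq_intros)
    show ?thesis
      by (rule has_derivative_eq_rhs[OF has_derivative_mult_right[OF has_derivative_mult[OF dF dG]]])
        (simp add: fun_eq_iff algebra_simps)
  qed
  show ?thesis
  proof (rule has_derivative_transform_within_open[where s = "{\<eta>. \<bar>snd \<eta>\<bar> < \<bar>snd \<xi>\<bar> + 1}"])
    show "((\<lambda>\<xi>. \<Sum>k<n. (1 / 2 ^ k) ^ s * (F (fst \<xi> / 2 ^ k) * G (snd \<xi> / 2 ^ k))) has_derivative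
      (\<lambda>h. fst h * dyadic_symbol (nderiv 1 F) G (Suc s) \<xi> +
         snd h * dyadic_symbol F (nderiv 1 G) (Suc s) \<xi>)) (at \<xi>)"
      by (rule has_derivative_eq_rhs[OF has_derivative_sum[OF summand]])
        (use n in \<open>simp add: fun_eq_iff dyadic_symbol_eq_sum[OF G, of _ n]
          dyadic_symbol_eq_sum[OF G', of _ n, unfolded One_nat_def] sum.distrib sum_distrib_left del: power_Suc\<close>)
    show "open {\<eta>::real \<times> real. \<bar>snd \<eta>\<bar> < \<bar>snd \<xi>\<bar> + 1}"
      by (intro open_Collect_less continuous_intros)
    fix \<eta> :: "real \<times> real" assume "\<eta> \<in> {\<eta>. \<bar>snd \<eta>\<bar> < \<bar>snd \<xi>\<bar> + 1}"
    then show "(\<Sum>k<n. (1 / 2 ^ k) ^ s * (F (fst \<eta> / 2 ^ k) * G (snd \<eta> / 2 ^ k))) =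
        dyadic_symbol F G s \<eta>"
      using n by (intro dyadic_symbol_eq_sum[symmetric] G) simp
  qed simp
qed

lemma dirderiv_dyadic_symbol:
  assumes "low_window F" "high_window G"
  shows "dirderiv v (dyadic_symbol F G s) =
    (\<lambda>\<xi>. fst v * dyadic_symbol (nderiv 1 F) G (Suc s) \<xi> +
      snd v * dyadic_symbol F (nderiv 1 G) (Suc s) \<xi>)"
  unfolding dirderiv_def
  by (intro ext) (simp add: frechet_derivative_at[OF dyadic_symbol_has_derivative[OF assms], symmetric])

inductive dyadic_span :: "(real \<times> real \<Rightarrow> real) \<Rightarrow> bool" where
  "low_window F \<Longrightarrow> high_window G \<Longrightarrow> dyadic_span (\<lambda>\<xi>. c * dyadic_symbol F G s \<xi>)"
| "dyadic_span f \<Longrightarrow> dyadic_span g \<Longrightarrow> dyadic_span (\<lambda>\<xi>. f \<xi> + g \<xi>)"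

lemma dyadic_span_derivative:
  "dyadic_span f \<Longrightarrow> \<exists>f'. (\<forall>\<xi>. (f has_derivative f' \<xi>) (at \<xi>)) \<and> (\<forall>v. dyadic_span (\<lambda>\<xi>. f' \<xi> v))"
proof (induction rule: dyadic_span.induct)
  case (1 F G c s)
  let ?f' = "\<lambda>\<xi> h. c * (fst h * dyadic_symbol (nderiv 1 F) G (Suc s) \<xi> +
         snd h * dyadic_symbol F (nderiv 1 G) (Suc s) \<xi>)"
  have "dyadic_span (\<lambda>\<xi>. ?f' \<xi> v)" for v
  proof -
    have "dyadic_span (\<lambda>\<xi>. (c * fst v) * dyadic_symbol (nderiv 1 F) G (Suc s) \<xi> +
        (c * snd v) * dyadic_symbol F (nderiv 1 G) (Suc s) \<xi>)"
      by (intro dyadic_span.intros smooth_supported_nderiv 1) auto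
    then show ?thesis by (simp add: algebra_simps)
  qed
  moreover have "((\<lambda>\<xi>. c * dyadic_symbol F G s \<xi>) has_derivative ?f' \<xi>) (at \<xi>)" for \<xi>
    by (rule has_derivative_mult_right[OF dyadic_symbol_has_derivative[OF 1]])
  ultimately show ?case by (intro exI[of _ ?f'] conjI allI)
next
  case (2 f g)
  then obtain f' g' where "\<forall>\<xi>. (f has_derivative f' \<xi>) (at \<xi>)" "\<forall>v. dyadic_span (\<lambda>\<xi>. f' \<xi> v)"
    "\<forall>\<xi>. (g has_derivative g' \<xi>) (at \<xi>)" "\<forall>v. dyadic_span (\<lambda>\<xi>. g' \<xi> v)"
    by (elim exE conjE)
  then show ?case
    by (intro exI[of _ "\<lambda>\<xi> v. f' \<xi> v + g' \<xi> v"] conjI allI has_derivative_add dyadic_span.intros(2))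
      (erule spec)+
qed

lemma dyadic_span_Ck_on: "dyadic_span f \<Longrightarrow> Ck_on n S f"
proof (induction n arbitrary: f)
  case 0
  then obtain f' where "\<forall>\<xi>. (f has_derivative f' \<xi>) (at \<xi>)"
    using dyadic_span_derivative by blast
  then show ?case
    by (auto intro!: continuous_at_imp_continuous_on has_derivative_continuous)
next
  case (Suc n)
  then obtain f' where f': "\<And>\<xi>. (f has_derivative f' \<xi>) (at \<xi>)" "\<And>v. dyadic_span (\<lambda>\<xi>. f' \<xi> v)"
    using dyadic_span_derivative by blast
  have "dirderiv v f = (\<lambda>\<xi>. f' \<xi> v)" for v
    unfolding dirderiv_def by (simp add: frechet_derivative_at[OF f'(1), symmetric])
  then show ?case
    using f'(2) Suc.IH differentiableI[OF f'(1)] by simp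
qed

lemma partial_dyadic_symbol:
  assumes "low_window F" "high_window G"
  shows "partial (m, n) (dyadic_symbol F G s) = dyadic_symbol (nderiv m F) (nderiv n G) (s + n + m)"
proof -
  have nd: "nderiv 1 (nderiv i f) = nderiv (Suc i) f" for i f
    by (simp add: nderiv_Suc)
  have "(dirderiv (0, 1) ^^ n) (dyadic_symbol F G s) = dyadic_symbol F (nderiv n G) (s + n)"
    by (induction n)
      (simp_all add: dirderiv_dyadic_symbol assms smooth_supported_nderiv nd del: One_nat_def)
  moreover have "(dirderiv (1, 0) ^^ m) (dyadic_symbol F (nderiv n G) t) =
      dyadic_symbol (nderiv m F) (nderiv n G) (t + m)" for t
    by (induction m)
      (simp_all add: dirderiv_dyadic_symbol assms smooth_supported_nderiv nd del: One_nat_def)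
  ultimately show ?thesis by (simp add: partial_def)
qed

text \<open>At most one scale k is active at \<xi>, and there both coordinates are at most 5/4 times
  2^k in modulus. Hence |\<xi>| <= 4 times 2^k, and the factor 2^(-k s) is at most 4^s
  |\<xi>|^(-s).\<close>

lemma dyadic_symbol_bound:
  assumes F: "low_window F" and G: "high_window G"
  shows "\<exists>C. \<forall>\<xi>. \<xi> \<noteq> 0 \<longrightarrow> \<bar>dyadic_symbol F G s \<xi>\<bar> \<le> C * dist \<xi> 0 powi (- int s)"
proof -
  obtain B where B: "B \<ge> 0" "\<And>x. \<bar>F x\<bar> \<le> B" using smooth_supported_bounded[OF F] by auto
  obtain D where D: "D \<ge> 0" "\<And>x. \<bar>G x\<bar> \<le> D" using smooth_supported_bounded[OF G] by auto
  have "\<bar>dyadic_symbol F G s \<xi>\<bar> \<le> (4 ^ s * (B * D)) * dist \<xi> 0 powi (- int s)" if "\<xi> \<noteq> 0" for \<xi>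
  proof (cases "\<exists>k. G (snd \<xi> / 2 ^ k) \<noteq> 0 \<and> F (fst \<xi> / 2 ^ k) \<noteq> 0")
    case True
    then obtain k where k: "G (snd \<xi> / 2 ^ k) \<noteq> 0" "F (fst \<xi> / 2 ^ k) \<noteq> 0" by blast
    have "fst \<xi> / 2 ^ k \<in> {-1..1}"
      using k F unfolding smooth_supported_def by blast
    then have "\<bar>fst \<xi>\<bar> \<le> 2 ^ k" by (auto simp: field_simps)
    moreover have "norm \<xi> \<le> \<bar>fst \<xi>\<bar> + \<bar>snd \<xi>\<bar>"
      using norm_Pair_le[of "fst \<xi>" "snd \<xi>"] by simp
    moreover have "(0::real) < 2 ^ k" by simp
    ultimately have "norm \<xi> \<le> 4 * 2 ^ k"
      using high_window_dyadic[OF G k(1)] by linarith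
    then have "1 / 2 ^ k \<le> 4 * inverse (norm \<xi>)"
      using that by (simp add: field_simps)
    then have "(1 / 2 ^ k) ^ s \<le> (4 * inverse (norm \<xi>)) ^ s"
      by (intro power_mono) auto
    moreover have "\<bar>F (fst \<xi> / 2 ^ k) * G (snd \<xi> / 2 ^ k)\<bar> \<le> B * D"
      unfolding abs_mult by (intro mult_mono B D) auto
    ultimately have "(1 / 2 ^ k) ^ s * \<bar>F (fst \<xi> / 2 ^ k) * G (snd \<xi> / 2 ^ k)\<bar> \<le>
        (4 * inverse (norm \<xi>)) ^ s * (B * D)"
      by (intro mult_mono) auto
    then show ?thesis
      using dyadic_symbol_single[OF G k(1), of F s]
      by (simp add: abs_mult power_int_minus power_mult_distrib power_inverse mult_ac power_divide)
  next
    case False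
    then have "dyadic_symbol F G s \<xi> = 0"
      unfolding dyadic_symbol_def by (subst suminf_finite[of "{}"]) auto
    then show ?thesis using B D by simp
  qed
  then show ?thesis by blast
qed

lemma hoermander_marcinkiewicz_dyadic_symbol:
  assumes "low_window F" "high_window G"
  shows "hoermander_marcinkiewicz (dyadic_symbol F G 0)"
  unfolding hoermander_marcinkiewicz_def
proof (intro conjI allI)
  fix n
  show "Ck_on n (- {0}) (dyadic_symbol F G 0)"
    using dyadic_span.intros(1)[OF assms, of 1 0] by (simp add: dyadic_span_Ck_on)
next
  fix \<alpha> :: "nat \<times> nat"
  obtain m n where \<alpha>: "\<alpha> = (m, n)" by (cases \<alpha>)
  show "\<exists>C. \<forall>\<xi>. \<xi> \<noteq> 0 \<longrightarrow>
      \<bar>partial \<alpha> (dyadic_symbol F G 0) \<xi>\<bar> \<le> C * dist \<xi> 0 powi (- int (fst \<alpha> + snd \<alpha>))"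
    unfolding \<alpha> partial_dyadic_symbol[OF assms] fst_conv snd_conv add_0 add.commute[of m n]
    by (intro dyadic_symbol_bound smooth_supported_nderiv assms) auto
qed

section \<open>The dyadic symbol as a sum of tensor products\<close>

lemma ddx_iterated_of_real_scaled:
  assumes "smooth f" "c \<noteq> 0"
  shows "(ddx ^^ l) (\<lambda>\<xi>. complex_of_real (f (\<xi> / c))) =
    (\<lambda>\<xi>. complex_of_real ((1 / c) ^ l * nderiv l f (\<xi> / c)))"
proof (induction l)
  case (Suc l)
  have "ddx (\<lambda>\<xi>. complex_of_real ((1 / c) ^ l * nderiv l f (\<xi> / c))) \<xi> =
      complex_of_real ((1 / c) ^ Suc l * nderiv (Suc l) f (\<xi> / c))" for \<xi>
    unfolding ddx_def
  proof (rule vector_derivative_at)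
    have "(nderiv l f has_real_derivative nderiv (Suc l) f (\<xi> / c)) (at (\<xi> / c))"
      using smooth_real_derivative[OF smooth_nderiv[OF assms(1)], of l "\<xi> / c"] by (simp add: nderiv_Suc)
    then have "((\<lambda>\<xi>. nderiv l f (\<xi> / c)) has_real_derivative nderiv (Suc l) f (\<xi> / c) * (1 / c)) (at \<xi>)"
      by (rule DERIV_chain2) (use assms(2) in \<open>auto intro!: derivative_eq_intros\<close>)
    then have "((\<lambda>\<xi>. (1 / c) ^ l * nderiv l f (\<xi> / c)) has_real_derivative
        (1 / c) ^ Suc l * nderiv (Suc l) f (\<xi> / c)) (at \<xi>)"
      by (rule DERIV_cong[OF DERIV_cmult]) simp
    then show "((\<lambda>\<xi>. complex_of_real ((1 / c) ^ l * nderiv l f (\<xi> / c))) has_vector_derivative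
        complex_of_real ((1 / c) ^ Suc l * nderiv (Suc l) f (\<xi> / c))) (at \<xi>)"
      by (intro has_vector_derivative_of_real)
        (simp add: has_real_derivative_iff_has_vector_derivative)
  qed
  then show ?case using Suc by (simp del: power_Suc of_real_mult)
qed simp

text \<open>The definition of (\<phi>,\<psi>) type sums over all integers, whereas the symbol uses
  the scales k >= 0 only; the remaining pieces are set to zero.\<close>

definition dyadic_piece :: "(real \<Rightarrow> real) \<Rightarrow> int \<Rightarrow> real \<Rightarrow> complex" where
  "dyadic_piece f k \<xi> = (if k \<ge> 0 then complex_of_real (f (\<xi> / 2 ^ nat k)) else 0)"

lemma test_function_dyadic_piece:
  assumes "smooth_supported K f" "bounded K"
  shows "test_function (dyadic_piece f k)"
proof -
  from test_function_affine[OF smooth_supported_test_function[OF assms], of "1 / 2 ^ nat k" 0] show ?thesis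
    by (cases "k \<ge> 0") (simp_all add: dyadic_piece_def[abs_def] test_function_0)
qed

lemma two_powi_neg_mult:
  assumes "k \<ge> 0"
  shows "2 powi (- (k * int l)) = (1 / 2 ^ nat k :: real) ^ l"
proof -
  have "2 powi (- (k * int l)) = inverse ((2::real) powi (int (nat k * l)))"
    using assms by (simp add: power_int_minus)
  also have "\<dots> = (1 / 2 ^ nat k) ^ l"
    by (simp only: power_int_of_nat) (simp add: power_mult power_divide inverse_eq_divide)
  finally show ?thesis .
qed

lemma dyadic_piece_derivative_bound:
  assumes "smooth_supported K f" "bounded K" "closed K"
  shows "\<exists>C\<ge>0. \<forall>k \<xi>. norm ((ddx ^^ l) (dyadic_piece f k) \<xi>) \<le> C * 2 powi (- (k * int l))"
proof -
  obtain B where B: "B \<ge> 0" "\<And>x. \<bar>nderiv l f x\<bar> \<le> B"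
    using smooth_supported_bounded[OF smooth_supported_nderiv] assms by blast
  have "norm ((ddx ^^ l) (dyadic_piece f k) \<xi>) \<le> B * 2 powi (- (k * int l))" for k \<xi>
  proof (cases "k \<ge> 0")
    case True
    then have "dyadic_piece f k = (\<lambda>\<xi>. complex_of_real (f (\<xi> / 2 ^ nat k)))"
      by (simp add: dyadic_piece_def[abs_def])
    then have "norm ((ddx ^^ l) (dyadic_piece f k) \<xi>) =
        (1 / 2 ^ nat k) ^ l * \<bar>nderiv l f (\<xi> / 2 ^ nat k)\<bar>"
      using assms(1) by (simp add: ddx_iterated_of_real_scaled smooth_supported_def norm_mult norm_power
          norm_divide del: of_real_mult of_real_power of_real_divide) (simp add: abs_mult power_divide)
    also have "\<dots> \<le> (1 / 2 ^ nat k) ^ l * B" by (intro mult_left_mono B) auto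
    finally show ?thesis by (simp add: two_powi_neg_mult[OF True] mult.commute)
  next
    case False
    then have "dyadic_piece f k = (\<lambda>\<xi>. 0)" by (simp add: dyadic_piece_def[abs_def])
    moreover have "(ddx ^^ l) (\<lambda>\<xi>. 0) = (\<lambda>\<xi>. 0)"
      by (induction l) (simp_all add: ddx_def[abs_def])
    ultimately show ?thesis using B by simp
  qed
  with B(1) show ?thesis by blast
qed

text \<open>The functions \<phi>_k and \<psi>_k are the inverse transforms of dilated windows, so
  Fourier inversion turns every requirement into one about the windows themselves. The
  integer-indexed sum has at most one nonzero term at each point.\<close>

lemma phi_psi_type_dyadic_symbol:
  assumes F: "low_window F" and G: "high_window G"
  shows "phi_psi_type (dyadic_symbol F G 0)"
proof -
  let ?\<phi> = "\<lambda>k. inv_fourier (dyadic_piece F k)" and ?\<psi> = "\<lambda>k. inv_fourier (dyadic_piece G k)"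
  have test: "test_function (dyadic_piece F k)" "test_function (dyadic_piece G k)" for k
    using F G by (auto intro: test_function_dyadic_piece)
  note fourier = fourier_inv_fourier[OF test(1)] fourier_inv_fourier[OF test(2)]
  have nonneg: "dyadic_piece f k \<xi> \<noteq> 0 \<Longrightarrow> k \<ge> 0 \<and> f (\<xi> / 2 ^ nat k) \<noteq> 0" for f k \<xi>
    by (simp add: dyadic_piece_def split: if_splits)
  have powi: "k \<ge> 0 \<Longrightarrow> 2 powi k = (2::real) ^ nat k" for k
    by (simp add: power_int_def)
  have supp_F: "supp (dyadic_piece F k) \<subseteq> {- (2 powi k)..2 powi k}" for k
    unfolding supp_def
  proof (rule closure_minimal, rule subsetI)
    fix \<xi> assume "\<xi> \<in> {\<xi>. dyadic_piece F k \<xi> \<noteq> 0}"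
    then have k: "k \<ge> 0" "F (\<xi> / 2 ^ nat k) \<noteq> 0" using nonneg by auto
    then have "\<xi> / 2 ^ nat k \<in> {-1..1}" using F unfolding smooth_supported_def by blast
    then show "\<xi> \<in> {- (2 powi k)..2 powi k}"
      using powi[OF k(1)] by (auto simp: field_simps)
  qed simp
  have supp_G: "supp (dyadic_piece G k) \<subseteq>
      {- (2 powi (k + 1)) .. - (2 powi (k - 1))} \<union> {2 powi (k - 1) .. 2 powi (k + 1)}" for k
    unfolding supp_def
  proof (rule closure_minimal, rule subsetI)
    fix \<xi> assume "\<xi> \<in> {\<xi>. dyadic_piece G k \<xi> \<noteq> 0}"
    then have k: "k \<ge> 0" "G (\<xi> / 2 ^ nat k) \<noteq> 0" using nonneg by auto
    have "(2::real) powi (k + 1) = 2 * 2 ^ nat k" "(2::real) powi (k - 1) = 2 ^ nat k / 2"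
      using powi[OF k(1)] by (simp_all add: power_int_add power_int_diff)
    moreover have "(0::real) < 2 ^ nat k" by simp
    \<comment> \<open>The high window lives on positive frequencies, so only the right half of the
      annulus occurs.\<close>
    ultimately show "\<xi> \<in> {- (2 powi (k + 1)) .. - (2 powi (k - 1))} \<union> {2 powi (k - 1) .. 2 powi (k + 1)}"
      using high_window_dyadic[OF G k(2)] by (intro UnI2) auto
  qed (auto intro: closed_Un)
  have bound: "\<exists>C. \<forall>k \<xi>.
      norm ((ddx ^^ l) (dyadic_piece F k) \<xi>) \<le> C * 2 powi (- (k * int l)) \<and>
      norm ((ddx ^^ l) (dyadic_piece G k) \<xi>) \<le> C * 2 powi (- (k * int l))" for l
  proof -
    obtain C where C: "C \<ge> 0" "\<And>k \<xi>. norm ((ddx ^^ l) (dyadic_piece F k) \<xi>) \<le> C * 2 powi (- (k * int l))"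
      using dyadic_piece_derivative_bound[OF F] by force
    obtain D where D: "D \<ge> 0" "\<And>k \<xi>. norm ((ddx ^^ l) (dyadic_piece G k) \<xi>) \<le> D * 2 powi (- (k * int l))"
      using dyadic_piece_derivative_bound[OF G] by force
    show ?thesis
      using C D
      by (intro exI[of _ "C + D"] allI conjI)
        (auto intro!: order_trans[OF C(2)] order_trans[OF D(2)] mult_right_mono)
  qed
  have sum: "((\<lambda>k. dyadic_piece F k \<xi>\<^sub>1 * dyadic_piece G k \<xi>\<^sub>2) has_sum
      complex_of_real (dyadic_symbol F G 0 (\<xi>\<^sub>1, \<xi>\<^sub>2))) UNIV" for \<xi>\<^sub>1 \<xi>\<^sub>2
  proof (cases "\<exists>k. G (\<xi>\<^sub>2 / 2 ^ k) \<noteq> 0")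
    case True
    then obtain k where k: "G (\<xi>\<^sub>2 / 2 ^ k) \<noteq> 0" by blast
    have "((\<lambda>k. dyadic_piece F k \<xi>\<^sub>1 * dyadic_piece G k \<xi>\<^sub>2) has_sum
        (\<Sum>k\<in>{int k}. dyadic_piece F k \<xi>\<^sub>1 * dyadic_piece G k \<xi>\<^sub>2)) {int k}"
      by (rule has_sum_finite) simp
    also have "?this \<longleftrightarrow> ((\<lambda>k. dyadic_piece F k \<xi>\<^sub>1 * dyadic_piece G k \<xi>\<^sub>2) has_sum
        (\<Sum>k\<in>{int k}. dyadic_piece F k \<xi>\<^sub>1 * dyadic_piece G k \<xi>\<^sub>2)) UNIV"
    proof (rule has_sum_cong_neutral)
      fix j assume "j \<in> UNIV - {int k}"
      then show "dyadic_piece F j \<xi>\<^sub>1 * dyadic_piece G j \<xi>\<^sub>2 = 0"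
        using high_window_unique[OF G k, of "nat j"] nonneg[of G j \<xi>\<^sub>2] by fastforce
    qed auto
    finally show ?thesis
      using dyadic_symbol_single[OF G, of "(\<xi>\<^sub>1, \<xi>\<^sub>2)" k F 0] k by (simp add: dyadic_piece_def)
  next
    case False
    then have "(\<lambda>k. dyadic_piece F k \<xi>\<^sub>1 * dyadic_piece G k \<xi>\<^sub>2) = (\<lambda>_. 0)"
      by (simp add: dyadic_piece_def fun_eq_iff)
    moreover have "dyadic_symbol F G 0 (\<xi>\<^sub>1, \<xi>\<^sub>2) = 0"
      using False by (intro dyadic_symbol_eq_0) simp
    ultimately show ?thesis by simp
  qed
  show ?thesis
    unfolding phi_psi_type_def
    by (rule exI[of _ ?\<phi>], rule exI[of _ ?\<psi>], unfold fourier)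
      (intro conjI allI schwartz_inv_fourier test supp_F supp_G bound sum)
qed

subsection \<open>Sign multipliers and wave packets\<close>

lemma norm_integral_le:
  fixes f :: "_ \<Rightarrow> complex"
  assumes "integrable M g" "\<And>x. norm (f x) \<le> g x"
  shows "norm (integral\<^sup>L M f) \<le> integral\<^sup>L M g"
proof (cases "integrable M f")
  case True
  have "norm (integral\<^sup>L M f) \<le> (\<integral>x. norm (f x) \<partial>M)"
    by (rule integral_norm_bound)
  also have "\<dots> \<le> integral\<^sup>L M g"
    using True assms by (intro integral_mono) auto
  finally show ?thesis .
next
  \<comment> \<open>The Bochner integral of a non-integrable function is 0 by convention, so this
    case only asks that the majorant have a nonnegative integral.\<close>
  case False
  have "0 \<le> integral\<^sup>L M g"
    using assms(2) norm_ge_zero order_trans by (intro Bochner_Integration.integral_nonneg) blast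
  then show ?thesis by (simp add: not_integrable_integral_eq[OF False])
qed

text \<open>If \<open>u\<close> and \<open>v\<close> are the transforms of two functions, each
  multiplied by exp(2 \<pi> i x \<xi>), this is the value at x of the multiplier with symbol sgn, a
  constant multiple of the Hilbert transform, applied to the product of the two functions.\<close>

definition sgn_form :: "(real \<Rightarrow> complex) \<Rightarrow> (real \<Rightarrow> complex) \<Rightarrow> complex" where
  "sgn_form u v = (LINT \<xi>|lborel. LINT \<eta>|lborel. complex_of_real (sgn (\<xi> + \<eta>)) * u \<xi> * v \<eta>)"

lemma norm_sgn_mult_le: "norm (complex_of_real (sgn t) * z) \<le> norm z"
  by (simp add: norm_mult sgn_if)

lemma integrable_sgn_tensor:
  assumes u: "integrable lborel u" and v: "integrable lborel v"
  shows "integrable (lborel \<Otimes>\<^sub>M lborel)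
    (\<lambda>p. complex_of_real (sgn (fst p + snd p)) * u (fst p) * v (snd p))"
proof (rule Bochner_Integration.integrable_bound[OF lborel_pair.integrable_tensor[OF u v]])
  have [measurable]: "u \<in> borel_measurable borel" "v \<in> borel_measurable borel"
    using assms by (simp_all add: integrable_iff_bounded)
  show "(\<lambda>p. complex_of_real (sgn (fst p + snd p)) * u (fst p) * v (snd p))
      \<in> borel_measurable (lborel \<Otimes>\<^sub>M lborel)"
    by measurable
  show "AE p in lborel \<Otimes>\<^sub>M lborel. norm (complex_of_real (sgn (fst p + snd p)) * u (fst p) * v (snd p))
      \<le> norm (u (fst p) * v (snd p))"
    using norm_sgn_mult_le by (intro AE_I2) (simp add: mult.assoc)
qed

lemma integrable_sgn_form_inner:
  assumes "integrable lborel u" "integrable lborel v"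
  shows "integrable lborel (\<lambda>\<xi>. LINT \<eta>|lborel. complex_of_real (sgn (\<xi> + \<eta>)) * u \<xi> * v \<eta>)"
  using lborel_pair.integrable_fst'[OF integrable_sgn_tensor[OF assms]] by simp

lemma integrable_sgn_shift_mult:
  assumes v: "integrable lborel v"
  shows "integrable lborel (\<lambda>\<eta>. complex_of_real (sgn (\<xi> + \<eta>)) * v \<eta>)"
proof (rule Bochner_Integration.integrable_bound[OF v])
  have [measurable]: "v \<in> borel_measurable borel"
    using v by (simp add: integrable_iff_bounded)
  show "(\<lambda>\<eta>. complex_of_real (sgn (\<xi> + \<eta>)) * v \<eta>) \<in> borel_measurable lborel"
    by measurable
qed (intro AE_I2 norm_sgn_mult_le)

lemma norm_sgn_form_le:
  assumes "integrable lborel u" "integrable lborel v"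
  shows "norm (sgn_form u v) \<le> (LINT \<xi>|lborel. norm (u \<xi>)) * (LINT \<eta>|lborel. norm (v \<eta>))"
proof -
  have "norm (LINT \<eta>|lborel. complex_of_real (sgn (\<xi> + \<eta>)) * u \<xi> * v \<eta>) \<le>
      norm (u \<xi>) * (LINT \<eta>|lborel. norm (v \<eta>))" for \<xi>
    using assms norm_sgn_mult_le[of _ "u \<xi> * v _"]
    by (subst integral_mult_right_zero[symmetric], intro norm_integral_le)
      (simp_all add: norm_mult mult.assoc)
  then have "norm (sgn_form u v) \<le>
      (LINT \<xi>|lborel. norm (u \<xi>) * (LINT \<eta>|lborel. norm (v \<eta>)))"
    unfolding sgn_form_def using assms by (intro norm_integral_le) auto
  then show ?thesis by simp
qed

text \<open>On a triple of packets the dyadic symbol will be constant, which leaves only the sign of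
  the first two frequencies. The third frequency then decouples by Fubini.\<close>

lemma triple_integral_sgn:
  fixes u v w :: "real \<Rightarrow> complex"
  assumes u: "integrable lborel u" and v: "integrable lborel v" and w: "integrable lborel w"
  defines "f \<equiv> \<lambda>p. complex_of_real (sgn (fst p + fst (snd p))) * u (fst p) * v (fst (snd p)) * w (snd (snd p))"
  shows "integrable lborel f" "(LINT p|lborel. f p) = sgn_form u v * (LINT \<zeta>|lborel. w \<zeta>)"
proof -
  have [measurable]: "u \<in> borel_measurable borel" "v \<in> borel_measurable borel" "w \<in> borel_measurable borel"
    using assms by (simp_all add: integrable_iff_bounded)
  have f_meas: "f \<in> borel_measurable (lborel \<Otimes>\<^sub>M (lborel \<Otimes>\<^sub>M lborel))"
    unfolding f_def by measurable
  have "integrable (lborel \<Otimes>\<^sub>M (lborel \<Otimes>\<^sub>M lborel)) (\<lambda>p. u (fst p) * (v (fst (snd p)) * w (snd (snd p))))"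
    using lborel_pair.integrable_tensor[OF u, of "\<lambda>p. v (fst p) * w (snd p)"]
      lborel_pair.integrable_tensor[OF v w] by (simp add: lborel_prod)
  then have f: "integrable (lborel \<Otimes>\<^sub>M (lborel \<Otimes>\<^sub>M lborel)) f"
    by (rule Bochner_Integration.integrable_bound[OF _ f_meas])
      (use norm_sgn_mult_le in \<open>auto simp: f_def mult.assoc\<close>)
  then have f2: "integrable (lborel \<Otimes>\<^sub>M lborel) f" by (simp add: lborel_prod)
  then show "integrable lborel f" by (simp add: lborel_prod)
  have inner: "(LINT q|lborel. f (\<xi>, q)) =
      (LINT \<eta>|lborel. complex_of_real (sgn (\<xi> + \<eta>)) * u \<xi> * v \<eta>) * (LINT \<zeta>|lborel. w \<zeta>)" for \<xi>
  proof -
    have "integrable (lborel \<Otimes>\<^sub>M lborel) (\<lambda>p. complex_of_real (sgn (\<xi> + fst p)) * v (fst p) * w (snd p))"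
      by (rule lborel_pair.integrable_tensor[OF integrable_sgn_shift_mult[OF v] w])
    then have "integrable (lborel \<Otimes>\<^sub>M lborel)
        (\<lambda>p. u \<xi> * (complex_of_real (sgn (\<xi> + fst p)) * v (fst p) * w (snd p)))"
      by (rule integrable_mult_right)
    moreover have "(\<lambda>p. u \<xi> * (complex_of_real (sgn (\<xi> + fst p)) * v (fst p) * w (snd p))) = (\<lambda>q. f (\<xi>, q))"
      by (simp add: f_def fun_eq_iff mult_ac)
    ultimately have "integrable (lborel \<Otimes>\<^sub>M lborel) (\<lambda>q. f (\<xi>, q))" by simp
    from lborel_pair.integral_fst'[OF this]
    have "(LINT q|lborel. f (\<xi>, q)) = (LINT \<eta>|lborel. LINT \<zeta>|lborel. f (\<xi>, \<eta>, \<zeta>))"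
      by (simp add: lborel_prod)
    then show ?thesis by (simp add: f_def)
  qed
  have "(LINT p|lborel. f p) = (LINT \<xi>|lborel. LINT q|lborel. f (\<xi>, q))"
    using lborel_pair.integral_fst'[OF f2] by (simp add: lborel_prod)
  then show "(LINT p|lborel. f p) = sgn_form u v * (LINT \<zeta>|lborel. w \<zeta>)"
    by (simp add: inner sgn_form_def)
qed

section \<open>Asymptotics of the Hilbert transform of a bump\<close>

lemma integral_sgn_derivative:
  fixes W W' :: "real \<Rightarrow> complex"
  assumes W: "\<And>x. (W has_vector_derivative W' x) (at x)"
    and supp: "\<And>x. \<bar>x\<bar> \<ge> R \<Longrightarrow> W x = 0" and W': "test_function W'"
  shows "(LINT x|lborel. complex_of_real (sgn (x - t)) * W' x) = - 2 * W t"
proof -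
  obtain S where S: "\<And>x. \<bar>x\<bar> \<ge> S \<Longrightarrow> W' x = 0"
    using W' by (rule test_functionE) (use that in blast)
  define Q where "Q = max (max R S) (\<bar>t\<bar> + 1)"
  let ?f = "\<lambda>x. complex_of_real (sgn (x - t)) * W' x"
  have cont: "continuous_on A W" for A
    by (intro continuous_at_imp_continuous_on ballI has_vector_derivative_continuous[OF W])
  \<comment> \<open>The integral is split at the jump. To the left the antiderivative is -W, to the
    right it is W, and each side contributes - W t.\<close>
  have "(?f has_integral (- W t) - (- W (-Q))) {-Q..t}"
  proof (rule fundamental_theorem_of_calculus_interior)
    fix x assume "x \<in> {-Q<..<t}"
    then show "((\<lambda>x. - W x) has_vector_derivative ?f x) (at x)"
      using has_vector_derivative_minus[OF W[of x]] by simp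
  qed (auto simp: Q_def intro!: continuous_intros cont)
  moreover have "(?f has_integral W Q - W t) {t..Q}"
  proof (rule fundamental_theorem_of_calculus_interior)
    fix x assume "x \<in> {t<..<Q}"
    then show "(W has_vector_derivative ?f x) (at x)"
      using W[of x] by simp
  qed (auto simp: Q_def intro!: cont)
  moreover have "W Q = 0" "W (-Q) = 0" by (auto intro!: supp simp: Q_def)
  ultimately have "(?f has_integral - 2 * W t) {-Q..Q}"
    using has_integral_combine[of "-Q" t Q ?f "- W t" "- W t"] by (simp add: Q_def)
  then have "(?f has_integral - 2 * W t) UNIV"
    by (rule has_integral_on_superset) (auto simp: Q_def intro!: S)
  moreover have "integrable lborel ?f"
    using integrable_sgn_shift_mult[OF test_function_integrable[OF W'], of "-t"] by simp
  ultimately show ?thesis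
    using has_integral_unique has_integral_integral_lborel by blast
qed

text \<open>For large y the oscillation sees only the jump of the sign at t. Integrating by parts
  twice isolates the boundary term of order 1/y and leaves a remainder of order 1/y^2, uniformly in
  t because \<open>b\<close> and its derivatives are bounded.\<close>

lemma sgn_oscillatory_integral:
  assumes b: "test_function b"
  shows "\<exists>D\<ge>0. \<forall>y t. y \<noteq> 0 \<longrightarrow>
    norm ((LINT x|lborel. complex_of_real (sgn (x - t)) * (b x * exp (2 * pi * \<i> * y * x))) +
      b t * exp (2 * pi * \<i> * y * t) / (pi * \<i> * y)) \<le> D / y\<^sup>2"
proof -
  let ?b' = "\<lambda>x. vector_derivative b (at x)"
  let ?b'' = "\<lambda>x. vector_derivative ?b' (at x)"
  note test' = test_function_derivative[OF b]
  note test'' = test_function_derivative[OF test']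
  obtain R where R: "smooth b" "\<And>x. \<bar>x\<bar> \<ge> R \<Longrightarrow> b x = 0"
    using b by (rule test_functionE) (use that in blast)
  obtain S where S: "smooth ?b'" "\<And>x. \<bar>x\<bar> \<ge> S \<Longrightarrow> ?b' x = 0"
    using test' by (rule test_functionE) (use that in blast)
  obtain B where B: "\<And>x. norm (?b' x) \<le> B" "B > 0" using test_function_bounded[OF test'] by blast
  define N where "N = (LINT x|lborel. norm (?b'' x))"
  have "N \<ge> 0" by (simp add: N_def)
  have "norm ((LINT x|lborel. complex_of_real (sgn (x - t)) * (b x * exp (2 * pi * \<i> * y * x))) +
      b t * exp (2 * pi * \<i> * y * t) / (pi * \<i> * y)) \<le> (2 * B + N) / y\<^sup>2" if "y \<noteq> 0" for y t :: real
  proof -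
    define c where "c = 2 * pi * \<i> * y"
    have "c \<noteq> 0" using that by (simp add: c_def)
    have norm_c: "norm c = 2 * pi * \<bar>y\<bar>" by (simp add: c_def norm_mult)
    let ?e = "\<lambda>x::real. exp (c * x)"
    have norm_e: "norm (?e x) = 1" for x by (simp add: c_def)
    \<comment> \<open>This carries out both integrations by parts at once: the derivative of
      \<open>W\<close> differs from b(x) exp(c x) only by b''(x) exp(c x) / c^2.\<close>
    define W where "W = (\<lambda>x. (b x / c - ?b' x / c\<^sup>2) * ?e x)"
    define W' where "W' = (\<lambda>x. (b x - ?b'' x / c\<^sup>2) * ?e x)"
    have "(W has_vector_derivative W' x) (at x)" for x
    proof -
      have "(?e has_vector_derivative c * ?e x) (at x)"
        by (rule has_vector_derivative_real_field) (auto intro!: derivative_eq_intros)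
      moreover have "((\<lambda>x. b x / c - ?b' x / c\<^sup>2) has_vector_derivative ?b' x / c - ?b'' x / c\<^sup>2) (at x)"
        by (intro has_vector_derivative_diff has_vector_derivative_divide smooth_vector_derivative R S)
      ultimately have "(W has_vector_derivative (b x / c - ?b' x / c\<^sup>2) * (c * ?e x) +
          (?b' x / c - ?b'' x / c\<^sup>2) * ?e x) (at x)"
        unfolding W_def by (intro has_vector_derivative_mult)
      also have "(b x / c - ?b' x / c\<^sup>2) * (c * ?e x) + (?b' x / c - ?b'' x / c\<^sup>2) * ?e x = W' x"
        using \<open>c \<noteq> 0\<close> by (simp add: W'_def power2_eq_square field_simps)
      finally show ?thesis .
    qed
    moreover have "W x = 0" if "\<bar>x\<bar> \<ge> max R S" for x
      using R(2)[of x] S(2)[of x] that by (simp add: W_def)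
    moreover have W': "test_function W'"
    proof -
      have "test_function (\<lambda>x. ?e x * (b x + (- 1 / c\<^sup>2) * ?b'' x))"
        by (intro test_function_mult_smooth test_function_add b test'' smooth_const smooth_exp)
      then show ?thesis by (simp add: W'_def mult.commute)
    qed
    ultimately have "(LINT x|lborel. complex_of_real (sgn (x - t)) * W' x) = - 2 * W t"
      by (intro integral_sgn_derivative)
    moreover have be: "test_function (\<lambda>x. ?b'' x * ?e x)" "test_function (\<lambda>x. b x * ?e x)"
      using test_function_mult_smooth[OF test'' smooth_exp[of c]] test_function_mult_smooth[OF b smooth_exp[of c]]
      by (simp_all add: mult.commute)
    have "(LINT x|lborel. complex_of_real (sgn (x - t)) * W' x) =
        (LINT x|lborel. complex_of_real (sgn (- t + x)) * (b x * ?e x) -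
          (1 / c\<^sup>2) * (complex_of_real (sgn (- t + x)) * (?b'' x * ?e x)))"
      by (intro Bochner_Integration.integral_cong refl) (simp add: W'_def field_simps)
    also have "\<dots> = (LINT x|lborel. complex_of_real (sgn (- t + x)) * (b x * ?e x)) -
        (1 / c\<^sup>2) * (LINT x|lborel. complex_of_real (sgn (- t + x)) * (?b'' x * ?e x))"
      by (simp only: Bochner_Integration.integral_diff[OF
            integrable_sgn_shift_mult[OF test_function_integrable[OF be(2)]]
            integrable_mult_right[OF integrable_sgn_shift_mult[OF test_function_integrable[OF be(1)]]]]
          integral_mult_right_zero)
    finally have "(LINT x|lborel. complex_of_real (sgn (- t + x)) * (b x * ?e x)) - (- 2 * b t / c * ?e t) =
        2 * ?b' t / c\<^sup>2 * ?e t +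
        (1 / c\<^sup>2) * (LINT x|lborel. complex_of_real (sgn (- t + x)) * (?b'' x * ?e x))"
      using \<open>(LINT x|lborel. complex_of_real (sgn (x - t)) * W' x) = - 2 * W t\<close>
      by (simp add: W_def algebra_simps)
    also have "norm \<dots> \<le> 2 * B / (norm c)\<^sup>2 + 1 / (norm c)\<^sup>2 * N"
    proof (rule order_trans[OF norm_triangle_ineq add_mono])
      show "norm (2 * ?b' t / c\<^sup>2 * ?e t) \<le> 2 * B / (norm c)\<^sup>2"
        using B(1)[of t] norm_e[of t]
        by (simp only: norm_mult norm_divide norm_power norm_numeral mult_1_right)
          (simp add: divide_right_mono)
      have "norm (LINT x|lborel. complex_of_real (sgn (- t + x)) * (?b'' x * ?e x)) \<le> N"
        unfolding N_def using test_function_integrable[OF test'']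
        by (intro norm_integral_le integrable_norm order_trans[OF norm_sgn_mult_le])
          (simp_all add: norm_mult norm_e del: norm_exp_eq_Re)
      then show "norm ((1 / c\<^sup>2) * (LINT x|lborel. complex_of_real (sgn (- t + x)) * (?b'' x * ?e x)))
          \<le> 1 / (norm c)\<^sup>2 * N"
        by (simp add: norm_mult norm_divide norm_power divide_right_mono)
    qed
    also have "\<dots> = (2 * B + N) / (norm c)\<^sup>2" by (simp add: add_divide_distrib)
    also have "\<dots> \<le> (2 * B + N) / y\<^sup>2"
    proof (rule divide_left_mono)
      have "1 \<le> (2 * pi)\<^sup>2" using pi_gt3 by (intro one_le_power) simp
      then show "y\<^sup>2 \<le> (norm c)\<^sup>2"
        using mult_right_mono[of 1 "(2 * pi)\<^sup>2" "y\<^sup>2"] by (simp add: norm_c power_mult_distrib)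
    qed (use B \<open>N \<ge> 0\<close> that in \<open>auto simp: norm_c\<close>)
    finally show ?thesis
      using that by (simp add: c_def mult.assoc)
  qed
  then show ?thesis using B \<open>N \<ge> 0\<close> by (intro exI[of _ "2 * B + N"]) auto
qed

definition cbump :: "real \<Rightarrow> complex" where
  "cbump x = complex_of_real (bump x)"

lemma test_function_cbump: "test_function cbump"
  unfolding cbump_def[abs_def]
  by (rule test_functionI[of _ 1]) (auto intro: smooth_of_real smooth_bump simp: bump_eq_0)

definition cbump_wave :: "real \<Rightarrow> real \<Rightarrow> complex" where
  "cbump_wave y \<xi> = cbump \<xi> * exp (2 * pi * \<i> * y * \<xi>)"

lemma integrable_cbump_wave: "integrable lborel (cbump_wave y)"
  unfolding cbump_wave_def[abs_def] by (rule inv_fourier_integrable[OF test_function_cbump])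

text \<open>In physical space this is the (unnormalised) Hilbert transform of the square of
  \<open>inv_fourier cbump\<close>.\<close>

definition bump_hilbert :: "real \<Rightarrow> complex" where
  "bump_hilbert y = sgn_form (cbump_wave y) (cbump_wave y)"

lemma bump_hilbert_bounded: "\<exists>H\<ge>0. \<forall>y. norm (bump_hilbert y) \<le> H"
proof -
  let ?N = "LINT \<xi>|lborel. norm (cbump \<xi>)"
  have "norm (bump_hilbert y) \<le> ?N * ?N" for y
    using norm_sgn_form_le[OF integrable_cbump_wave integrable_cbump_wave, of y y]
    by (simp add: bump_hilbert_def cbump_wave_def norm_mult)
  then show ?thesis by (intro exI[of _ "?N * ?N"]) auto
qed

text \<open>This is the convolution of the bump with itself at 0, that is, the integral of the
  square of \<open>inv_fourier cbump\<close>. That it is nonzero is the reason why the Hilbert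
  transform of this square decays no faster than 1/y.\<close>

definition bump_overlap :: real where
  "bump_overlap = (LINT \<xi>|lborel. bump \<xi> * bump (- \<xi>))"

lemma integrable_bump: "integrable lborel bump"
  using test_function_integrable[OF test_function_cbump]
  unfolding cbump_def[abs_def] complex_of_real_integrable_eq .

lemma integral_pos_of_unit_plateau:
  fixes f :: "real \<Rightarrow> real"
  assumes "integrable lborel f" "\<And>x. f x \<ge> 0" "\<And>x. \<bar>x\<bar> \<le> 3 / 4 \<Longrightarrow> f x = 1"
  shows "(LINT x|lborel. f x) > 0"
proof -
  have "(LINT x|lborel. indicator {-(3/4)..3/4::real} x) \<le> (LINT x|lborel. f x)"
    using assms by (intro integral_mono integrable_real_indicator) (auto simp: indicator_def)
  then show ?thesis by simp
qed

lemma bump_overlap_pos: "bump_overlap > 0"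
  unfolding bump_overlap_def
proof (rule integral_pos_of_unit_plateau)
  have "test_function (\<lambda>\<xi>. complex_of_real (bump (-1 * \<xi> + 0)) * cbump \<xi>)"
    by (intro test_function_mult_smooth test_function_cbump smooth_of_real smooth_affine smooth_bump)
  then show "integrable lborel (\<lambda>\<xi>. bump \<xi> * bump (- \<xi>))"
    using test_function_integrable complex_of_real_integrable_eq
    by (fastforce simp: cbump_def mult.commute simp flip: of_real_mult)
qed (simp_all add: bump_nonneg bump_eq_1)

text \<open>For fixed \<xi> the inner integral has its jump at \<eta> = -\<xi>. There the
  exponentials in \<xi> and \<eta> cancel, so the leading terms do not oscillate and integrate to
  \<open>bump_overlap\<close>; the constant is -1 / (\<pi> i y) = i / (\<pi> y).\<close>

lemma bump_hilbert_asymptotics: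
  "\<exists>D\<ge>0. \<forall>y. y \<noteq> 0 \<longrightarrow> norm (bump_hilbert y - \<i> * bump_overlap / (pi * y)) \<le> D / y\<^sup>2"
proof -
  obtain D where D: "D \<ge> 0" "\<And>y t. y \<noteq> 0 \<Longrightarrow>
    norm ((LINT x|lborel. complex_of_real (sgn (x - t)) * (cbump x * exp (2 * pi * \<i> * y * x))) +
      cbump t * exp (2 * pi * \<i> * y * t) / (pi * \<i> * y)) \<le> D / y\<^sup>2"
    using sgn_oscillatory_integral[OF test_function_cbump] by blast
  define N where "N = (LINT \<xi>|lborel. norm (cbump \<xi>))"
  have "norm (bump_hilbert y - \<i> * bump_overlap / (pi * y)) \<le> (N * D) / y\<^sup>2" if "y \<noteq> 0" for y
  proof -
    let ?I = "\<lambda>\<xi>. LINT \<eta>|lborel. complex_of_real (sgn (\<xi> + \<eta>)) * cbump_wave y \<xi> * cbump_wave y \<eta>"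
    let ?M = "\<lambda>\<xi>. \<i> / (pi * y) * complex_of_real (bump \<xi> * bump (- \<xi>))"
    \<comment> \<open>Integrability is read off from the positive value of the integral: it would be
      0 for a non-integrable function.\<close>
    have int_M: "integrable lborel ?M"
      using bump_overlap_pos not_integrable_integral_eq[of lborel "\<lambda>\<xi>. bump \<xi> * bump (- \<xi>)"]
      by (intro integrable_mult_right integrable_of_real) (fastforce simp: bump_overlap_def)
    have "(LINT \<xi>|lborel. ?M \<xi>) = \<i> * bump_overlap / (pi * y)"
      unfolding integral_mult_right_zero integral_complex_of_real bump_overlap_def by simp
    then have "bump_hilbert y - \<i> * bump_overlap / (pi * y) = (LINT \<xi>|lborel. ?I \<xi> - ?M \<xi>)"
      unfolding bump_hilbert_def sgn_form_def
      by (subst Bochner_Integration.integral_diff[OF integrable_sgn_form_inner int_M])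
        (auto intro: integrable_cbump_wave)
    also have "norm \<dots> \<le> (LINT \<xi>|lborel. norm (cbump \<xi>) * (D / y\<^sup>2))"
    proof (rule norm_integral_le)
      show "integrable lborel (\<lambda>\<xi>. norm (cbump \<xi>) * (D / y\<^sup>2))"
        by (intro integrable_mult_left integrable_norm test_function_integrable test_function_cbump)
      fix \<xi> :: real
      let ?J = "LINT x|lborel. complex_of_real (sgn (x - - \<xi>)) * (cbump x * exp (2 * pi * \<i> * y * x))"
      have I: "?I \<xi> = cbump_wave y \<xi> * ?J"
        unfolding integral_mult_right_zero[symmetric] cbump_wave_def
        by (intro Bochner_Integration.integral_cong refl) (simp add: add.commute mult_ac)
      have "exp (2 * pi * \<i> * y * \<xi>) * exp (2 * pi * \<i> * y * (- \<xi>)) = 1"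
        by (simp flip: exp_add)
      then have "cbump_wave y \<xi> * (cbump (- \<xi>) * exp (2 * pi * \<i> * y * (- \<xi>)) / (pi * \<i> * y)) = - ?M \<xi>"
        using that unfolding cbump_wave_def cbump_def
        by (simp add: divide_simps) 
      then have "?I \<xi> - ?M \<xi> = cbump_wave y \<xi> *
          (?J + cbump (- \<xi>) * exp (2 * pi * \<i> * y * (- \<xi>)) / (pi * \<i> * y))"
        unfolding I distrib_left by simp
      also have "norm \<dots> = norm (cbump \<xi>) *
          norm (?J + cbump (- \<xi>) * exp (2 * pi * \<i> * y * (- \<xi>)) / (pi * \<i> * y))"
        by (simp add: norm_mult cbump_wave_def)
      also have "\<dots> \<le> norm (cbump \<xi>) * (D / y\<^sup>2)"
        using D(2)[OF that, of "- \<xi>"] by (intro mult_left_mono) auto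
      finally show "norm (?I \<xi> - ?M \<xi>) \<le> norm (cbump \<xi>) * (D / y\<^sup>2)" .
    qed
    also have "\<dots> = (N * D) / y\<^sup>2" by (simp add: N_def)
    finally show ?thesis .
  qed
  then show ?thesis using D(1) by (intro exI[of _ "N * D"]) (auto simp: N_def)
qed

section \<open>Wave packets and their pairwise interaction\<close>

definition packet :: "real \<Rightarrow> real \<Rightarrow> real \<Rightarrow> complex" where
  "packet c \<nu> \<xi> = cbump (\<xi> - \<nu>) * exp (- (2 * pi * \<i> * c * (\<xi> - \<nu>)))"

lemma packet_eq_0: "\<bar>\<xi> - \<nu>\<bar> \<ge> 1 \<Longrightarrow> packet c \<nu> \<xi> = 0"
  by (simp add: packet_def cbump_def bump_eq_0)

lemma test_function_packet: "test_function (packet c \<nu>)"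
proof -
  have "test_function (\<lambda>\<xi>. exp ((- (2 * pi * \<i> * c)) * complex_of_real \<xi>) * cbump \<xi>)"
    by (intro test_function_mult_smooth smooth_exp test_function_cbump)
  from test_function_affine[OF this, of 1 "- \<nu>"] show ?thesis
    by (simp add: packet_def[abs_def] mult.commute)
qed

text \<open>The phase of a packet is measured from its central frequency \<nu>, so in physical space
  it is a pure character times the profile translated to \<open>c\<close>, with no extra constant
  phase.\<close>

lemma inv_fourier_packet:
  "inv_fourier (packet c \<nu>) x = exp (2 * pi * \<i> * x * \<nu>) * inv_fourier cbump (x - c)"
proof -
  have "inv_fourier (packet c \<nu>) x =
      (LINT \<xi>|lborel. packet c \<nu> (\<nu> + \<xi>) * exp (2 * pi * \<i> * x * (\<nu> + \<xi>)))"
    unfolding inv_fourier_def by (subst lborel_integral_real_affine[of 1 _ \<nu>]) simp_all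
  also have "\<dots> = (LINT \<xi>|lborel. exp (2 * pi * \<i> * x * \<nu>) * (cbump \<xi> * exp (2 * pi * \<i> * (x - c) * \<xi>)))"
    by (intro Bochner_Integration.integral_cong refl)
      (simp add: packet_def algebra_simps flip: exp_add)
  also have "\<dots> = exp (2 * pi * \<i> * x * \<nu>) * inv_fourier cbump (x - c)"
    by (simp add: inv_fourier_def)
  finally show ?thesis .
qed

lemma norm_inv_fourier_packet: "norm (inv_fourier (packet c \<nu>) x) = norm (inv_fourier cbump (x - c))"
  by (simp add: inv_fourier_packet norm_mult)

text \<open>Shifting the two frequencies by -\<nu> and \<nu> leaves their sum, hence the sign,
  unchanged. The modulation disappears, and the jump of the sign cuts through the product of the
  supports.\<close>

lemma sgn_form_resonant:
  "sgn_form (\<lambda>\<xi>. packet c (- \<nu>) \<xi> * exp (2 * pi * \<i> * x * \<xi>))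
      (\<lambda>\<xi>. packet c \<nu> \<xi> * exp (2 * pi * \<i> * x * \<xi>)) = bump_hilbert (x - c)"
proof -
  let ?u = "\<lambda>\<xi>. packet c (- \<nu>) \<xi> * exp (2 * pi * \<i> * x * \<xi>)"
  let ?v = "\<lambda>\<xi>. packet c \<nu> \<xi> * exp (2 * pi * \<i> * x * \<xi>)"
  have shift: "?u (- \<nu> + \<xi>) * ?v (\<nu> + \<eta>) = cbump_wave (x - c) \<xi> * cbump_wave (x - c) \<eta>" for \<xi> \<eta>
    by (simp add: packet_def cbump_wave_def algebra_simps flip: exp_add)
  have "sgn_form ?u ?v =
      (LINT \<xi>|lborel. LINT \<eta>|lborel. complex_of_real (sgn ((- \<nu> + \<xi>) + \<eta>)) * ?u (- \<nu> + \<xi>) * ?v \<eta>)"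
    unfolding sgn_form_def by (subst lborel_integral_real_affine[of 1 _ "- \<nu>"]) simp_all
  also have "\<dots> = (LINT \<xi>|lborel. LINT \<eta>|lborel.
      complex_of_real (sgn ((- \<nu> + \<xi>) + (\<nu> + \<eta>))) * ?u (- \<nu> + \<xi>) * ?v (\<nu> + \<eta>))"
  proof (rule Bochner_Integration.integral_cong[OF refl])
    fix \<xi> :: real
    show "(LINT \<eta>|lborel. complex_of_real (sgn ((- \<nu> + \<xi>) + \<eta>)) * ?u (- \<nu> + \<xi>) * ?v \<eta>) =
      (LINT \<eta>|lborel. complex_of_real (sgn ((- \<nu> + \<xi>) + (\<nu> + \<eta>))) * ?u (- \<nu> + \<xi>) * ?v (\<nu> + \<eta>))"
      by (subst lborel_integral_real_affine[of 1 _ \<nu>]) simp_all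
  qed
  also have "\<dots> = bump_hilbert (x - c)"
    unfolding bump_hilbert_def sgn_form_def mult.assoc[of _ "?u _"] shift by (simp add: mult.assoc)
  finally show ?thesis .
qed

text \<open>On the supports \<xi> + \<eta> stays within 2 of \<nu> + \<mu>, so the sign is constant
  and the form factorises.\<close>

lemma sgn_form_nonresonant:
  assumes "\<bar>\<nu> + \<mu>\<bar> > 2"
  shows "sgn_form (\<lambda>\<xi>. packet c \<nu> \<xi> * exp (2 * pi * \<i> * x * \<xi>))
      (\<lambda>\<xi>. packet d \<mu> \<xi> * exp (2 * pi * \<i> * x * \<xi>)) =
    complex_of_real (sgn (\<nu> + \<mu>)) * inv_fourier (packet c \<nu>) x * inv_fourier (packet d \<mu>) x"
proof -
  have "complex_of_real (sgn (\<xi> + \<eta>)) * (packet c \<nu> \<xi> * z) * (packet d \<mu> \<eta> * w) =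
      complex_of_real (sgn (\<nu> + \<mu>)) * (packet c \<nu> \<xi> * z) * (packet d \<mu> \<eta> * w)" for \<xi> \<eta> z w
  proof (cases "\<bar>\<xi> - \<nu>\<bar> < 1 \<and> \<bar>\<eta> - \<mu>\<bar> < 1")
    case True
    then have "sgn (\<xi> + \<eta>) = sgn (\<nu> + \<mu>)"
      using assms by (auto simp: sgn_if abs_if split: if_splits)
    then show ?thesis by simp
  next
    case False
    then show ?thesis using packet_eq_0[of \<xi> \<nu> c] packet_eq_0[of \<eta> \<mu> d] by auto
  qed
  then show ?thesis
    unfolding sgn_form_def inv_fourier_def
    by (simp only: integral_mult_right_zero integral_mult_left_zero)
qed

subsection \<open>The operator on superpositions of wave packets\<close>

text \<open>This equals 1 for |x - 1| <= 3/16. For k >= 3 a frequency within 1 of 2^k falls into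
  that region after division by 2^k, since 1/8 < 3/16.\<close>

definition high_bump :: "real \<Rightarrow> real" where
  "high_bump x = bump (4 * x + (- 4))"

lemma low_window_bump: "low_window bump"
  by (auto simp: smooth_supported_def smooth_bump intro!: bump_eq_0)

lemma high_window_high_bump: "high_window high_bump"
  unfolding smooth_supported_def
proof (intro conjI allI impI)
  show "smooth high_bump"
    unfolding high_bump_def[abs_def] by (intro smooth_affine smooth_bump)
  fix x :: real assume "x \<notin> {3/4..5/4}"
  then show "high_bump x = 0"
    unfolding high_bump_def by (intro bump_eq_0) (auto simp: abs_if)
qed

definition symbol :: "real \<times> real \<Rightarrow> real" where
  "symbol = dyadic_symbol bump high_bump 0"

text \<open>The factor 9/8 goes with indices at least 3, for which the packet radius 1 is at most
  2^k / 8. If j = k, the frequency of the packet is at least (9/8 - 1/8) 2^k, outside the support of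
  the low bump; if j = k - 1, it is at most (9/16 + 1/8) 2^k = 11/16 times 2^k, inside the plateau.
  Other j are further away from the transition.\<close>

definition freq :: "nat \<Rightarrow> real" where
  "freq j = 9 / 8 * 2 ^ j"

lemma symbol_eq:
  assumes "j \<ge> 3" "k \<ge> 3" "\<bar>\<eta> - freq j\<bar> < 1" "\<bar>\<zeta> - 2 ^ k\<bar> < 1"
  shows "symbol (\<eta>, \<zeta>) = (if j < k then 1 else 0)"
proof -
  have pow: "(2::real) ^ 3 \<le> 2 ^ j" "(2::real) ^ 3 \<le> 2 ^ k"
    using assms by (intro power_increasing; simp)+
  have pow: "(8::real) \<le> 2 ^ j" "(8::real) \<le> 2 ^ k"
    using pow by simp_all
  have \<eta>: "\<eta> < 9 / 8 * 2 ^ j + 1" "9 / 8 * 2 ^ j - 1 < \<eta>"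
    using assms(3) by (auto simp: freq_def abs_less_iff)
  have "\<bar>4 * (\<zeta> / 2 ^ k) + (- 4)\<bar> \<le> 3 / 4"
  proof -
    have "4 * (\<zeta> / 2 ^ k) + (- 4) = 4 * (\<zeta> - 2 ^ k) / 2 ^ k" by (simp add: field_simps)
    moreover have "\<bar>4 * (\<zeta> - 2 ^ k)\<bar> \<le> 3 / 4 * 2 ^ k"     proof -
      have "4 * \<bar>\<zeta> - 2 ^ k\<bar> \<le> 3 / 4 * 2 ^ k" using assms(4) pow by simp
      then show ?thesis unfolding abs_mult abs_numeral .
    qed
    ultimately show ?thesis by (simp add: divide_le_eq)
  qed
  then have hb: "high_bump (\<zeta> / 2 ^ k) = 1"
    unfolding high_bump_def by (rule bump_eq_1)
  then have "symbol (\<eta>, \<zeta>) = bump (\<eta> / 2 ^ k)"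
    using dyadic_symbol_single[OF high_window_high_bump, of "(\<eta>, \<zeta>)" k bump 0]
    by (simp add: symbol_def)
  also have "\<dots> = (if j < k then 1 else 0)"
  proof (cases "j < k")
    case True
    then have "(2::real) ^ Suc j \<le> 2 ^ k" by (intro power_increasing) auto
    then have "\<bar>\<eta>\<bar> \<le> 3 / 4 * 2 ^ k"
      using \<eta> pow unfolding power_Suc by (intro abs_leI) linarith+
    then have "\<bar>\<eta> / 2 ^ k\<bar> \<le> 3 / 4" by (simp add: divide_le_eq)
    then show ?thesis using True by (simp add: bump_eq_1)
  next
    case False
    then have "(2::real) ^ k \<le> 2 ^ j" by (intro power_increasing) auto
    then have "\<bar>\<eta>\<bar> \<ge> 2 ^ k"
      using \<eta> pow by (intro order_trans[OF _ abs_ge_self]) linarith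
    then have "\<bar>\<eta> / 2 ^ k\<bar> \<ge> 1" by (simp add: le_divide_eq)
    then show ?thesis using False by (simp add: bump_eq_0)
  qed
  finally show ?thesis .
qed

text \<open>The threshold 2 is the sum of the radii of two packets, as nonresonance requires; the
  smallest gap, between indices 3 and 4, is 9.\<close>

lemma freq_separated:
  assumes "j \<ge> 3" "l \<ge> 3" "j \<noteq> l"
  shows "\<bar>freq j - freq l\<bar> > 2"
proof -
  have "freq b - freq a > 2" if "3 \<le> a" "a < b" for a b
  proof -
    have "(2::real) ^ 3 \<le> 2 ^ a" "(2::real) ^ Suc a \<le> 2 ^ b"
      using that by (intro power_increasing; simp)+
    then show ?thesis by (simp add: freq_def)
  qed
  from this[of j l] this[of l j] assms show ?thesis by (cases "j < l") auto
qed

text \<open>\<open>packet1\<close> and \<open>packet2\<close> have opposite frequencies at the same place, so that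
  \<open>sgn (\<xi>\<^sub>1 + \<xi>\<^sub>2)\<close> sees their product near its jump.\<close>

definition packet1 :: "real \<Rightarrow> nat \<Rightarrow> real \<Rightarrow> complex" where
  "packet1 L l = packet (L * real l) (- freq l)"

definition packet2 :: "real \<Rightarrow> nat \<Rightarrow> real \<Rightarrow> complex" where
  "packet2 L j = packet (L * real j) (freq j)"

definition packet3 :: "real \<Rightarrow> nat \<Rightarrow> real \<Rightarrow> complex" where
  "packet3 L k = packet (L * real k) (2 ^ k)"

lemmas packet_defs = packet1_def packet2_def packet3_def

text \<open>Defined as one inverse transform of the summed packets, so that Fourier inversion and
  the Schwartz property apply to it directly.\<close>

definition superposition :: "(nat \<Rightarrow> real \<Rightarrow> complex) \<Rightarrow> nat set \<Rightarrow> real \<Rightarrow> complex" where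
  "superposition P J = inv_fourier (\<lambda>\<xi>. \<Sum>j\<in>J. P j \<xi>)"

lemma test_function_packets:
  "test_function (packet1 L j)" "test_function (packet2 L j)" "test_function (packet3 L j)"
  by (simp_all add: packet_defs test_function_packet)

lemma superposition_eq_sum:
  assumes "\<And>j. test_function (P j)"
  shows "superposition P J x = (\<Sum>j\<in>J. inv_fourier (P j) x)"
  unfolding superposition_def inv_fourier_def sum_distrib_right
  by (intro Bochner_Integration.integral_sum inv_fourier_integrable assms)

lemma fourier_superposition:
  assumes "\<And>j. test_function (P j)"
  shows "fourier (superposition P J) = (\<lambda>\<xi>. \<Sum>j\<in>J. P j \<xi>)"
  unfolding superposition_def by (intro fourier_inv_fourier test_function_sum assms)

definition multiplier :: "real \<times> real \<times> real \<Rightarrow> complex" where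
  "multiplier = (\<lambda>(\<xi>\<^sub>1, \<xi>\<^sub>2, \<xi>\<^sub>3). complex_of_real (sgn (\<xi>\<^sub>1 + \<xi>\<^sub>2) * symbol (\<xi>\<^sub>2, \<xi>\<^sub>3)))"

text \<open>Away from the packet supports both sides vanish, so multiplied by packets the symbol
  acts everywhere as the indicator of j < k.\<close>

lemma symbol_mult_packets:
  assumes "j \<ge> 3" "k \<ge> 3"
  shows "complex_of_real (symbol (\<eta>, \<zeta>)) * packet2 L j \<eta> * packet3 L k \<zeta> =
    (if j < k then packet2 L j \<eta> * packet3 L k \<zeta> else 0)"
proof (cases "\<bar>\<eta> - freq j\<bar> < 1 \<and> \<bar>\<zeta> - 2 ^ k\<bar> < 1")
  case True
  then show ?thesis using symbol_eq[OF assms] by simp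
next
  case False
  then show ?thesis
    using packet_eq_0[of \<eta> "freq j" "L * real j"] packet_eq_0[of \<zeta> "2 ^ k" "L * real k"]
    by (auto simp: packet_defs)
qed

text \<open>Expanding the three sums gives triples (l, j, k). The symbol keeps those with j < k.
  Among them l = j is resonant and yields a Hilbert transform, while for l different from j the
  frequencies are separated and the sign merely multiplies the product of the packets.\<close>

lemma T_op_superpositions:
  fixes J :: "nat set" and L x :: real
  assumes "finite J" and J: "\<And>j. j \<in> J \<Longrightarrow> j \<ge> 3"
  shows "T_op multiplier (superposition (packet1 L) J) (superposition (packet2 L) J) (superposition (packet3 L) J) x =
    (\<Sum>k\<in>J. inv_fourier (packet3 L k) x * (\<Sum>j | j \<in> J \<and> j < k. bump_hilbert (x - L * real j) +
      (\<Sum>l\<in>J - {j}. complex_of_real (sgn (freq j - freq l)) *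
        inv_fourier (packet1 L l) x * inv_fourier (packet2 L j) x)))"
proof -
  let ?e = "\<lambda>\<xi>::real. exp (2 * pi * \<i> * x * \<xi>)"
  let ?u = "\<lambda>l \<xi>. packet1 L l \<xi> * ?e \<xi>" and ?v = "\<lambda>j \<xi>. packet2 L j \<xi> * ?e \<xi>"
    and ?w = "\<lambda>k \<xi>. packet3 L k \<xi> * ?e \<xi>"
  let ?f = "\<lambda>k j l p. complex_of_real (sgn (fst p + fst (snd p))) * ?u l (fst p) *
      ?v j (fst (snd p)) * ?w k (snd (snd p))"
  note int = inv_fourier_integrable[OF test_function_packets(1)]
    inv_fourier_integrable[OF test_function_packets(2)]
    inv_fourier_integrable[OF test_function_packets(3)]
  note triple = triple_integral_sgn[OF int]
  \<comment> \<open>The expansion takes place in the integrand, so that integrability is needed for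
    single triples only.\<close>
  have pointwise: "(case p of (\<xi>\<^sub>1, \<xi>\<^sub>2, \<xi>\<^sub>3) \<Rightarrow> multiplier (\<xi>\<^sub>1, \<xi>\<^sub>2, \<xi>\<^sub>3) *
      (\<Sum>l\<in>J. packet1 L l \<xi>\<^sub>1) * (\<Sum>j\<in>J. packet2 L j \<xi>\<^sub>2) * (\<Sum>k\<in>J. packet3 L k \<xi>\<^sub>3) *
      exp (2 * pi * \<i> * x * (complex_of_real \<xi>\<^sub>1 + complex_of_real \<xi>\<^sub>2 + complex_of_real \<xi>\<^sub>3))) =
    (\<Sum>k\<in>J. \<Sum>j | j \<in> J \<and> j < k. \<Sum>l\<in>J. ?f k j l p)" for p :: "real \<times> real \<times> real"
  proof -
    obtain \<xi> \<eta> \<zeta> where p: "p = (\<xi>, \<eta>, \<zeta>)" by (cases p)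
    have "complex_of_real (symbol (\<eta>, \<zeta>)) * (\<Sum>j\<in>J. packet2 L j \<eta>) * (\<Sum>k\<in>J. packet3 L k \<zeta>) =
        (\<Sum>k\<in>J. \<Sum>j\<in>J. complex_of_real (symbol (\<eta>, \<zeta>)) * packet2 L j \<eta> * packet3 L k \<zeta>)"
      by (simp only: sum_distrib_left sum_distrib_right)
    also have "\<dots> = (\<Sum>k\<in>J. \<Sum>j\<in>J. if j < k then packet2 L j \<eta> * packet3 L k \<zeta> else 0)"
      by (intro sum.cong refl symbol_mult_packets J)
    also have "\<dots> = (\<Sum>k\<in>J. \<Sum>j | j \<in> J \<and> j < k. packet2 L j \<eta> * packet3 L k \<zeta>)"
      by (intro sum.cong refl sum.inter_filter[symmetric] \<open>finite J\<close>)
    finally have sym: "complex_of_real (symbol (\<eta>, \<zeta>)) * (\<Sum>j\<in>J. packet2 L j \<eta>) * (\<Sum>k\<in>J. packet3 L k \<zeta>) =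
      (\<Sum>k\<in>J. \<Sum>j | j \<in> J \<and> j < k. packet2 L j \<eta> * packet3 L k \<zeta>)" .
    have e: "exp (2 * pi * \<i> * x * (complex_of_real \<xi> + complex_of_real \<eta> + complex_of_real \<zeta>)) = ?e \<xi> * ?e \<eta> * ?e \<zeta>"
      by (simp add: algebra_simps flip: exp_add)
    have "multiplier (\<xi>, \<eta>, \<zeta>) *
        (\<Sum>l\<in>J. packet1 L l \<xi>) * (\<Sum>j\<in>J. packet2 L j \<eta>) * (\<Sum>k\<in>J. packet3 L k \<zeta>) *
        exp (2 * pi * \<i> * x * (complex_of_real \<xi> + complex_of_real \<eta> + complex_of_real \<zeta>)) =
      (complex_of_real (symbol (\<eta>, \<zeta>)) * (\<Sum>j\<in>J. packet2 L j \<eta>) * (\<Sum>k\<in>J. packet3 L k \<zeta>)) *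
        (\<Sum>l\<in>J. complex_of_real (sgn (\<xi> + \<eta>)) * packet1 L l \<xi>) * (?e \<xi> * ?e \<eta> * ?e \<zeta>)"
      unfolding e sum_distrib_left[symmetric] by (simp add: multiplier_def mult_ac)
    also have "\<dots> = (\<Sum>k\<in>J. \<Sum>j | j \<in> J \<and> j < k. \<Sum>l\<in>J. ?f k j l p)"
      unfolding sym p fst_conv snd_conv
      unfolding sum_distrib_right
      unfolding sum_distrib_left sum_distrib_right
      by (intro sum.cong refl) (simp add: mult_ac)
    finally show ?thesis by (simp add: p)
  qed
  have "T_op multiplier (superposition (packet1 L) J) (superposition (packet2 L) J) (superposition (packet3 L) J) x =
      (LINT p|lborel. (\<Sum>k\<in>J. \<Sum>j | j \<in> J \<and> j < k. \<Sum>l\<in>J. ?f k j l p))"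
    unfolding T_op_def fourier_superposition[of "packet1 L", OF test_function_packets(1)]
      fourier_superposition[of "packet2 L", OF test_function_packets(2)]
      fourier_superposition[of "packet3 L", OF test_function_packets(3)]
    by (intro Bochner_Integration.integral_cong refl pointwise)
  also have "\<dots> = (\<Sum>k\<in>J. \<Sum>j | j \<in> J \<and> j < k. \<Sum>l\<in>J. sgn_form (?u l) (?v j) * inv_fourier (packet3 L k) x)"
    by (simp only: Bochner_Integration.integral_sum Bochner_Integration.integrable_sum
        triple inv_fourier_def)
  also have "\<dots> = (\<Sum>k\<in>J. \<Sum>j | j \<in> J \<and> j < k. inv_fourier (packet3 L k) x * (\<Sum>l\<in>J. sgn_form (?u l) (?v j)))"
    by (intro sum.cong refl) (simp add: sum_distrib_left mult.commute)
  also have "\<dots> = (\<Sum>k\<in>J. inv_fourier (packet3 L k) x * (\<Sum>j | j \<in> J \<and> j < k. bump_hilbert (x - L * real j) +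
      (\<Sum>l\<in>J - {j}. complex_of_real (sgn (freq j - freq l)) *
        inv_fourier (packet1 L l) x * inv_fourier (packet2 L j) x)))"
    unfolding sum_distrib_left
  proof (intro sum.cong refl, unfold sum_distrib_left[symmetric], intro arg_cong2[where f = "(*)"] refl)
    fix k j assume "j \<in> {j \<in> J. j < k}"
    then have j: "j \<in> J" by simp
    have res: "sgn_form (?u j) (?v j) = bump_hilbert (x - L * real j)"
      unfolding packet_defs by (rule sgn_form_resonant)
    have nonres: "sgn_form (?u l) (?v j) = complex_of_real (sgn (freq j - freq l)) *
        inv_fourier (packet1 L l) x * inv_fourier (packet2 L j) x" if "l \<in> J - {j}" for l
      unfolding packet_defs
      using freq_separated[of j l] J[of l] J[OF j] that
      by (subst sgn_form_nonresonant) auto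
    show "(\<Sum>l\<in>J. sgn_form (?u l) (?v j)) = bump_hilbert (x - L * real j) +
      (\<Sum>l\<in>J - {j}. complex_of_real (sgn (freq j - freq l)) *
        inv_fourier (packet1 L l) x * inv_fourier (packet2 L j) x)"
      unfolding sum.remove[OF \<open>finite J\<close> j] res using nonres by simp
  qed
  finally show ?thesis .
qed

section \<open>Tails of widely spaced packets\<close>

lemma sum_inverse_squares_le:
  assumes "finite I" "\<And>i. i \<in> I \<Longrightarrow> i \<ge> (1::nat)"
  shows "(\<Sum>i\<in>I. 1 / (real i)\<^sup>2) \<le> 2"
proof -
  \<comment> \<open>The term - 1/n carries the induction, because 1/(n+1)^2 <= 1/n -
    1/(n+1).\<close>
  have partial: "(\<Sum>i=1..n. 1 / (real i)\<^sup>2) \<le> 2 - 1 / real n" if "n \<ge> 1" for n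
    using that
  proof (induction n rule: dec_induct)
    case (step n)
    have "1 / (real (Suc n))\<^sup>2 \<le> 1 / real n - 1 / real (Suc n)"
    proof -
      have "1 / (real (Suc n))\<^sup>2 \<le> 1 / (real n * real (Suc n))"
        using step.hyps by (intro divide_left_mono) (simp_all add: power2_eq_square)
      also have "\<dots> = 1 / real n - 1 / real (Suc n)"
        using step.hyps by (simp add: field_simps)
      finally show ?thesis .
    qed
    then show ?case using step by simp
  qed simp
  have "I \<subseteq> {1..Max (insert 1 I)}" using assms by auto
  then have "(\<Sum>i\<in>I. 1 / (real i)\<^sup>2) \<le> (\<Sum>i=1..Max (insert 1 I). 1 / (real i)\<^sup>2)"
    by (intro sum_mono2) auto
  also have "\<dots> \<le> 2 - 1 / real (Max (insert 1 I))"
    using assms by (intro partial) simp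
  also have "\<dots> \<le> 2" by simp
  finally show ?thesis .
qed

text \<open>Each distance to \<open>m\<close> occurs at most once on either side. The centre is an
  integer because it will be the lattice index nearest to an arbitrary, possibly negative,
  point.\<close>

lemma sum_inverse_square_distances_le:
  fixes m :: int
  assumes "finite K"
  shows "(\<Sum>k | k \<in> K \<and> int k \<noteq> m. 1 / (real k - real_of_int m)\<^sup>2) \<le> 4"
proof -
  let ?d = "\<lambda>k. nat \<bar>int k - m\<bar>"
  have half: "(\<Sum>k\<in>A. 1 / (real k - real_of_int m)\<^sup>2) \<le> 2"
    if "finite A" "inj_on ?d A" "\<And>k. k \<in> A \<Longrightarrow> int k \<noteq> m" for A
  proof -
    have "(real k - real_of_int m)\<^sup>2 = (real (?d k))\<^sup>2" for k
    proof -
      have "real (?d k) = \<bar>real k - real_of_int m\<bar>" by (simp add: of_nat_nat)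
      then show ?thesis by simp
    qed
    then have "(\<Sum>k\<in>A. 1 / (real k - real_of_int m)\<^sup>2) = (\<Sum>i\<in>?d ` A. 1 / (real i)\<^sup>2)"
      using that(2) by (simp add: sum.reindex)
    also have "\<dots> \<le> 2"
      using that by (intro sum_inverse_squares_le) force+
    finally show ?thesis .
  qed
  have "(\<Sum>k | k \<in> K \<and> int k \<noteq> m. 1 / (real k - real_of_int m)\<^sup>2) =
      (\<Sum>k\<in>{k\<in>K. int k < m} \<union> {k\<in>K. int k > m}. 1 / (real k - real_of_int m)\<^sup>2)"
    by (intro sum.cong) auto
  also have "\<dots> = (\<Sum>k\<in>{k\<in>K. int k < m}. 1 / (real k - real_of_int m)\<^sup>2) +
      (\<Sum>k\<in>{k\<in>K. int k > m}. 1 / (real k - real_of_int m)\<^sup>2)"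
    using assms by (intro sum.union_disjoint) auto
  also have "\<dots> \<le> 2 + 2"
    using assms by (intro add_mono half) (auto simp: inj_on_def)
  finally show ?thesis by simp
qed

text \<open>\<open>\<tau> \<le> \<kappa>\<close> makes a packet dominate, on the ball of radius \<open>r\<close> about its centre,
  the sum of all the others.\<close>

locale packet_spacing =
  fixes g :: "real \<Rightarrow> complex" and L r A \<tau> \<kappa> :: real
  assumes g_def: "g = inv_fourier cbump"
    and L: "L \<ge> 2" and r: "0 < r" "r \<le> 1 / 2" and \<kappa>: "\<kappa> > 0" and \<tau>: "\<tau> \<le> \<kappa>"
    and g_bound: "\<And>x. norm (g x) \<le> A"
    and g_lower: "\<And>x. \<bar>x\<bar> \<le> r \<Longrightarrow> norm (g x) \<ge> 2 * \<kappa>"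
    and g_tail: "\<And>K x m. finite K \<Longrightarrow> \<bar>x - L * real_of_int m\<bar> \<le> L / 2 \<Longrightarrow>
      (\<Sum>k | k \<in> K \<and> int k \<noteq> m. \<bar>real k - real_of_int m\<bar> * norm (g (x - L * real k))) \<le> \<tau>"

text \<open>If x is nearest to the lattice point with index \<open>m\<close>, its distance to the
  k-th one is at least L |k - m| / 2. Cubic decay beats the weight |k - m| and leaves a convergent
  sum of inverse squares; the factor L^(-3) allows the tail to be made small by wide
  spacing.\<close>

lemma inv_fourier_tail:
  assumes b: "test_function b"
  shows "\<exists>C\<ge>0. \<forall>L x m K. finite K \<longrightarrow> L > 0 \<longrightarrow> \<bar>x - L * real_of_int m\<bar> \<le> L / 2 \<longrightarrow>
    (\<Sum>k | k \<in> K \<and> int k \<noteq> m. \<bar>real k - real_of_int m\<bar> * norm (inv_fourier b (x - L * real k))) \<le> C / L ^ 3"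
proof -
  obtain C where C: "\<And>x. \<bar>x\<bar> ^ 3 * norm (inv_fourier b x) \<le> C"
    using inv_fourier_decay[OF b] by blast
  have "C \<ge> 0" using C[of 0] by simp
  have "(\<Sum>k | k \<in> K \<and> int k \<noteq> m. \<bar>real k - real_of_int m\<bar> * norm (inv_fourier b (x - L * real k))) \<le> 32 * C / L ^ 3"
    if "finite K" "L > 0" and x: "\<bar>x - L * real_of_int m\<bar> \<le> L / 2" for L x :: real and m :: int and K :: "nat set"
  proof -
    have term_le: "\<bar>real k - real_of_int m\<bar> * norm (inv_fourier b (x - L * real k)) \<le>
        8 * C / L ^ 3 * (1 / (real k - real_of_int m)\<^sup>2)" if "int k \<noteq> m" for k
    proof -
      define d where "d = \<bar>real k - real_of_int m\<bar>"
      have "d \<ge> 1" unfolding d_def using that by linarith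
      have Ld: "\<bar>L * real_of_int m - L * real k\<bar> = L * d"
        using \<open>L > 0\<close> by (simp add: d_def abs_mult flip: right_diff_distrib)
      have "L * 1 \<le> L * d" using \<open>d \<ge> 1\<close> \<open>L > 0\<close> by (intro mult_left_mono) auto
      then have "L * d / 2 \<le> \<bar>x - L * real k\<bar>"
        using x Ld by linarith
      then have "(L * d / 2) ^ 3 * norm (inv_fourier b (x - L * real k)) \<le>
          \<bar>x - L * real k\<bar> ^ 3 * norm (inv_fourier b (x - L * real k))"
        using \<open>d \<ge> 1\<close> \<open>L > 0\<close> by (intro mult_right_mono power_mono) auto
      also have "\<dots> \<le> C" by (rule C)
      finally have "d * norm (inv_fourier b (x - L * real k)) \<le> 8 * C / L ^ 3 * (1 / d\<^sup>2)"
        using \<open>d \<ge> 1\<close> \<open>L > 0\<close> by (simp add: field_simps power_divide power3_eq_cube power2_eq_square)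
      then show ?thesis by (simp add: d_def)
    qed
    then have "(\<Sum>k | k \<in> K \<and> int k \<noteq> m. \<bar>real k - real_of_int m\<bar> * norm (inv_fourier b (x - L * real k))) \<le>
        8 * C / L ^ 3 * (\<Sum>k | k \<in> K \<and> int k \<noteq> m. 1 / (real k - real_of_int m)\<^sup>2)"
      unfolding sum_distrib_left by (intro sum_mono) auto
    also have "\<dots> \<le> 8 * C / L ^ 3 * 4"
      using \<open>C \<ge> 0\<close> \<open>L > 0\<close> by (intro mult_left_mono sum_inverse_square_distances_le \<open>finite K\<close>) auto
    finally show ?thesis by simp
  qed
  then show ?thesis using \<open>C \<ge> 0\<close> by (intro exI[of _ "32 * C"]) auto
qed

lemma packet_spacing_exists: "\<exists>L r A \<tau> \<kappa>. packet_spacing (inv_fourier cbump) L r A \<tau> \<kappa>"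
proof -
  let ?g = "inv_fourier cbump"
  note test = test_function_cbump
  have "?g 0 = complex_of_real (LINT x|lborel. bump x)"
    by (simp add: inv_fourier_def cbump_def integral_complex_of_real)
  moreover have "(LINT x|lborel. bump x) > 0"
    by (rule integral_pos_of_unit_plateau) (auto simp: integrable_bump bump_nonneg bump_eq_1)
  ultimately have g0: "norm (?g 0) > 0" by simp
  \<comment> \<open>With |g(0)| = 4 \<kappa>, continuity keeps 2 \<kappa> near the centre, and
    \<kappa> of this may still be lost to the other packets.\<close>
  define \<kappa> where "\<kappa> = norm (?g 0) / 4"
  have \<kappa>: "\<kappa> > 0" using g0 by (simp add: \<kappa>_def)
  obtain A where A: "\<And>x. norm (?g x) \<le> A" using norm_inv_fourier_le by blast
  obtain C where C: "C \<ge> 0" "\<And>L x m K. finite K \<Longrightarrow> L > 0 \<Longrightarrow> \<bar>x - L * real_of_int m\<bar> \<le> L / 2 \<Longrightarrow>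
    (\<Sum>k | k \<in> K \<and> int k \<noteq> m. \<bar>real k - real_of_int m\<bar> * norm (?g (x - L * real k))) \<le> C / L ^ 3"
    using inv_fourier_tail[OF test] by blast
  \<comment> \<open>As L >= 1, the tail C / L^3 is at most C / L, hence at most \<kappa>.\<close>
  define L where "L = max 2 (C / \<kappa>)"
  have L: "L \<ge> 2" "L \<ge> C / \<kappa>" by (auto simp: L_def)
  have "C / L ^ 3 \<le> \<kappa>"
  proof -
    have "C \<le> L * \<kappa>" using L \<kappa> by (simp add: divide_le_eq)
    also have "\<dots> \<le> L ^ 3 * \<kappa>"
      using L \<kappa> power_increasing[of 1 3 L] by (intro mult_right_mono) auto
    finally show ?thesis using L by (simp add: divide_le_eq mult.commute)
  qed
  have "isCont ?g 0"
    using inv_fourier_continuous[OF test, of UNIV] by (simp add: continuous_on_eq_continuous_at)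
  then obtain d where d: "d > 0" "\<And>x. \<bar>x\<bar> < d \<Longrightarrow> norm (?g x - ?g 0) < 2 * \<kappa>"
  proof -
    have "\<exists>d>0. \<forall>x. norm (x - 0) < d \<longrightarrow> norm (?g x - ?g 0) < 2 * \<kappa>"
      using \<open>isCont ?g 0\<close> \<kappa> unfolding continuous_at_eps_delta dist_norm by simp
    then show ?thesis using that by auto
  qed
  define r where "r = min (1 / 2) (d / 2)"
  have "norm (?g x) \<ge> 2 * \<kappa>" if "\<bar>x\<bar> \<le> r" for x
  proof -
    have "norm (?g x - ?g 0) < 2 * \<kappa>" using that d by (intro d(2)) (auto simp: r_def)
    moreover have "norm (?g 0) \<le> norm (?g x) + norm (?g x - ?g 0)"
      using norm_triangle_sub[of "?g 0" "?g x"] by (simp add: norm_minus_commute)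
    ultimately show ?thesis by (simp add: \<kappa>_def)
  qed
  then have "packet_spacing ?g L r A (C / L ^ 3) \<kappa>"
    using d(1) L \<kappa> A C(2) \<open>C / L ^ 3 \<le> \<kappa>\<close> by unfold_locales (auto simp: r_def)
  then show ?thesis by blast
qed

subsection \<open>Lower bounds and failure of the estimates\<close>

lemma packets_norm:
  "norm (inv_fourier (packet1 L j) x) = norm (inv_fourier cbump (x - L * real j))"
  "norm (inv_fourier (packet2 L j) x) = norm (inv_fourier cbump (x - L * real j))"
  "norm (inv_fourier (packet3 L j) x) = norm (inv_fourier cbump (x - L * real j))"
  by (simp_all add: packet_defs norm_inv_fourier_packet)

context packet_spacing
begin

lemma A_nonneg: "A \<ge> 0"
  using g_bound[of 0] norm_ge_zero order_trans by blast

lemma \<tau>_nonneg: "\<tau> \<ge> 0"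
  using g_tail[of "{}" 0 0] L by simp

lemma g_tail_plain:
  assumes "finite K" "\<bar>x - L * real_of_int m\<bar> \<le> L / 2"
  shows "(\<Sum>k | k \<in> K \<and> int k \<noteq> m. norm (g (x - L * real k))) \<le> \<tau>"
proof (rule order_trans[OF sum_mono g_tail[OF assms]])
  fix k assume "k \<in> {k \<in> K. int k \<noteq> m}"
  then have "1 \<le> \<bar>real k - real_of_int m\<bar>" by simp linarith
  then show "norm (g (x - L * real k)) \<le> \<bar>real k - real_of_int m\<bar> * norm (g (x - L * real k))"
    using mult_right_mono[of 1 "\<bar>real k - real_of_int m\<bar>" "norm (g (x - L * real k))"] by simp
qed

text \<open>Some lattice point lies within L/2 of x; the packet there contributes at most
  \<open>A\<close>, all others together at most \<tau>. The bound does not depend on the number of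
  packets.\<close>

lemma sum_translates_le:
  assumes "finite K"
  shows "(\<Sum>k\<in>K. norm (g (x - L * real k))) \<le> A + \<tau>"
proof -
  define m where "m = round (x / L)"
  have "\<bar>x - L * real_of_int m\<bar> = L * \<bar>x / L - real_of_int m\<bar>"
  proof -
    have "x - L * real_of_int m = L * (x / L - real_of_int m)" using L by (simp add: field_simps)
    then show ?thesis using L by (simp add: abs_mult)
  qed
  also have "\<dots> \<le> L * (1 / 2)"
    using L of_int_round_abs_le[of "x / L"] by (intro mult_left_mono) (auto simp: m_def abs_minus_commute)
  finally have m: "\<bar>x - L * real_of_int m\<bar> \<le> L / 2" by simp
  have "(\<Sum>k\<in>K. norm (g (x - L * real k))) =
      (\<Sum>k\<in>{k\<in>K. int k = m} \<union> {k\<in>K. int k \<noteq> m}. norm (g (x - L * real k)))"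
    by (intro sum.cong) auto
  also have "\<dots> = (\<Sum>k\<in>{k\<in>K. int k = m}. norm (g (x - L * real k))) +
      (\<Sum>k\<in>{k\<in>K. int k \<noteq> m}. norm (g (x - L * real k)))"
    using assms by (intro sum.union_disjoint) auto
  also have "(\<Sum>k\<in>{k\<in>K. int k = m}. norm (g (x - L * real k))) \<le> (\<Sum>k\<in>{k\<in>K. int k = m}. A)"
    by (intro sum_mono g_bound)
  also have "\<dots> \<le> A"
  proof -
    have "{k\<in>K. int k = m} \<subseteq> {nat m}" by auto
    then have "card {k\<in>K. int k = m} \<le> 1" using card_mono[of "{nat m}"] by fastforce
    then show ?thesis using A_nonneg mult_right_mono[of "real (card {k\<in>K. int k = m})" 1 A] by simp
  qed
  finally show ?thesis using g_tail_plain[OF assms m] by simp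
qed

lemma superposition_bound:
  assumes "finite K" "\<And>j. test_function (P j)"
    and "\<And>j x. norm (inv_fourier (P j) x) = norm (g (x - L * real j))"
  shows "norm (superposition P K x) \<le> A + \<tau>"
  unfolding superposition_eq_sum[OF assms(2)]
  by (rule order_trans[OF norm_sum]) (simp add: assms sum_translates_le)

lemma superposition_integral:
  assumes "finite K" "\<And>j. test_function (P j)"
    and "\<And>j x. norm (inv_fourier (P j) x) = norm (g (x - L * real j))"
  shows "(LINT x|lborel. norm (superposition P K x)) \<le> real (card K) * (LINT x|lborel. norm (g x))"
proof -
  have int: "integrable lborel g"
    unfolding g_def by (rule inv_fourier_integrable_self[OF test_function_cbump])
  have int': "integrable lborel (\<lambda>x. norm (g (x - L * real j)))" for j
    using lborel_integrable_real_affine[OF integrable_norm[OF int], of 1 "- L * real j"] by simp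
  have eq: "(LINT x|lborel. norm (g (x - L * real j))) = (LINT x|lborel. norm (g x))" for j
    using lborel_integral_real_affine[of 1 "\<lambda>x. norm (g x)" "- L * real j"] by simp
  have pointwise: "norm (superposition P K x) \<le> (\<Sum>j\<in>K. norm (g (x - L * real j)))" for x
    unfolding superposition_eq_sum[OF assms(2)] by (rule order_trans[OF norm_sum]) (simp add: assms(3))
  have "integrable lborel (superposition P K)"
    unfolding superposition_def by (intro inv_fourier_integrable_self test_function_sum assms)
  then have "(LINT x|lborel. norm (superposition P K x)) \<le>
      (LINT x|lborel. (\<Sum>j\<in>K. norm (g (x - L * real j))))"
    by (intro integral_mono integrable_norm Bochner_Integration.integrable_sum int' pointwise)
  also have "\<dots> = real (card K) * (LINT x|lborel. norm (g x))"
    by (subst Bochner_Integration.integral_sum) (simp_all only: int' eq sum_constant of_nat_id)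
  finally show ?thesis .
qed

lemma superposition3_lower:
  assumes "finite K" "m \<in> K" "\<bar>x - L * real m\<bar> \<le> r"
  shows "norm (superposition (packet3 L) K x) \<ge> \<kappa>"
proof -
  let ?f = "\<lambda>k. inv_fourier (packet3 L k) x"
  have x: "\<bar>x - L * real_of_int (int m)\<bar> \<le> L / 2" using assms(3) r L by simp
  have "norm (\<Sum>k\<in>K - {m}. ?f k) \<le> (\<Sum>k\<in>K - {m}. norm (g (x - L * real k)))"
    by (rule order_trans[OF norm_sum]) (simp add: packets_norm g_def)
  also have "\<dots> = (\<Sum>k | k \<in> K \<and> int k \<noteq> int m. norm (g (x - L * real k)))"
    by (intro sum.cong) auto
  also have "\<dots> \<le> \<kappa>"
    using g_tail_plain[OF assms(1) x] \<tau> by linarith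
  finally have tail: "norm (\<Sum>k\<in>K - {m}. ?f k) \<le> \<kappa>" .
  have "superposition (packet3 L) K x = ?f m + (\<Sum>k\<in>K - {m}. ?f k)"
    unfolding superposition_eq_sum[OF test_function_packets(3)] by (rule sum.remove[OF assms(1,2)])
  then have "norm (?f m) \<le> norm (superposition (packet3 L) K x) + norm (\<Sum>k\<in>K - {m}. ?f k)"
    using norm_triangle_ineq4[of "superposition (packet3 L) K x" "\<Sum>k\<in>K - {m}. ?f k"] by simp
  moreover have "norm (?f m) \<ge> 2 * \<kappa>"
    using g_lower[OF assms(3)] by (simp add: packets_norm g_def)
  ultimately show ?thesis using tail by simp
qed

text \<open>All centres L j with j < m lie to the left of x, so the leading terms are positive
  multiples of i and cannot cancel. Their imaginary parts dominate a harmonic sum, and the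
  remainders are summable.\<close>

lemma hilbert_sum_lower:
  "\<exists>c D. c > 0 \<and> (\<forall>m x. m \<ge> 3 \<longrightarrow> \<bar>x - L * real m\<bar> \<le> r \<longrightarrow>
    c * harm (m - 3) - D \<le> norm (\<Sum>j=3..<m. bump_hilbert (x - L * real j)))"
proof -
  obtain D where D: "D \<ge> 0"
    "\<And>y. y \<noteq> 0 \<Longrightarrow> norm (bump_hilbert y - \<i> * bump_overlap / (pi * y)) \<le> D / y\<^sup>2"
    using bump_hilbert_asymptotics by blast
  \<comment> \<open>The factor 2 allows for the distance y from x to L (m - i), which is at most 2 L
    i.\<close>
  define c where "c = bump_overlap / (2 * pi * L)"
  have "c > 0" using bump_overlap_pos L by (simp add: c_def)
  have "c * harm (m - 3) - 8 * D \<le> norm (\<Sum>j=3..<m. bump_hilbert (x - L * real j))"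
    if "m \<ge> 3" and x: "\<bar>x - L * real m\<bar> \<le> r" for m :: nat and x :: real
  proof -
    have Im_ge: "Im (bump_hilbert (x - L * real j)) \<ge> c / real (m - j) - 4 * D * (1 / (real (m - j))\<^sup>2)"
      if "j \<in> {3..<m}" for j
    proof -
      define i where "i = real (m - j)"
      define y where "y = x - L * real j"
      have i: "i \<ge> 1" "real m = real j + i" using that by (auto simp: i_def of_nat_diff)
      have "y = (x - L * real m) + L * i" by (simp add: y_def i(2) algebra_simps)
      moreover have "L * 1 \<le> L * i" using L i by (intro mult_left_mono) auto
      ultimately have y: "L * i / 2 \<le> y" "y \<le> 2 * (L * i)"
        using x r L by linarith+
      have "i / 1 \<le> L * i / 2" using L i by simp
      then have "i \<le> y" "y > 0" using y i by linarith+
      have "Im (\<i> * bump_overlap / (pi * y)) = bump_overlap / (pi * y)"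
        by (simp add: Im_divide_of_real flip: of_real_mult)
      moreover have "\<bar>Im (bump_hilbert y - \<i> * bump_overlap / (pi * y))\<bar> \<le> D / y\<^sup>2"
        using D(2)[of y] \<open>y > 0\<close> abs_Im_le_cmod order_trans by blast
      ultimately have Im_y: "bump_overlap / (pi * y) - D / y\<^sup>2 \<le> Im (bump_hilbert y)"
        by simp
      have main: "c / i \<le> bump_overlap / (pi * y)"
      proof -
        have "c / i = bump_overlap / (pi * (2 * (L * i)))" by (simp add: c_def)
        also have "\<dots> \<le> bump_overlap / (pi * y)"
          using y \<open>y > 0\<close> bump_overlap_pos L i by (intro divide_left_mono mult_left_mono mult_pos_pos) auto
        finally show ?thesis .
      qed
      have error: "D / y\<^sup>2 \<le> 4 * D * (1 / i\<^sup>2)"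
      proof -
        have "D / y\<^sup>2 \<le> D / i\<^sup>2"
          using D(1) \<open>i \<le> y\<close> \<open>y > 0\<close> i by (intro divide_left_mono power_mono) auto
        also have "\<dots> \<le> 4 * D * (1 / i\<^sup>2)" using D(1) by (simp add: divide_right_mono)
        finally show ?thesis .
      qed
      show ?thesis
        using order_trans[OF diff_mono[OF main error] Im_y] by (simp only: i_def y_def)
    qed
    have "c * harm (m - 3) - 8 * D \<le>
        c * harm (m - 3) - 4 * D * (\<Sum>i=1..m - 3. 1 / (real i)\<^sup>2)"
      using sum_inverse_squares_le[of "{1..m - 3}"] D(1)
        mult_left_mono[of "\<Sum>i=1..m - 3. 1 / (real i)\<^sup>2" 2 "4 * D"] by simp
    also have "\<dots> = (\<Sum>i=1..m - 3. c / real i - 4 * D * (1 / (real i)\<^sup>2))"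
      by (simp add: harm_def sum_subtractf sum_distrib_left divide_inverse)
    also have "\<dots> = (\<Sum>j=3..<m. c / real (m - j) - 4 * D * (1 / (real (m - j))\<^sup>2))"
      by (rule sum.reindex_bij_witness[of _ "\<lambda>j. m - j" "\<lambda>i. m - i"]) (use \<open>m \<ge> 3\<close> in auto)
    also have "\<dots> \<le> (\<Sum>j=3..<m. Im (bump_hilbert (x - L * real j)))"
      by (intro sum_mono Im_ge)
    also have "\<dots> = Im (\<Sum>j=3..<m. bump_hilbert (x - L * real j))" by (simp add: Im_sum)
    also have "\<dots> \<le> norm (\<Sum>j=3..<m. bump_hilbert (x - L * real j))"
      using abs_Im_le_cmod abs_ge_self order_trans by blast
    finally show ?thesis .
  qed
  with \<open>c > 0\<close> show ?thesis by blast
qed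

abbreviation response :: "nat \<Rightarrow> real \<Rightarrow> complex" where
  "response N \<equiv> T_op multiplier (superposition (packet1 L) {3..<N})
    (superposition (packet2 L) {3..<N}) (superposition (packet3 L) {3..<N})"

text \<open>Near \<open>L * m\<close> the sum over \<open>k\<close> may be frozen at \<open>k = m\<close>, up to a bounded error, since the
  inner sums differ by \<open>O(|k - m|)\<close> and the packets decay.\<close>

lemma response_lower:
  "\<exists>E. \<forall>N m x. m \<in> {3..<N} \<longrightarrow> \<bar>x - L * real m\<bar> \<le> r \<longrightarrow>
    \<kappa> * norm (\<Sum>j=3..<m. bump_hilbert (x - L * real j)) - E \<le> norm (response N x)"
proof -
  obtain H where H: "H \<ge> 0" "\<And>y. norm (bump_hilbert y) \<le> H"
    using bump_hilbert_bounded by blast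
  \<comment> \<open>The first summand is the cost of freezing k at m. The second bounds the terms
    with l different from j by three sums of packet moduli, each at most A + \<tau>. Neither depends
    on \<open>N\<close> or \<open>m\<close>.\<close>
  define E where "E = H * \<tau> + (A + \<tau>) * ((A + \<tau>) * (A + \<tau>))"
  have "\<kappa> * norm (\<Sum>j=3..<m. bump_hilbert (x - L * real j)) - E \<le> norm (response N x)"
    if m: "m \<in> {3..<N}" and x: "\<bar>x - L * real m\<bar> \<le> r" for N m :: nat and x :: real
  proof -
    let ?J = "{3..<N}"
    let ?g = "\<lambda>k. norm (g (x - L * real k))"
    let ?f1 = "\<lambda>k. inv_fourier (packet1 L k) x" and ?f2 = "\<lambda>k. inv_fourier (packet2 L k) x"
      and ?f3 = "\<lambda>k. inv_fourier (packet3 L k) x"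
    define S where "S k = (\<Sum>j | j \<in> ?J \<and> j < k. bump_hilbert (x - L * real j))" for k
    define R where "R k = (\<Sum>j | j \<in> ?J \<and> j < k. \<Sum>l\<in>?J - {j}.
      complex_of_real (sgn (freq j - freq l)) * ?f1 l * ?f2 j)" for k
    have out: "response N x = (\<Sum>k\<in>?J. ?f3 k * (S k + R k))"
      by (subst T_op_superpositions) (simp_all add: S_def R_def sum.distrib)
    have Sm: "S m = (\<Sum>j=3..<m. bump_hilbert (x - L * real j))"
      unfolding S_def using m by (intro sum.cong) auto
    have total: "(\<Sum>k\<in>B. ?g k) \<le> A + \<tau>" if "B \<subseteq> ?J" for B
      using that by (intro sum_translates_le) (auto intro: finite_subset)
    have R: "norm (R k) \<le> (A + \<tau>) * (A + \<tau>)" for k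
    proof -
      have "norm (R k) \<le> (\<Sum>j | j \<in> ?J \<and> j < k. \<Sum>l\<in>?J - {j}. ?g l * ?g j)"
        unfolding R_def
        by (intro sum_norm_le) (simp add: norm_mult packets_norm g_def sgn_if)
      also have "\<dots> \<le> (\<Sum>j | j \<in> ?J \<and> j < k. (A + \<tau>) * ?g j)"
        unfolding sum_distrib_right[symmetric]
        by (intro sum_mono mult_right_mono total) auto
      also have "\<dots> \<le> (A + \<tau>) * (A + \<tau>)"
        unfolding sum_distrib_left[symmetric] using A_nonneg \<tau>_nonneg
        by (intro mult_left_mono total) auto
      finally show ?thesis .
    qed
    have S_diff: "norm (S k - S m) \<le> H * \<bar>real k - real m\<bar>" if "k \<in> ?J" for k
    proof -
      have S_eq: "S i = (\<Sum>j=3..<i. bump_hilbert (x - L * real j))" if "i \<in> ?J" for i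
        unfolding S_def using that by (intro sum.cong) auto
      have le: "norm (S b - S a) \<le> H * real (b - a)" if "a \<in> ?J" "b \<in> ?J" "a \<le> b" for a b
      proof -
        have "S b - S a = (\<Sum>j=a..<b. bump_hilbert (x - L * real j))"
          using that unfolding S_eq[OF that(1)] S_eq[OF that(2)]
          by (simp add: sum_diff_nat_ivl)
        also have "norm \<dots> \<le> real (card {a..<b}) * H"
          by (rule sum_norm_bound) (rule H)
        finally show ?thesis by (simp add: mult.commute)
      qed
      show ?thesis
      proof (cases "k \<le> m")
        case True
        then show ?thesis using le[of k m] m that by (simp add: norm_minus_commute of_nat_diff)
      next
        case False
        then show ?thesis using le[of m k] m that by (simp add: of_nat_diff)
      qed
    qed
    have xm: "\<bar>x - L * real_of_int (int m)\<bar> \<le> L / 2" using x r L by simp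
    have "norm (\<Sum>k\<in>?J. ?f3 k * (S k - S m)) \<le> (\<Sum>k\<in>?J. ?g k * (H * \<bar>real k - real m\<bar>))"
      by (intro sum_norm_le) (auto simp: norm_mult packets_norm g_def intro!: mult_left_mono S_diff)
    also have "\<dots> = (\<Sum>k | k \<in> ?J \<and> int k \<noteq> int m. ?g k * (H * \<bar>real k - real m\<bar>))"
      by (intro sum.mono_neutral_right) auto
    also have "\<dots> = H * (\<Sum>k | k \<in> ?J \<and> int k \<noteq> int m. \<bar>real k - real_of_int (int m)\<bar> * ?g k)"
      by (simp add: sum_distrib_left mult_ac)
    \<comment> \<open>The weight |k - m| in \<open>g_tail\<close> is there to absorb this linear
      growth.\<close>
    also have "\<dots> \<le> H * \<tau>"
      using g_tail[OF _ xm, of ?J] H(1) by (intro mult_left_mono) auto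
    finally have err1: "norm (\<Sum>k\<in>?J. ?f3 k * (S k - S m)) \<le> H * \<tau>" .
    have "norm (\<Sum>k\<in>?J. ?f3 k * R k) \<le> (\<Sum>k\<in>?J. ?g k * ((A + \<tau>) * (A + \<tau>)))"
      by (intro sum_norm_le) (auto simp: norm_mult packets_norm g_def intro!: mult_left_mono R)
    also have "\<dots> \<le> (A + \<tau>) * ((A + \<tau>) * (A + \<tau>))"
      unfolding sum_distrib_right[symmetric] using A_nonneg \<tau>_nonneg
      by (intro mult_right_mono total) auto
    finally have err2: "norm (\<Sum>k\<in>?J. ?f3 k * R k) \<le> (A + \<tau>) * ((A + \<tau>) * (A + \<tau>))" .
    have triangle: "norm (a - b - c) \<le> norm a + u + v"
      if "norm b \<le> u" "norm c \<le> v" for a b c :: complex and u v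
      using that norm_triangle_ineq4[of "a - b" c] norm_triangle_ineq4[of a b] by linarith
    let ?F = "superposition (packet3 L) ?J x"
    have "?F * S m = (\<Sum>k\<in>?J. ?f3 k * S m)"
      by (simp add: superposition_eq_sum test_function_packets sum_distrib_right)
    also have "\<dots> = response N x - (\<Sum>k\<in>?J. ?f3 k * (S k - S m)) - (\<Sum>k\<in>?J. ?f3 k * R k)"
      unfolding out by (simp add: algebra_simps sum.distrib sum_subtractf)
    finally have decomposition: "?F * S m = response N x - (\<Sum>k\<in>?J. ?f3 k * (S k - S m)) - (\<Sum>k\<in>?J. ?f3 k * R k)" .
    have "norm (?F * S m) \<le> norm (response N x) + H * \<tau> + (A + \<tau>) * ((A + \<tau>) * (A + \<tau>))"
      unfolding decomposition by (rule triangle[OF err1 err2])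
    then have "norm ?F * norm (S m) \<le> norm (response N x) + E"
      by (simp only: norm_mult E_def add.assoc)
    moreover have "\<kappa> * norm (S m) \<le> norm ?F * norm (S m)"
      using superposition3_lower[OF _ m x] by (intro mult_right_mono) auto
    ultimately show ?thesis by (simp add: Sm)
  qed
  then show ?thesis by blast
qed

text \<open>The divergent harmonic sum outgrows the fixed losses. The threshold \<open>M\<close> is
  independent of \<open>N\<close>, so \<open>N\<close> can be chosen after it.\<close>

lemma response_unbounded:
  "\<exists>M\<ge>1. \<forall>m N x. M \<le> m \<longrightarrow> m < N \<longrightarrow> \<bar>x - L * real m\<bar> \<le> r \<longrightarrow> K \<le> norm (response N x)"
proof -
  obtain c D where c: "c > 0" and D: "\<And>m x. m \<ge> 3 \<Longrightarrow> \<bar>x - L * real m\<bar> \<le> r \<Longrightarrow>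
    c * harm (m - 3) - D \<le> norm (\<Sum>j=3..<m. bump_hilbert (x - L * real j))"
    using hilbert_sum_lower by blast
  obtain E where E: "\<And>N m x. m \<in> {3..<N} \<Longrightarrow> \<bar>x - L * real m\<bar> \<le> r \<Longrightarrow>
    \<kappa> * norm (\<Sum>j=3..<m. bump_hilbert (x - L * real j)) - E \<le> norm (response N x)"
    using response_lower by blast
  obtain M0 where M0: "\<And>n. n \<ge> M0 \<Longrightarrow> harm n \<ge> ((K + E) / \<kappa> + D) / c"
    using harm_at_top unfolding filterlim_at_top eventually_sequentially by blast
  have "K \<le> norm (response N x)" if "M0 + 3 \<le> m" "m < N" "\<bar>x - L * real m\<bar> \<le> r" for m N x
  proof -
    have "((K + E) / \<kappa> + D) / c \<le> harm (m - 3)" using that by (intro M0) simp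
    then have "(K + E) / \<kappa> \<le> c * harm (m - 3) - D" using c by (simp add: field_simps)
    also have "\<dots> \<le> norm (\<Sum>j=3..<m. bump_hilbert (x - L * real j))" using that by (intro D) auto
    finally have "K + E \<le> \<kappa> * norm (\<Sum>j=3..<m. bump_hilbert (x - L * real j))"
      using \<kappa> by (simp add: divide_le_eq mult.commute)
    with E[of m N x] that show ?thesis by simp
  qed
  then show ?thesis by (intro exI[of _ "M0 + 3"]) auto
qed

end

section \<open>From pointwise bounds to Lebesgue norms\<close>

lemma Lp_norm_le_of_bounds:
  fixes p :: ennreal
  assumes p: "1 \<le> p" and f: "f \<in> borel_measurable borel"
    and bound: "\<And>x. norm (f x) \<le> A" and "A \<ge> 1" and int: "integrable lborel f"
    and L1: "(LINT x|lborel. norm (f x)) \<le> n * G" and "G \<ge> 1" "n \<ge> 1"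
  shows "Lp_norm p f \<le> ennreal (A * G * n powr enn2real (1 / p))"
proof (cases "p = \<infinity>")
  case True
  have "esssup lborel (\<lambda>x. ennreal (norm (f x))) \<le> ennreal A"
    using f bound by (intro esssup_I) (auto intro!: ennreal_leI)
  also have "\<dots> \<le> ennreal (A * G)"
    using \<open>A \<ge> 1\<close> \<open>G \<ge> 1\<close> mult_left_mono[of 1 G A] by (intro ennreal_leI) auto
  finally show ?thesis using True \<open>n \<ge> 1\<close> by (simp add: Lp_norm_def)
next
  case False
  define q where "q = enn2real p"
  have p_eq: "p = ennreal q" using False by (simp add: q_def less_top)
  have q: "q \<ge> 1" using p unfolding p_eq by (simp add: ennreal_ge_1)
  have inv: "enn2real (1 / p) = 1 / q"
    using q by (simp add: p_eq divide_ennreal flip: ennreal_1)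
  have A0: "A > 0" and G0: "G > 0" and n0: "n > 0" using assms by auto
  let ?I = "\<integral>\<^sup>+ x. ennreal (norm (f x) powr q) \<partial>lborel"
  \<comment> \<open>Interpolation between the supremum and the integral: |f|^q <= A^(q-1)
    |f|.\<close>
  have "?I \<le> (\<integral>\<^sup>+ x. ennreal (A powr (q - 1)) * ennreal (norm (f x)) \<partial>lborel)"
  proof (rule nn_integral_mono)
    fix x
    have "norm (f x) powr q \<le> A powr (q - 1) * norm (f x)"
    proof (cases "f x = 0")
      case False
      then have "norm (f x) powr q = norm (f x) powr (q - 1) * norm (f x)"
        using powr_add[of "norm (f x)" "q - 1" 1] by simp
      also have "\<dots> \<le> A powr (q - 1) * norm (f x)"
        using q bound by (intro mult_right_mono powr_mono2) auto
      finally show ?thesis .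
    qed simp
    then show "ennreal (norm (f x) powr q) \<le> ennreal (A powr (q - 1)) * ennreal (norm (f x))"
      by (simp add: ennreal_leI flip: ennreal_mult)
  qed
  also have "\<dots> = ennreal (A powr (q - 1)) * ennreal (LINT x|lborel. norm (f x))"
    using int f by (simp add: nn_integral_cmult nn_integral_eq_integral)
  also have "\<dots> = ennreal (A powr (q - 1) * (LINT x|lborel. norm (f x)))"
    by (simp add: ennreal_mult)
  \<comment> \<open>Since \<open>A\<close> and \<open>G\<close> are at least 1, both may be raised
    to the power q, so that the q-th root is \<open>A * G\<close> times n^(1/q) with a constant free
    of q.\<close>
  also have "\<dots> \<le> ennreal (A powr q * (n * G powr q))"
  proof (intro ennreal_leI mult_mono)
    show "A powr (q - 1) \<le> A powr q" using \<open>A \<ge> 1\<close> by (intro powr_mono) auto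
    have "G powr 1 \<le> G powr q" using \<open>G \<ge> 1\<close> q by (intro powr_mono) auto
    then have "n * G \<le> n * G powr q" using G0 n0 by (intro mult_left_mono) auto
    with L1 show "(LINT x|lborel. norm (f x)) \<le> n * G powr q" by simp
  qed auto
  finally have I: "?I \<le> ennreal (A powr q * (n * G powr q))" .
  then have fin: "?I \<noteq> \<infinity>" using le_less_trans[OF I ennreal_less_top] by auto
  have "enn2real ?I \<le> A powr q * (n * G powr q)"
    using I n0 by (intro enn2real_leI) auto
  then have "enn2real ?I powr (1 / q) \<le> (A powr q * (n * G powr q)) powr (1 / q)"
    using q by (intro powr_mono2) auto
  also have "\<dots> = A * G * n powr (1 / q)"
    using A0 G0 n0 q by (simp add: powr_mult powr_powr)
  finally have "enn2real ?I powr (1 / q) \<le> A * G * n powr (1 / q)" .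
  then show ?thesis
    using False fin by (simp add: Lp_norm_def Let_def inv ennreal_leI flip: q_def)
qed

text \<open>As L > 2 r the intervals are disjoint, so the integral is at least K^q times their total
  length. This works for every q > 0; for p = \<infinity> a single interval suffices, since it is
  not a null set.\<close>

lemma Lp_norm_ge_of_intervals:
  fixes p :: ennreal
  assumes p: "p \<noteq> 0" and "K > 0" "L > 2 * r" "r > 0" "finite I" "I \<noteq> {}"
    and bound: "\<And>m x. m \<in> I \<Longrightarrow> \<bar>x - L * real m\<bar> \<le> r \<Longrightarrow> K \<le> norm (f x)"
  shows "Lp_norm p f \<ge> ennreal (K * (2 * r * real (card I)) powr enn2real (1 / p))"
proof (cases "p = \<infinity>")
  case True
  obtain m where m: "m \<in> I" using \<open>I \<noteq> {}\<close> by blast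
  let ?B = "{L * real m - r..L * real m + r}"
  have "ennreal K \<le> esssup lborel (\<lambda>x. ennreal (norm (f x)))"
  proof (rule ccontr)
    assume "\<not> ?thesis"
    then have less: "esssup lborel (\<lambda>x. ennreal (norm (f x))) < ennreal K" by simp
    have "AE x in lborel. x \<notin> ?B"
      using esssup_AE[of "\<lambda>x. ennreal (norm (f x))" lborel]
    proof eventually_elim
      case (elim x)
      then have "ennreal (norm (f x)) < ennreal K" using less by (rule le_less_trans)
      then have "norm (f x) < K" by (simp add: ennreal_less_iff)
      then show ?case using bound[OF m, of x] by (auto simp: abs_le_iff)
    qed
    then have "?B \<in> null_sets lborel" by (subst AE_iff_null_sets) auto
    then have "emeasure lborel ?B = 0" by (rule null_setsD1)
    then show False using \<open>r > 0\<close> by simp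
  qed
  then show ?thesis using True \<open>r > 0\<close> m \<open>finite I\<close> by (auto simp: Lp_norm_def card_gt_0_iff)
next
  case False
  define q where "q = enn2real p"
  have p_eq: "p = ennreal q" using False by (simp add: q_def less_top)
  have q: "q > 0" using p False by (simp add: q_def enn2real_positive_iff less_top zero_less_iff_neq_zero)
  have inv: "enn2real (1 / p) = 1 / q"
    using q by (simp add: p_eq divide_ennreal flip: ennreal_1)
  define B where "B m = {L * real m - r..L * real m + r}" for m :: nat
  let ?I = "\<integral>\<^sup>+ x. ennreal (norm (f x) powr q) \<partial>lborel"
  have disj: "m = m'" if "x \<in> B m" "x \<in> B m'" for x m m'
  proof -
    have "\<not> i < j" if "x \<in> B i" "x \<in> B j" for i j :: nat
    proof
      assume "i < j"
      then have "L * (real i + 1) \<le> L * real j"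
        using assms by (intro mult_left_mono) auto
      then show False using that \<open>L > 2 * r\<close> by (simp add: B_def algebra_simps)
    qed
    from this[OF that] this[OF that(2,1)] show ?thesis by simp
  qed
  have "ennreal (K powr q * (2 * r * real (card I))) =
      (\<Sum>m\<in>I. ennreal (K powr q) * emeasure lborel (B m))"
    using \<open>r > 0\<close> by (simp add: B_def ennreal_mult mult_ac flip: ennreal_of_nat_eq_real_of_nat)
  also have "\<dots> = (\<integral>\<^sup>+ x. (\<Sum>m\<in>I. ennreal (K powr q) * indicator (B m) x) \<partial>lborel)"
    by (subst nn_integral_sum) (auto simp: B_def nn_integral_cmult_indicator)
  also have "\<dots> \<le> ?I"
  proof (rule nn_integral_mono)
    fix x
    show "(\<Sum>m\<in>I. ennreal (K powr q) * indicator (B m) x) \<le> ennreal (norm (f x) powr q)"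
    proof (cases "\<exists>m\<in>I. x \<in> B m")
      case True
      then obtain m where m: "m \<in> I" "x \<in> B m" by blast
      have "ennreal (K powr q) * indicator (B k) x = (if k = m then ennreal (K powr q) else 0)" for k
      proof (cases "k = m")
        case False
        then have "x \<notin> B k" using disj m(2) by blast
        then show ?thesis using False by simp
      qed (use m(2) in simp)
      then have "(\<Sum>m\<in>I. ennreal (K powr q) * indicator (B m) x) = ennreal (K powr q)"
        using m(1) \<open>finite I\<close> by simp
      also have "\<dots> \<le> ennreal (norm (f x) powr q)"
        using bound[OF m(1), of x] m(2) \<open>K > 0\<close> q
        by (intro ennreal_leI powr_mono2) (auto simp: B_def abs_le_iff)
      finally show ?thesis .
    next
      case False
      then have "(\<Sum>m\<in>I. ennreal (K powr q) * indicator (B m) x) = 0"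
        by (intro sum.neutral) auto
      then show ?thesis by simp
    qed
  qed
  finally have I: "ennreal (K powr q * (2 * r * real (card I))) \<le> ?I" .
  show ?thesis
  proof (cases "?I = \<infinity>")
    case True
    then show ?thesis using False by (simp add: Lp_norm_def Let_def flip: q_def)
  next
    case fin: False
    have "K powr q * (2 * r * real (card I)) \<le> enn2real ?I"
      using enn2real_mono[OF I] fin \<open>r > 0\<close> by (simp add: less_top)
    then have "(K powr q * (2 * r * real (card I))) powr (1 / q) \<le> enn2real ?I powr (1 / q)"
      using q \<open>r > 0\<close> by (intro powr_mono2) auto
    moreover have "(K powr q * (2 * r * real (card I))) powr (1 / q) =
        K * (2 * r * real (card I)) powr (1 / q)"
      using q \<open>K > 0\<close> \<open>r > 0\<close> by (subst powr_mult) (auto simp: powr_powr)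
    ultimately show ?thesis
      using False fin by (simp add: Lp_norm_def Let_def inv ennreal_leI flip: q_def)
  qed
qed

text \<open>By the relation between the exponents both sides carry the same power N^s. After
  cancellation the assumed estimate bounds \<open>K\<close> by a constant, although the response can
  exceed any prescribed level.\<close>

lemma (in packet_spacing) no_Lp_estimates: "satisfies_no_Lp_estimates (T_op multiplier)"
  unfolding satisfies_no_Lp_estimates_def
proof (intro notI, elim exE conjE)
  fix p\<^sub>1 p\<^sub>2 p\<^sub>3 p :: ennreal and C0 :: real
  assume p: "1 \<le> p\<^sub>1" "1 \<le> p\<^sub>2" "1 \<le> p\<^sub>3" and hoelder: "1 / p = 1 / p\<^sub>1 + 1 / p\<^sub>2 + 1 / p\<^sub>3"
    and est: "\<forall>f\<^sub>1 f\<^sub>2 f\<^sub>3. schwartz f\<^sub>1 \<and> schwartz f\<^sub>2 \<and> schwartz f\<^sub>3 \<longrightarrow>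
      Lp_norm p (T_op multiplier f\<^sub>1 f\<^sub>2 f\<^sub>3) \<le> ennreal C0 * (Lp_norm p\<^sub>1 f\<^sub>1 * Lp_norm p\<^sub>2 f\<^sub>2 * Lp_norm p\<^sub>3 f\<^sub>3)"
  \<comment> \<open>\<open>ennreal\<close> sends negative reals to 0, so the constant may be taken
    nonnegative.\<close>
  define C where "C = max 0 C0"
  have C: "C \<ge> 0" "ennreal C0 = ennreal C" by (auto simp: C_def ennreal_neg max_def)
  have inv_fin: "1 / q < top" if "1 \<le> q" for q :: ennreal
    using that by (auto simp: ennreal_divide_eq_top_iff simp flip: less_top)
  define s where "s = enn2real (1 / p)"
  have s: "s = enn2real (1 / p\<^sub>1) + enn2real (1 / p\<^sub>2) + enn2real (1 / p\<^sub>3)"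
    using inv_fin[OF p(1)] inv_fin[OF p(2)] inv_fin[OF p(3)]
    by (simp add: s_def hoelder enn2real_plus ennreal_add_less_top)
  have "1 / p < top"
    unfolding hoelder using inv_fin[OF p(1)] inv_fin[OF p(2)] inv_fin[OF p(3)] by simp
  then have "p \<noteq> 0" by auto
  define G where "G = max 1 (LINT x|lborel. norm (g x))"
  define B where "B = max 1 (A + \<tau>)"
  define D where "D = B * G"
  have GB: "G \<ge> 1" "B \<ge> 1" by (auto simp: G_def B_def)
  then have D: "D > 0" by (simp add: D_def)
  \<comment> \<open>The first summand is the level that would just balance the upper bound after
    cancelling N^s; adding 1 makes the contradiction strict.\<close>
  define K where "K = C * (D * D * D) / r powr s + 1"
  have K: "K > 0" using C D r by (simp add: K_def add_nonneg_pos)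
  obtain M where M: "M \<ge> 1" "\<And>m N x. M \<le> m \<Longrightarrow> m < N \<Longrightarrow> \<bar>x - L * real m\<bar> \<le> r \<Longrightarrow> K \<le> norm (response N x)"
    using response_unbounded by blast
  \<comment> \<open>Half of the indices then lie beyond the threshold, and the intervals around
    their centres have total length 2 r M = r N.\<close>
  define N where "N = 2 * M"
  have upper: "Lp_norm q (superposition P {3..<N}) \<le> ennreal (D * real N powr enn2real (1 / q))"
    if "1 \<le> q" and P: "\<And>j. test_function (P j)" "\<And>j x. norm (inv_fourier (P j) x) = norm (g (x - L * real j))"
    for q :: ennreal and P
    unfolding D_def
  proof (rule Lp_norm_le_of_bounds)
    have test: "test_function (\<lambda>\<xi>. \<Sum>j\<in>{3..<N}. P j \<xi>)" by (intro test_function_sum P)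
    show "superposition P {3..<N} \<in> borel_measurable borel"
      unfolding superposition_def by (intro borel_measurable_continuous_onI inv_fourier_continuous test)
    show "integrable lborel (superposition P {3..<N})"
      unfolding superposition_def by (rule inv_fourier_integrable_self[OF test])
    show "norm (superposition P {3..<N} x) \<le> B" for x
      using superposition_bound[of "{3..<N}" P x] P by (simp add: B_def)
    have "(LINT x|lborel. norm (superposition P {3..<N} x)) \<le> real (N - 3) * (LINT x|lborel. norm (g x))"
      using superposition_integral[of "{3..<N}" P] P by simp
    also have "\<dots> \<le> real N * G" by (intro mult_mono) (auto simp: G_def)
    finally show "(LINT x|lborel. norm (superposition P {3..<N} x)) \<le> real N * G" .
  qed (use that GB M in \<open>auto simp: N_def\<close>)
  let ?f1 = "superposition (packet1 L) {3..<N}" and ?f2 = "superposition (packet2 L) {3..<N}"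
    and ?f3 = "superposition (packet3 L) {3..<N}"
  have "schwartz (superposition P {3..<N})" if "\<And>j. test_function (P j)" for P
    unfolding superposition_def by (intro schwartz_inv_fourier test_function_sum that)
  then have "Lp_norm p (response N) \<le> ennreal C * (Lp_norm p\<^sub>1 ?f1 * Lp_norm p\<^sub>2 ?f2 * Lp_norm p\<^sub>3 ?f3)"
    using est C(2) test_function_packets by auto
  also have "\<dots> \<le> ennreal C * (ennreal (D * real N powr enn2real (1 / p\<^sub>1)) *
      ennreal (D * real N powr enn2real (1 / p\<^sub>2)) * ennreal (D * real N powr enn2real (1 / p\<^sub>3)))"
    by (intro mult_left_mono mult_mono upper p) (auto simp: test_function_packets packets_norm g_def)
  also have "\<dots> = ennreal (C * (D * D * D) * real N powr s)"
    using C(1) D by (simp add: s powr_add mult_ac flip: ennreal_mult)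
  finally have up: "Lp_norm p (response N) \<le> ennreal (C * (D * D * D) * real N powr s)" .
  have "ennreal (K * (2 * r * real (card {M..<N})) powr enn2real (1 / p)) \<le> Lp_norm p (response N)"
    using \<open>p \<noteq> 0\<close> K r L M by (intro Lp_norm_ge_of_intervals) (auto simp: N_def)
  then have "ennreal (K * (r * real N) powr s) \<le> ennreal (C * (D * D * D) * real N powr s)"
    using up by (simp add: s_def N_def mult_ac)
  then have "K * (r * real N) powr s \<le> C * (D * D * D) * real N powr s"
    using C D by (subst (asm) ennreal_le_iff) auto
  then have "(K * r powr s) * real N powr s \<le> (C * (D * D * D)) * real N powr s"
    using r by (simp add: powr_mult mult.assoc)
  then have "K * r powr s \<le> C * (D * D * D)"
    using M by (simp add: N_def)
  then show False
    using r by (simp add: K_def distrib_right)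
qed

theorem theorem2:
  shows "\<exists>a :: real \<times> real \<Rightarrow> real.
    phi_psi_type a \<and> hoermander_marcinkiewicz a \<and>
    satisfies_no_Lp_estimates
      (T_op (\<lambda>(\<xi>\<^sub>1, \<xi>\<^sub>2, \<xi>\<^sub>3). complex_of_real (sgn (\<xi>\<^sub>1 + \<xi>\<^sub>2) * a (\<xi>\<^sub>2, \<xi>\<^sub>3))))"
proof (intro exI[of _ symbol] conjI)
  show "phi_psi_type symbol" "hoermander_marcinkiewicz symbol"
    unfolding symbol_def
    by (intro phi_psi_type_dyadic_symbol hoermander_marcinkiewicz_dyadic_symbol
        low_window_bump high_window_high_bump)+
  obtain L r A \<tau> \<kappa> where "packet_spacing (inv_fourier cbump) L r A \<tau> \<kappa>"
    using packet_spacing_exists by blast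
  from packet_spacing.no_Lp_estimates[OF this]
  show "satisfies_no_Lp_estimates
      (T_op (\<lambda>(\<xi>\<^sub>1, \<xi>\<^sub>2, \<xi>\<^sub>3). complex_of_real (sgn (\<xi>\<^sub>1 + \<xi>\<^sub>2) * symbol (\<xi>\<^sub>2, \<xi>\<^sub>3))))"
    by (simp only: multiplier_def)
qed

end
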